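(* There exist constants $C, h_0>0$ such that for every $h\in(0,h_0]$ and every $N\in\mathbb N$ we have $\lambda^{(2)}_{h,N}\geq C$.
   Context: Fix $\mu>1$. For $N\in\mathbb N$ let $V_N:\mathbb R^N\to[0,\infty)$, $V_N(x)=\sum_{k=1}^N\frac14(x_k^2-1)^2+\frac{\mu}{8\sin^2(\pi/N)}\sum_{k=1}^N(x_k-x_{k+1})^2$, with the convention $x_{N+1}:=x_1$. Let $C_b^\infty(\mathbb R^N)$ be the space of smooth real functions on $\mathbb R^N$ bounded together with all their derivatives. For $h>0$ and $f\in C_b^\infty(\mathbb R^N)$ set $\mathcal E_{h,N}[f]=hN\int_{\mathbb R^N}|\nabla f|^2e^{-V_N/(hN)}dx$. For a finite-dimensional linear subspace $S\subset C_b^\infty(\mathbb R^N)$ let $\kappa^{(S)}_{h,N}=\sup\{\mathcal E_{h,N}[f]: f\in S,\ \int f^2e^{-V_N/(hN)}dx=1\}$, and for $j\in\mathbb N_0$ let $\lambda^{(j)}_{h,N}=\inf\{\kappa^{(S)}_{h,N}: S\subset C_b^\infty(\mathbb R^N)\text{ linear subspace},\ \dim S=j+1\}$. *)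

theory Defs
  imports "HOL-Analysis.Analysis"
begin

text \<open>Points of R^N are represented as extensional functions nat => real supported
on {..<N}, i.e. elements of the carrier below; coordinates x_1..x_N are x 0..x (N-1).\<close>

definition RN :: "nat \<Rightarrow> (nat \<Rightarrow> real) set" where
  "RN N = PiE {..<N} (\<lambda>_. UNIV)"

definition lebN :: "nat \<Rightarrow> (nat \<Rightarrow> real) measure" where
  "lebN N = PiM {..<N} (\<lambda>_. lborel)"

definition VN :: "real \<Rightarrow> nat \<Rightarrow> (nat \<Rightarrow> real) \<Rightarrow> real" where
  "VN \<mu> N x = (\<Sum>k<N. (x k ^ 2 - 1) ^ 2 / 4)
      + \<mu> / (8 * (sin (pi / real N)) ^ 2) * (\<Sum>k<N. (x k - x ((k + 1) mod N)) ^ 2)"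

definition weight :: "real \<Rightarrow> real \<Rightarrow> nat \<Rightarrow> (nat \<Rightarrow> real) \<Rightarrow> real" where
  "weight \<mu> h N x = exp (- VN \<mu> N x / (h * real N))"

definition partial :: "nat \<Rightarrow> ((nat \<Rightarrow> real) \<Rightarrow> real) \<Rightarrow> (nat \<Rightarrow> real) \<Rightarrow> real" where
  "partial k f x = deriv (\<lambda>t. f (x(k := t))) (x k)"

definition iter_partial :: "nat list \<Rightarrow> ((nat \<Rightarrow> real) \<Rightarrow> real) \<Rightarrow> (nat \<Rightarrow> real) \<Rightarrow> real" where
  "iter_partial ks f = foldr partial ks f"

text \<open>C_b^infty(R^N): all iterated partial derivatives exist, are continuous and bounded
(existence and continuity of all iterated partials is equivalent to smoothness).\<close>
definition Cb_inf :: "nat \<Rightarrow> ((nat \<Rightarrow> real) \<Rightarrow> real) \<Rightarrow> bool" where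
  "Cb_inf N f \<longleftrightarrow> (\<forall>ks. set ks \<subseteq> {..<N} \<longrightarrow>
      continuous_on (RN N) (iter_partial ks f) \<and>
      (\<exists>B. \<forall>x\<in>RN N. \<bar>iter_partial ks f x\<bar> \<le> B) \<and>
      (\<forall>k<N. \<forall>x\<in>RN N. (\<lambda>t. iter_partial ks f (x(k := t))) differentiable (at (x k))))"

definition energy :: "real \<Rightarrow> real \<Rightarrow> nat \<Rightarrow> ((nat \<Rightarrow> real) \<Rightarrow> real) \<Rightarrow> real" where
  "energy \<mu> h N f = h * real N *
     (\<integral>x. (\<Sum>k<N. (partial k f x) ^ 2) * weight \<mu> h N x \<partial>lebN N)"

definition wnorm2 :: "real \<Rightarrow> real \<Rightarrow> nat \<Rightarrow> ((nat \<Rightarrow> real) \<Rightarrow> real) \<Rightarrow> real" where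
  "wnorm2 \<mu> h N f = (\<integral>x. (f x) ^ 2 * weight \<mu> h N x \<partial>lebN N)"

text \<open>A (j+1)-dimensional subspace S of C_b^infty is given by a basis g 0, ..., g j,
linearly independent as functions on R^N; S = span of the g i.\<close>
definition lin_indep_on :: "nat \<Rightarrow> nat \<Rightarrow> (nat \<Rightarrow> (nat \<Rightarrow> real) \<Rightarrow> real) \<Rightarrow> bool" where
  "lin_indep_on N m g \<longleftrightarrow>
     (\<forall>c::nat \<Rightarrow> real. (\<forall>x\<in>RN N. (\<Sum>i<m. c i * g i x) = 0) \<longrightarrow> (\<forall>i<m. c i = 0))"

definition kappa :: "real \<Rightarrow> real \<Rightarrow> nat \<Rightarrow> nat \<Rightarrow> (nat \<Rightarrow> (nat \<Rightarrow> real) \<Rightarrow> real) \<Rightarrow> real" where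
  "kappa \<mu> h N m g = Sup {energy \<mu> h N f | f. (\<exists>c::nat \<Rightarrow> real. f = (\<lambda>x. \<Sum>i<m. c i * g i x))
                                            \<and> wnorm2 \<mu> h N f = 1}"

definition lambda_ev :: "real \<Rightarrow> real \<Rightarrow> nat \<Rightarrow> nat \<Rightarrow> real" where
  "lambda_ev \<mu> h N j = Inf {kappa \<mu> h N (j + 1) g | g.
      (\<forall>i<j + 1. Cb_inf N (g i)) \<and> lin_indep_on N (j + 1) g}"

end

theory Submission
  imports Defs "HOL-Probability.Distributions"
begin

text \<open>Adding \<open>\<mu> N (\<xi> - mean x)\<^sup>2 / 2\<close> to the potential couples the chain to a scalar field \<open>\<xi>\<close>;
  integrating over \<open>\<xi>\<close> gives back the original weight up to a constant. At fixed \<open>\<xi>\<close> the potential is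
  uniformly convex, since by the discrete Wirtinger inequality the coupling beats the concave part of the
  double well, so the Prekopa-Leindler inequality yields a Poincare inequality with constant
  \<open>h N / (\<mu> - 1)\<close> and moment bounds for coordinates and mean, all uniform in \<open>N\<close>. What remains is the
  conditional expectation \<open>F \<xi>\<close> of the test function. Its derivative is a covariance with the mean, hence
  controlled by the conditional variance. The field itself sees a double well with minima near \<open>1\<close> and \<open>-1\<close>:
  the moment bounds locate its critical points up to \<open>O(h)\<close>, and a Cramer-Rao bound makes it concave
  near \<open>0\<close>. If \<open>F\<close> vanishes at \<open>1\<close> and \<open>-1\<close>, a one-dimensional Poincare inequality closes the estimate.
  These are two linear conditions, so every three-dimensional space contains a function satisfying them.\<close>

section \<open>The Prekopa-Leindler inequality\<close>

text \<open>The double well has curvature at least -1 at each site; the Hessian of the coupling is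
  at least \<mu> orthogonally to the constants and 0 on them. The mean is thus the one direction in
  which nothing opposes the concave part, and a field term of the same stiffness \<mu> in that
  direction makes the Hessian at least \<mu> - 1 for every N. As the temperature is h N, the
  Gaussian factor of the field has variance h / \<mu>, whatever N is. Strong convexity alone would
  only bound the variance of a coordinate by a multiple of h N. The missing factor 1 / N comes from
  keeping part of the coupling, whose prefactor grows like N^2, and from a discrete Sobolev
  inequality. This is what locates the critical points of the field's potential and controls its
  curvature uniformly in N. Convexity enters only through midpoints: Prekopa-Leindler with weight
  1/2 bounds a product of two exponential moments, and suitable test functions in it give both the
  moment bounds and the Poincare inequality. The points 1 and -1 need not be critical for the field,
  but the slope there is small on the scale sqrt h, which suffices.\<close>

lemma compact_midpoint_emeasure:
  fixes K L C :: "real set"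
  assumes "compact K" "compact L" "K \<noteq> {}" "L \<noteq> {}"
    and C: "C \<in> sets borel" and mid: "\<And>a b. a \<in> K \<Longrightarrow> b \<in> L \<Longrightarrow> (a + b) / 2 \<in> C"
  shows "emeasure lborel K + emeasure lborel L \<le> 2 * emeasure lborel C"
proof -
  obtain l where l: "l \<in> L" "\<And>x. x \<in> L \<Longrightarrow> l \<le> x"
    using compact_attains_inf[OF \<open>compact L\<close> \<open>L \<noteq> {}\<close>] by auto
  obtain k where k: "k \<in> K" "\<And>x. x \<in> K \<Longrightarrow> x \<le> k"
    using compact_attains_sup[OF \<open>compact K\<close> \<open>K \<noteq> {}\<close>] by auto
  have [measurable]: "K \<in> sets borel" "L \<in> sets borel" "C \<in> sets borel"
    using assms by (auto intro: borel_compact)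
  have "emeasure lborel K = (\<integral>\<^sup>+z. indicator K z \<partial>lborel)" by simp
  also have "\<dots> = ennreal \<bar>2\<bar> * (\<integral>\<^sup>+z. indicator K (- l + 2 * z) \<partial>lborel)"
    by (rule nn_integral_real_affine) auto
  finally have 1: "emeasure lborel K = 2 * (\<integral>\<^sup>+z. indicator K (- l + 2 * z) \<partial>lborel)" by simp
  have "emeasure lborel L = (\<integral>\<^sup>+z. indicator L z \<partial>lborel)" by simp
  also have "\<dots> = ennreal \<bar>2\<bar> * (\<integral>\<^sup>+z. indicator L (- k + 2 * z) \<partial>lborel)"
    by (rule nn_integral_real_affine) auto
  finally have 2: "emeasure lborel L = 2 * (\<integral>\<^sup>+z. indicator L (- k + 2 * z) \<partial>lborel)" by simp
  \<comment> \<open>These are the indicators of the half-size copies (K + l) / 2 and (k + L) / 2.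
    Both lie in \<open>C\<close>, one to the left and one to the right of (k + l) / 2, so they
    overlap in at most that point.\<close>
  have ae: "AE z in lborel. (indicator K (- l + 2 * z) + indicator L (- k + 2 * z) :: ennreal) \<le> indicator C z"
  proof (rule AE_mp[OF AE_lborel_singleton[of "(k + l) / 2"]], rule AE_I2, rule impI)
    fix z :: real assume z: "z \<noteq> (k + l) / 2"
    have "- l + 2 * z \<in> K \<Longrightarrow> z \<in> C" using mid[of "- l + 2 * z" l] l by simp
    moreover have "- k + 2 * z \<in> L \<Longrightarrow> z \<in> C" using mid[of k "- k + 2 * z"] k by simp
    moreover have "\<not> (- l + 2 * z \<in> K \<and> - k + 2 * z \<in> L)"
      using k(2)[of "- l + 2 * z"] l(2)[of "- k + 2 * z"] z by auto
    ultimately show "(indicator K (- l + 2 * z) + indicator L (- k + 2 * z) :: ennreal) \<le> indicator C z"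
      by (auto simp: indicator_def)
  qed
  have "emeasure lborel K + emeasure lborel L
      = 2 * (\<integral>\<^sup>+z. indicator K (- l + 2 * z) + indicator L (- k + 2 * z) \<partial>lborel)"
    unfolding 1 2 by (subst nn_integral_add) (auto simp: distrib_left)
  also have "\<dots> \<le> 2 * (\<integral>\<^sup>+z. indicator C z \<partial>lborel)"
    by (intro mult_left_mono nn_integral_mono_AE ae) auto
  finally show ?thesis by simp
qed

text \<open>Inner regularity reduces this to compact sets. The target is any Borel set containing
  the midpoints, so measurability of the Minkowski average never has to be proved.\<close>

lemma midpoint_emeasure:
  fixes A B C :: "real set"
  assumes A: "A \<in> sets borel" "bounded A" "A \<noteq> {}" and B: "B \<in> sets borel" "bounded B" "B \<noteq> {}"
    and C: "C \<in> sets borel" and mid: "\<And>a b. a \<in> A \<Longrightarrow> b \<in> B \<Longrightarrow> (a + b) / 2 \<in> C"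
  shows "emeasure lborel A + emeasure lborel B \<le> 2 * emeasure lborel C"
proof (rule ennreal_le_epsilon)
  fix e :: real assume e: "0 < e"
  have *: "\<exists>K. compact K \<and> K \<noteq> {} \<and> K \<subseteq> S \<and> emeasure lborel S \<le> emeasure lborel K + ennreal (e/2)"
    if S: "S \<in> sets borel" "bounded S" "S \<noteq> {}" for S :: "real set"
  proof -
    obtain T where "closed T" "T \<subseteq> S" "emeasure lebesgue (S - T) < ennreal (e/2)"
      by (rule sets_lebesgue_inner_closed[of S "e/2"]) (use S e in auto)
    hence T: "compact T" "T \<subseteq> S" "emeasure lebesgue (S - T) < ennreal (e/2)"
      using S by (auto simp: compact_eq_bounded_closed intro: bounded_subset)
    \<comment> \<open>The compact approximation may be empty, so a point of \<open>S\<close> is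
      added to it.\<close>
    obtain s where s: "s \<in> S" using S by auto
    have cK: "compact (insert s T)" using T by (auto intro: compact_insert)
    hence [measurable]: "insert s T \<in> sets borel" by (rule borel_compact)
    have [measurable]: "T \<in> sets borel" using T(1) by (rule borel_compact)
    have [measurable]: "S \<in> sets borel" by fact
    have "emeasure lborel S \<le> emeasure lborel (insert s T) + emeasure lborel (S - T)"
      using s T(2) by (intro order.trans[OF _ emeasure_subadditive] emeasure_mono) auto
    also have "emeasure lborel (S - T) = emeasure lebesgue (S - T)"
      by simp
    also have "emeasure lborel (insert s T) + emeasure lebesgue (S - T)
      \<le> emeasure lborel (insert s T) + ennreal (e/2)"
      using T(3) by (intro add_left_mono) simp
    finally show ?thesis using cK T(2) s by (intro exI[of _ "insert s T"]) auto
  qed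
  obtain K where K: "compact K" "K \<noteq> {}" "K \<subseteq> A" "emeasure lborel A \<le> emeasure lborel K + ennreal (e/2)"
    using *[OF A] by auto
  obtain L where L: "compact L" "L \<noteq> {}" "L \<subseteq> B" "emeasure lborel B \<le> emeasure lborel L + ennreal (e/2)"
    using *[OF B] by auto
  have "emeasure lborel A + emeasure lborel B
      \<le> (emeasure lborel K + ennreal (e/2)) + (emeasure lborel L + ennreal (e/2))"
    by (intro add_mono K L)
  also have "\<dots> = (emeasure lborel K + emeasure lborel L) + (ennreal (e/2) + ennreal (e/2))"
    by (simp add: ac_simps)
  also have "ennreal (e/2) + ennreal (e/2) = ennreal e"
    using e by (simp flip: ennreal_plus)
  also have "emeasure lborel K + emeasure lborel L \<le> 2 * emeasure lborel C"
    using K L mid by (intro compact_midpoint_emeasure C) auto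
  finally show "emeasure lborel A + emeasure lborel B \<le> 2 * emeasure lborel C + ennreal e"
    by (simp add: add_right_mono)
qed

lemma nn_integral_layer_cake_unit:
  fixes f :: "real \<Rightarrow> real"
  assumes [measurable]: "f \<in> borel_measurable borel" and "\<And>x. 0 \<le> f x"
  shows "(\<integral>\<^sup>+s\<in>{0<..<1}. emeasure lborel {x. s < f x} \<partial>lborel) = (\<integral>\<^sup>+x. ennreal (min 1 (f x)) \<partial>lborel)"
proof -
  have "(\<integral>\<^sup>+s\<in>{0<..<1}. emeasure lborel {x. s < f x} \<partial>lborel)
     = (\<integral>\<^sup>+s. (\<integral>\<^sup>+x. indicator {0<..<1} s * indicator {x. s < f x} x \<partial>lborel) \<partial>lborel)"
    by (intro nn_integral_cong, subst nn_integral_cmult) (auto simp: mult.commute)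
  also have "\<dots> = (\<integral>\<^sup>+x. (\<integral>\<^sup>+s. indicator {0<..<1} s * indicator {x. s < f x} x \<partial>lborel) \<partial>lborel)"
    by (rule lborel_pair.Fubini') simp
  also have "\<dots> = (\<integral>\<^sup>+x. ennreal (min 1 (f x)) \<partial>lborel)"
  proof (rule nn_integral_cong)
    fix x :: real
    have "(\<integral>\<^sup>+s. indicator {0<..<1} s * indicator {x. s < f x} x \<partial>lborel)
      = (\<integral>\<^sup>+s. indicator {0<..<min 1 (f x)} s \<partial>lborel)"
      by (intro nn_integral_cong) (auto simp: indicator_def)
    also have "\<dots> = emeasure lborel {0<..<min 1 (f x)}" by simp
    also have "\<dots> = ennreal (min 1 (f x))"
      using assms(2)[of x] by (simp del: min_less_iff_conj)
    finally show "(\<integral>\<^sup>+s. indicator {0<..<1} s * indicator {x. s < f x} x \<partial>lborel) = ennreal (min 1 (f x))" .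
  qed
  finally show ?thesis .
qed

text \<open>With both suprema equal to 1, all superlevel sets at heights below 1 are nonempty, and
  the midpoint hypothesis sends a pair of them into the superlevel set of \<open>k\<close> at the
  same height. The one-dimensional Brunn-Minkowski inequality thus applies at every height, and
  integration over heights gives a sum of integrals on the left.\<close>

lemma prekopa_leindler_normalized:
  fixes f g k :: "real \<Rightarrow> real"
  assumes meas [measurable]: "f \<in> borel_measurable borel" "g \<in> borel_measurable borel" "k \<in> borel_measurable borel"
    and nonneg: "\<And>x. 0 \<le> f x" "\<And>x. 0 \<le> g x" "\<And>x. 0 \<le> k x"
    and le1: "\<And>x. f x \<le> 1" "\<And>x. g x \<le> 1"
    and sup1: "\<And>s. s < 1 \<Longrightarrow> \<exists>x. s < f x" "\<And>s. s < 1 \<Longrightarrow> \<exists>x. s < g x"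
    and supp: "\<And>x. R < \<bar>x\<bar> \<Longrightarrow> f x = 0" "\<And>x. R < \<bar>x\<bar> \<Longrightarrow> g x = 0"
    and mid: "\<And>x y. f x * g y \<le> (k ((x + y) / 2))\<^sup>2"
  shows "(\<integral>\<^sup>+x. f x \<partial>lborel) + (\<integral>\<^sup>+x. g x \<partial>lborel) \<le> 2 * (\<integral>\<^sup>+x. k x \<partial>lborel)"
proof -
  have bd: "bounded {x. s < f x}" "bounded {x. s < g x}" if "0 < s" for s
    proof -
    have "\<bar>x\<bar> \<le> R" if "s < f x \<or> s < g x" for x
      using supp[of x] that \<open>0 < s\<close> by (cases "R < \<bar>x\<bar>") auto
    thus "bounded {x. s < f x}" "bounded {x. s < g x}" by (auto intro!: boundedI[of _ R])
  qed
  have "(\<integral>\<^sup>+x. f x \<partial>lborel) + (\<integral>\<^sup>+x. g x \<partial>lborel)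
     = (\<integral>\<^sup>+x. ennreal (min 1 (f x)) \<partial>lborel) + (\<integral>\<^sup>+x. ennreal (min 1 (g x)) \<partial>lborel)"
    using le1 by (simp add: min_absorb2)
  also have "\<dots> = (\<integral>\<^sup>+s\<in>{0<..<1}. emeasure lborel {x. s < f x} \<partial>lborel)
      + (\<integral>\<^sup>+s\<in>{0<..<1}. emeasure lborel {x. s < g x} \<partial>lborel)"
    using nonneg by (simp add: nn_integral_layer_cake_unit)
  also have "\<dots> = (\<integral>\<^sup>+s\<in>{0<..<1}. (emeasure lborel {x. s < f x} + emeasure lborel {x. s < g x}) \<partial>lborel)"
    by (subst nn_integral_add[symmetric]) (auto simp: distrib_right)
  also have "\<dots> \<le> (\<integral>\<^sup>+s. 2 * (emeasure lborel {x. s < k x} * indicator {0<..<1} s) \<partial>lborel)"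
  proof (rule nn_integral_mono)
    fix s :: real
    show "(emeasure lborel {x. s < f x} + emeasure lborel {x. s < g x}) * indicator {0<..<1} s
      \<le> 2 * (emeasure lborel {x. s < k x} * indicator {0<..<1} s)"
    proof (cases "s \<in> {0<..<1}")
      case True
      have "emeasure lborel {x. s < f x} + emeasure lborel {x. s < g x} \<le> 2 * emeasure lborel {x. s < k x}"
      proof (rule midpoint_emeasure)
        fix a b assume "a \<in> {x. s < f x}" "b \<in> {x. s < g x}"
        hence "s * s < f a * g b" using True by (intro mult_strict_mono) auto
        also note mid[of a b]
        finally have "s\<^sup>2 < (k ((a + b) / 2))\<^sup>2" by (simp add: power2_eq_square)
        thus "(a + b) / 2 \<in> {x. s < k x}" using nonneg(3) power_less_imp_less_base by auto
      qed (use True bd sup1 in auto)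
      thus ?thesis using True by simp
    qed auto
  qed
  also have "\<dots> = 2 * (\<integral>\<^sup>+s\<in>{0<..<1}. emeasure lborel {x. s < k x} \<partial>lborel)"
    by (rule nn_integral_cmult) simp
  also have "\<dots> = 2 * (\<integral>\<^sup>+x. ennreal (min 1 (k x)) \<partial>lborel)"
    using nonneg by (simp add: nn_integral_layer_cake_unit)
  also have "\<dots> \<le> 2 * (\<integral>\<^sup>+x. k x \<partial>lborel)"
    by (intro mult_left_mono nn_integral_mono) (auto intro: ennreal_leI)
  finally show ?thesis .
qed

text \<open>Dividing \<open>u\<close> and \<open>v\<close> by their suprema and \<open>w\<close> by
  the geometric mean \<open>q\<close> of these preserves the hypothesis. The arithmetic-geometric
  mean inequality then turns the sum of the normalised case into a product.\<close>

lemma prekopa_leindler_bounded: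
  fixes u v w :: "real \<Rightarrow> real"
  assumes meas [measurable]: "u \<in> borel_measurable borel" "v \<in> borel_measurable borel" "w \<in> borel_measurable borel"
    and nonneg: "\<And>x. 0 \<le> u x" "\<And>x. 0 \<le> v x" "\<And>x. 0 \<le> w x"
    and bdd: "\<And>x. u x \<le> B" "\<And>x. v x \<le> B"
    and supp: "\<And>x. R < \<bar>x\<bar> \<Longrightarrow> u x = 0" "\<And>x. R < \<bar>x\<bar> \<Longrightarrow> v x = 0"
    and mid: "\<And>x y. u x * v y \<le> (w ((x + y) / 2))\<^sup>2"
  shows "(\<integral>\<^sup>+x. u x \<partial>lborel) * (\<integral>\<^sup>+x. v x \<partial>lborel) \<le> (\<integral>\<^sup>+x. w x \<partial>lborel)\<^sup>2"
proof (cases "(\<forall>x. u x = 0) \<or> (\<forall>x. v x = 0)")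
  case True thus ?thesis by auto
next
  case False
  define su where "su = (SUP x. u x)"
  define sv where "sv = (SUP x. v x)"
  have bu: "bdd_above (range u)" and bv: "bdd_above (range v)" using bdd by (auto intro!: bdd_aboveI)
  have leu: "u x \<le> su" for x unfolding su_def by (rule cSUP_upper[OF _ bu]) simp
  have lev: "v x \<le> sv" for x unfolding sv_def by (rule cSUP_upper[OF _ bv]) simp
  obtain x0 y0 where "u x0 > 0" "v y0 > 0" using False nonneg by (metis less_le)
  hence pos: "su > 0" "sv > 0" using leu[of x0] lev[of y0] by auto
  define q where "q = sqrt (su * sv)"
  have q: "q > 0" "q\<^sup>2 = su * sv" unfolding q_def using pos by auto
  have fin: "(\<integral>\<^sup>+x. ennreal (f x) \<partial>lborel) < \<infinity>"
    if "f \<in> borel_measurable borel" "\<And>x. f x \<le> B" "\<And>x. R < \<bar>x\<bar> \<Longrightarrow> f x = 0" for f :: "real \<Rightarrow> real"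
  proof -
    have "(\<integral>\<^sup>+x. ennreal (f x) \<partial>lborel) \<le> (\<integral>\<^sup>+x. ennreal B * indicator {-R..R} x \<partial>lborel)"
    proof (rule nn_integral_mono)
      show "ennreal (f x) \<le> ennreal B * indicator {-R..R} x" for x
        using that(2,3)[of x] by (cases "R < \<bar>x\<bar>") (auto simp: indicator_def intro!: ennreal_leI)
    qed
    also have "\<dots> < \<infinity>" by (subst nn_integral_cmult_indicator)
        (auto simp: ennreal_mult_less_top emeasure_lborel_Icc_eq)
    finally show ?thesis .
  qed
  have "(\<integral>\<^sup>+x. u x / su \<partial>lborel) + (\<integral>\<^sup>+x. v x / sv \<partial>lborel) \<le> 2 * (\<integral>\<^sup>+x. w x / q \<partial>lborel)"
  proof (rule prekopa_leindler_normalized[where R = R])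
    show "\<exists>x. s < u x / su" if "s < 1" for s
    proof -
      have "s * su < su" using that pos by simp
      then obtain x where "s * su < u x" unfolding su_def using less_cSUP_iff[OF _ bu] by auto
      thus ?thesis using pos by (auto simp: field_simps)
    qed
    show "\<exists>x. s < v x / sv" if "s < 1" for s
    proof -
      have "s * sv < sv" using that pos by simp
      then obtain x where "s * sv < v x" unfolding sv_def using less_cSUP_iff[OF _ bv] by auto
      thus ?thesis using pos by (auto simp: field_simps)
    qed
    show "u x / su * (v y / sv) \<le> (w ((x + y) / 2) / q)\<^sup>2" for x y
      using mid[of x y] pos by (simp add: power_divide q divide_right_mono)
  qed (use nonneg leu lev pos q supp in auto)
  moreover obtain Iu where Iu: "(\<integral>\<^sup>+x. u x \<partial>lborel) = ennreal Iu" "Iu \<ge> 0"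
    using fin[of u] bdd supp by (cases "\<integral>\<^sup>+x. ennreal (u x) \<partial>lborel") auto
  moreover obtain Iv where Iv: "(\<integral>\<^sup>+x. v x \<partial>lborel) = ennreal Iv" "Iv \<ge> 0"
    using fin[of v] bdd supp by (cases "\<integral>\<^sup>+x. ennreal (v x) \<partial>lborel") auto
  moreover have "(\<integral>\<^sup>+x. f x / c \<partial>lborel) = (\<integral>\<^sup>+x. f x \<partial>lborel) * ennreal (1/c)"
    if "f \<in> borel_measurable borel" "c > 0" "\<And>x. f x \<ge> 0" for f :: "real \<Rightarrow> real" and c
    using that by (subst nn_integral_multc[symmetric]) (auto simp flip: ennreal_mult simp: field_simps)
  ultimately have main: "ennreal (Iu / su + Iv / sv) \<le> 2 * ((\<integral>\<^sup>+x. w x \<partial>lborel) * ennreal (1/q))"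
    using pos q nonneg by (simp add: ennreal_plus ennreal_mult[symmetric])
  show ?thesis
  proof (cases "\<integral>\<^sup>+x. w x \<partial>lborel")
    case top
    have "(top :: ennreal)\<^sup>2 = top" by (simp add: power2_eq_square ennreal_mult_eq_top_iff)
    thus ?thesis unfolding top by simp
  next
    case (real Iw)
    have "Iu / su + Iv / sv \<le> 2 * (Iw / q)"
    proof -
      have "ennreal (2 * (Iw * (1/q))) = ennreal 2 * (ennreal Iw * ennreal (1/q))"
        using real(1) q(1) by (metis ennreal_mult less_imp_le mult_nonneg_nonneg zero_le_numeral divide_nonneg_pos zero_le_one)
      hence "ennreal (Iu / su + Iv / sv) \<le> ennreal (2 * (Iw * (1/q)))"
        using main unfolding real by simp
      hence "Iu / su + Iv / sv \<le> 2 * (Iw * (1/q))"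
        using real(1) q(1) by (subst (asm) ennreal_le_iff) auto
      also have "2 * (Iw * (1/q)) = 2 * (Iw / q)" by simp
      finally show ?thesis .
    qed
    moreover have "X / 2 \<le> Y" if "X \<le> 2 * Y" for X Y :: real using that by simp
    ultimately have le: "(Iu / su + Iv / sv) / 2 \<le> Iw / q" by blast
    have "(Iu / su) * (Iv / sv) \<le> ((Iu / su + Iv / sv) / 2)\<^sup>2"
    proof -
      have "p * q \<le> ((p + q) / 2)\<^sup>2" for p q :: real
        using zero_le_power2[of "p - q"] by (simp add: power2_eq_square field_simps)
      thus ?thesis .
    qed
    also have "\<dots> \<le> (Iw / q)\<^sup>2" using le Iu Iv pos by (intro power_mono) auto
    finally have "Iu * Iv \<le> Iw\<^sup>2" using pos by (simp add: power_divide q divide_le_cancel)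
    thus ?thesis unfolding Iu Iv real using Iu(2) Iv(2) real(1)
      by (simp add: ennreal_mult[symmetric] power2_eq_square)
  qed
qed

text \<open>Monotone approximation by cutting at height n and to the interval [-n, n]. The
  hypothesis survives: midpoints stay in the interval, and two factors capped at n have product at
  most n^2.\<close>

lemma prekopa_leindler_real:
  fixes u v w :: "real \<Rightarrow> ennreal"
  assumes meas [measurable]: "u \<in> borel_measurable borel" "v \<in> borel_measurable borel" "w \<in> borel_measurable borel"
    and mid: "\<And>x y. u x * v y \<le> (w ((x + y) / 2))\<^sup>2"
  shows "(\<integral>\<^sup>+x. u x \<partial>lborel) * (\<integral>\<^sup>+x. v x \<partial>lborel) \<le> (\<integral>\<^sup>+x. w x \<partial>lborel)\<^sup>2"
proof -
  define T where "T f n x = min (f x) (of_nat n) * indicator {- real n..real n} x"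
    for f :: "real \<Rightarrow> ennreal" and n :: nat and x :: real
  have Tmeas [measurable]: "T f n \<in> borel_measurable borel" if [measurable]: "f \<in> borel_measurable borel" for f n
    unfolding T_def by measurable
  have Tle: "T f n x \<le> of_nat n" "T f n x \<le> f x" "T f n x < top" "R = real n \<Longrightarrow> R < \<bar>x\<bar> \<Longrightarrow> T f n x = 0" for f n x R
    unfolding T_def by (auto simp: indicator_def min_less_iff_disj of_nat_less_top)
  have real_T: "ennreal (enn2real (T f n x)) = T f n x" for f n x
    using Tle(3)[of f n x] by simp
  have step: "(\<integral>\<^sup>+x. T u n x \<partial>lborel) * (\<integral>\<^sup>+x. T v n x \<partial>lborel) \<le> (\<integral>\<^sup>+x. w x \<partial>lborel)\<^sup>2" for n
  proof -
    have TT: "T u n x * T v n y \<le> (T w n ((x + y) / 2))\<^sup>2" for x y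
    proof (cases "\<bar>x\<bar> \<le> real n \<and> \<bar>y\<bar> \<le> real n")
      case True
      hence "(x + y) / 2 \<in> {- real n..real n}" by (auto simp: abs_le_iff)
      moreover have "min (u x) (of_nat n) * min (v y) (of_nat n) \<le> u x * v y"
         "min (u x) (of_nat n) * min (v y) (of_nat n) \<le> of_nat n * of_nat n"
        by (intro mult_mono; simp)+
      ultimately show ?thesis using mid[of x y] True
        unfolding T_def by (auto simp: indicator_def min_def power2_eq_square intro: order.trans)
    qed (auto simp: T_def indicator_def)
    have "(\<integral>\<^sup>+x. enn2real (T u n x) \<partial>lborel) * (\<integral>\<^sup>+x. enn2real (T v n x) \<partial>lborel)
      \<le> (\<integral>\<^sup>+x. enn2real (T w n x) \<partial>lborel)\<^sup>2"
    proof (rule prekopa_leindler_bounded[where R = "real n" and B = "real n"])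
      show "enn2real (T u n x) \<le> real n" "enn2real (T v n x) \<le> real n" for x
        using Tle(1) by (auto intro!: enn2real_leI simp: ennreal_of_nat_eq_real_of_nat)
      show "enn2real (T u n x) * enn2real (T v n y) \<le> (enn2real (T w n ((x + y) / 2)))\<^sup>2" for x y
      proof -
        have "ennreal (enn2real (T u n x) * enn2real (T v n y)) \<le> ennreal ((enn2real (T w n ((x + y) / 2)))\<^sup>2)"
          using TT[of x y] by (simp add: ennreal_mult real_T ennreal_power[symmetric])
        thus ?thesis by simp
      qed
    qed (auto simp: Tle(4))
    hence "(\<integral>\<^sup>+x. T u n x \<partial>lborel) * (\<integral>\<^sup>+x. T v n x \<partial>lborel) \<le> (\<integral>\<^sup>+x. T w n x \<partial>lborel)\<^sup>2"
      by (simp add: real_T)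
    also have "\<dots> \<le> (\<integral>\<^sup>+x. w x \<partial>lborel)\<^sup>2"
      unfolding power2_eq_square by (intro mult_mono nn_integral_mono Tle) auto
    finally show ?thesis .
  qed
  have incT: "incseq (T f)" for f
    unfolding incseq_def le_fun_def T_def
    by (auto simp: indicator_def min_le_iff_disj intro!: min.mono)
  have SUPT: "(SUP n. T f n x) = f x" for f x
  proof (rule antisym)
    obtain n0 :: nat where n0: "\<bar>x\<bar> \<le> real n0" using real_arch_simple by blast
    have *: "min (f x) (of_nat n) \<le> T f (max n n0) x" for n
    proof -
      have "x \<in> {- real (max n n0)..real (max n n0)}" using n0 by (auto simp: abs_le_iff)
      thus ?thesis unfolding T_def by (simp add: min.coboundedI2)
    qed
    have "f x = min (f x) (SUP n. of_nat n)" by (simp add: ennreal_SUP_of_nat_eq_top)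
    also have "\<dots> = (SUP n. min (f x) (of_nat n))" by (simp add: inf_SUP flip: inf_min)
    also have "\<dots> \<le> (SUP n. T f n x)" by (rule SUP_mono) (use * in auto)
    finally show "f x \<le> (SUP n. T f n x)" .
  qed (auto intro!: SUP_least Tle)
  have conv: "(\<lambda>n. \<integral>\<^sup>+x. T f n x \<partial>lborel) \<longlonglongrightarrow> (\<integral>\<^sup>+x. f x \<partial>lborel)" if [measurable]: "f \<in> borel_measurable borel" for f
  proof -
    have "(\<integral>\<^sup>+x. f x \<partial>lborel) = (\<integral>\<^sup>+x. (SUP n. T f n x) \<partial>lborel)" by (simp add: SUPT)
    also have "\<dots> = (SUP n. \<integral>\<^sup>+x. T f n x \<partial>lborel)"
      by (rule nn_integral_monotone_convergence_SUP[OF incT]) simp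
    finally show ?thesis
      using LIMSEQ_SUP[of "\<lambda>n. \<integral>\<^sup>+x. T f n x \<partial>lborel"] incT[of f]
      by (auto simp: incseq_def le_fun_def intro!: nn_integral_mono)
  qed
  show ?thesis
  proof (cases "(\<integral>\<^sup>+x. u x \<partial>lborel) = 0 \<or> (\<integral>\<^sup>+x. v x \<partial>lborel) = 0")
    case False
    show ?thesis
      by (rule LIMSEQ_le_const2[OF tendsto_mult_ennreal[OF conv conv]]) (use False step in auto)
  qed auto
qed

text \<open>Tensorisation: by the one-dimensional inequality, the integrals over one coordinate
  satisfy the midpoint hypothesis in the remaining ones.\<close>

lemma prekopa_leindler_PiM:
  fixes u v w :: "('a \<Rightarrow> real) \<Rightarrow> ennreal"
  assumes "finite I"
    and "u \<in> borel_measurable (PiM I (\<lambda>_. lborel))" "v \<in> borel_measurable (PiM I (\<lambda>_. lborel))"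
      "w \<in> borel_measurable (PiM I (\<lambda>_. lborel))"
    and "\<And>x y. x \<in> PiE I (\<lambda>_. UNIV) \<Longrightarrow> y \<in> PiE I (\<lambda>_. UNIV) \<Longrightarrow>
      u x * v y \<le> (w (\<lambda>i\<in>I. (x i + y i) / 2))\<^sup>2"
  shows "(\<integral>\<^sup>+x. u x \<partial>PiM I (\<lambda>_. lborel)) * (\<integral>\<^sup>+x. v x \<partial>PiM I (\<lambda>_. lborel))
    \<le> (\<integral>\<^sup>+x. w x \<partial>PiM I (\<lambda>_. lborel))\<^sup>2"
  using assms
proof (induction I arbitrary: u v w rule: finite_induct)
  case empty
  interpret product_sigma_finite "\<lambda>_::'a. lborel :: real measure" ..
  have "u (\<lambda>_. undefined) * v (\<lambda>_. undefined) \<le> (w (\<lambda>_. undefined))\<^sup>2"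
    using empty(4)[of "\<lambda>_. undefined" "\<lambda>_. undefined"] by (simp add: restrict_def)
  thus ?case unfolding PiM_empty by (simp only: nn_integral_count_space_finite finite.intros sum.insert sum.empty
      empty_iff not_False_eq_True add_0_right)
next
  case (insert i I)
  interpret product_sigma_finite "\<lambda>_::'a. lborel :: real measure" ..
  note [measurable] = insert.prems(1-3)
  define U where "U f x = (\<integral>\<^sup>+t. f (x(i := t)) \<partial>lborel)" for f :: "('a \<Rightarrow> real) \<Rightarrow> ennreal" and x
  have Umeas: "U f \<in> borel_measurable (PiM I (\<lambda>_. lborel))"
    if [measurable]: "f \<in> borel_measurable (PiM (insert i I) (\<lambda>_. lborel))" for f
    unfolding U_def by measurable
  have eq: "(\<integral>\<^sup>+x. f x \<partial>PiM (insert i I) (\<lambda>_. lborel)) = (\<integral>\<^sup>+x. U f x \<partial>PiM I (\<lambda>_. lborel))"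
    if [measurable]: "f \<in> borel_measurable (PiM (insert i I) (\<lambda>_. lborel))" for f
    unfolding U_def using insert.hyps that by (rule product_nn_integral_insert)
  have "(\<integral>\<^sup>+x. U u x \<partial>PiM I (\<lambda>_. lborel)) * (\<integral>\<^sup>+x. U v x \<partial>PiM I (\<lambda>_. lborel))
    \<le> (\<integral>\<^sup>+x. U w x \<partial>PiM I (\<lambda>_. lborel))\<^sup>2"
  proof (rule insert.IH)
    fix x y :: "'a \<Rightarrow> real" assume xy: "x \<in> PiE I (\<lambda>_. UNIV)" "y \<in> PiE I (\<lambda>_. UNIV)"
    have sec: "(\<lambda>t. f (z(i := t))) \<in> borel_measurable borel"
      if "f \<in> borel_measurable (PiM (insert i I) (\<lambda>_. lborel))" "z \<in> PiE I (\<lambda>_. UNIV)"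
      for f :: "('a \<Rightarrow> real) \<Rightarrow> ennreal" and z
    proof -
      have "(\<lambda>t. z(i := t)) \<in> measurable lborel (PiM (insert i I) (\<lambda>_. lborel))"
        using that(2) by (intro measurable_fun_upd[where J = I]) (auto simp: space_PiM)
      from measurable_compose[OF this that(1)] show ?thesis by simp
    qed
    show "U u x * U v y \<le> (U w (\<lambda>i\<in>I. (x i + y i) / 2))\<^sup>2"
      unfolding U_def
    proof (rule prekopa_leindler_real)
      fix s t :: real
      have "u (x(i := s)) * v (y(i := t)) \<le>
        (w (\<lambda>j\<in>insert i I. ((x(i := s)) j + (y(i := t)) j) / 2))\<^sup>2"
        using xy by (intro insert.prems(4)) (auto simp: PiE_iff extensional_def)
      also have "(\<lambda>j\<in>insert i I. ((x(i := s)) j + (y(i := t)) j) / 2) =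
        (\<lambda>j\<in>I. (x j + y j) / 2)(i := (s + t) / 2)"
        using insert.hyps by (auto simp: fun_eq_iff)
      finally show "u (x(i := s)) * v (y(i := t)) \<le> (w ((\<lambda>j\<in>I. (x j + y j) / 2)(i := (s + t) / 2)))\<^sup>2" .
    qed (use xy insert.prems(1-3) in \<open>auto intro!: sec\<close>)
  qed (intro Umeas insert.prems)+
  thus ?case using insert.prems(1-3) by (simp add: eq)
qed

section \<open>Discrete Wirtinger and Sobolev inequalities\<close>

lemma sum_cis_unity:
  fixes m :: int
  assumes N: "N > 0" and m: "\<not> int N dvd m"
  shows "(\<Sum>j<N. cis (2 * pi * real_of_int m * real j / real N)) = 0"
proof -
  define z where "z = cis (2 * pi * real_of_int m / real N)"
  have pow: "cis (2 * pi * real_of_int m * real j / real N) = z ^ j" for j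
  proof -
    have "z ^ j = cis (real j * (2 * pi * real_of_int m / real N))" unfolding z_def by (rule Complex.DeMoivre)
    also have "real j * (2 * pi * real_of_int m / real N) = 2 * pi * real_of_int m * real j / real N" by simp
    finally show ?thesis by simp
  qed
  have "z ^ N = cis (2 * pi * real_of_int m)" unfolding z_def Complex.DeMoivre using N by simp
  also have "\<dots> = 1" by (simp add: cis_multiple_2pi)
  finally have zN: "z ^ N = 1" .
  have "z \<noteq> 1"
  proof
    assume "z = 1"
    hence "cos (2 * pi * real_of_int m / real N) = 1" unfolding z_def by (metis cis.sel(1) one_complex.sel(1))
    then obtain n :: int where "2 * pi * real_of_int m / real N = real_of_int n * 2 * pi"
      by (auto simp: cos_one_2pi_int)
    hence "real_of_int m = real_of_int (n * int N)" using N by (simp add: field_simps)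
    hence "m = n * int N" using of_int_eq_iff by blast
    thus False using m by simp
  qed
  thus ?thesis unfolding pow using geometric_sum[of z N] zN by simp
qed

definition dft :: "nat \<Rightarrow> (nat \<Rightarrow> real) \<Rightarrow> nat \<Rightarrow> complex" where
  "dft N x j = (\<Sum>k<N. of_real (x k) * cis (- (2 * pi * real j * real k / real N)))"

lemma dft_parseval:
  assumes N: "N > 0"
  shows "(\<Sum>j<N. (cmod (dft N x j))\<^sup>2) = real N * (\<Sum>k<N. (x k)\<^sup>2)"
proof -
  have prod: "cis (- (2 * pi * real j * real k / real N)) * cnj (cis (- (2 * pi * real j * real l / real N)))
     = cis (2 * pi * real_of_int (int l - int k) * real j / real N)" for j k l
    unfolding cis_cnj cis_mult by (simp add: field_simps diff_divide_distrib)
  have orth: "(\<Sum>j<N. cis (2 * pi * real_of_int (int l - int k) * real j / real N)) = (if k = l then of_nat N else 0)"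
    if "k < N" "l < N" for k l
  proof (cases "k = l")
    case False
    have "\<not> int N dvd (int l - int k)"
    proof
      assume "int N dvd (int l - int k)"
      hence "\<bar>int N\<bar> \<le> \<bar>int l - int k\<bar>" using False by (intro dvd_imp_le_int) auto
      thus False using that by auto
    qed
    from sum_cis_unity[OF N this] False show ?thesis by simp
  qed simp
  have "of_real (\<Sum>j<N. (cmod (dft N x j))\<^sup>2) = (\<Sum>j<N. dft N x j * cnj (dft N x j))"
    unfolding of_real_sum by (intro sum.cong refl complex_norm_square)
  also have "\<dots> = (\<Sum>j<N. \<Sum>k<N. \<Sum>l<N. of_real (x k * x l) * cis (2 * pi * real_of_int (int l - int k) * real j / real N))"
    unfolding dft_def cnj_sum sum_product prod[symmetric] by (intro sum.cong refl) (simp add: algebra_simps)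
  also have "\<dots> = (\<Sum>k<N. \<Sum>j<N. \<Sum>l<N. of_real (x k * x l) * cis (2 * pi * real_of_int (int l - int k) * real j / real N))"
    by (rule sum.swap)
  also have "\<dots> = (\<Sum>k<N. \<Sum>l<N. \<Sum>j<N. of_real (x k * x l) * cis (2 * pi * real_of_int (int l - int k) * real j / real N))"
    by (intro sum.cong refl sum.swap)
  also have "\<dots> = (\<Sum>k<N. \<Sum>l<N. of_real (x k * x l) * (if k = l then of_nat N else 0))"
    by (intro sum.cong refl) (simp add: sum_distrib_left[symmetric] orth del: of_real_mult of_int_diff)
  also have "\<dots> = (\<Sum>k<N. of_real (x k * x k) * of_nat N)"
    by (intro sum.cong refl) (simp add: if_distrib sum.delta' cong: if_cong)
  also have "\<dots> = of_real (real N * (\<Sum>k<N. (x k)\<^sup>2))"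
    by (simp add: sum_distrib_left power2_eq_square mult.commute)
  finally show ?thesis using of_real_eq_iff by blast
qed

lemma sum_shift_mod:
  fixes g :: "nat \<Rightarrow> 'a :: comm_monoid_add"
  assumes "N > 0"
  shows "(\<Sum>k<N. g ((k + 1) mod N)) = (\<Sum>k<N. g k)"
proof -
  obtain n where N: "N = Suc n" using assms gr0_implies_Suc by blast
  have "(\<Sum>k<N. g ((k + 1) mod N)) = (\<Sum>k<n. g (Suc k)) + g 0"
    unfolding N sum.lessThan_Suc by simp
  also have "\<dots> = (\<Sum>k<N. g k)" unfolding N sum.lessThan_Suc_shift by (simp add: add.commute)
  finally show ?thesis .
qed

text \<open>The transform diagonalises the cyclic difference. The wrap-around at k = N - 1 is
  harmless because the characters are N-periodic.\<close>

lemma dft_diff: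
  assumes N: "N > 0"
  shows "dft N (\<lambda>k. x k - x ((k + 1) mod N)) j = (1 - cis (2 * pi * real j / real N)) * dft N x j"
proof -
  have w: "cis (- (2 * pi * real j * real k / real N))
    = cis (2 * pi * real j / real N) * cis (- (2 * pi * real j * real ((k + 1) mod N) / real N))"
    if "k < N" for k
  proof (cases "k + 1 = N")
    case True
    have "2 * pi * real j * real k / real N = 2 * pi * real j - 2 * pi * real j / real N"
      using True N by (simp add: field_simps flip: True)
    hence "cis (- (2 * pi * real j * real k / real N)) = cis (2 * pi * real j / real N) * cis (2 * pi * real_of_int (- int j))"
      by (simp add: cis_mult)
    thus ?thesis using True by (simp add: cis_multiple_2pi del: of_int_minus)
  next
    case False
    hence "(k + 1) mod N = k + 1" using that by simp
    thus ?thesis by (simp add: cis_mult add_divide_distrib distrib_left)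
  qed
  have "dft N (\<lambda>k. x k - x ((k + 1) mod N)) j = dft N x j
    - (\<Sum>k<N. of_real (x ((k + 1) mod N)) * cis (- (2 * pi * real j * real k / real N)))"
    unfolding dft_def by (simp add: algebra_simps sum_subtractf)
  also have "(\<Sum>k<N. of_real (x ((k + 1) mod N)) * cis (- (2 * pi * real j * real k / real N)))
    = (\<Sum>k<N. cis (2 * pi * real j / real N) *
        (of_real (x ((k + 1) mod N)) * cis (- (2 * pi * real j * real ((k + 1) mod N) / real N))))"
    by (intro sum.cong refl) (subst w, auto)
  also have "\<dots> = cis (2 * pi * real j / real N) * dft N x j"
    unfolding sum_shift_mod[OF N, of "\<lambda>k. cis (2 * pi * real j / real N) *
        (of_real (x k) * cis (- (2 * pi * real j * real k / real N)))"] dft_def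
    by (simp add: sum_distrib_left)
  finally show ?thesis by (simp add: algebra_simps)
qed

lemma cmod_one_minus_cis: "(cmod (1 - cis (2 * t)))\<^sup>2 = 4 * (sin t)\<^sup>2"
proof -
  have "(cmod (1 - cis (2 * t)))\<^sup>2 = (1 - cos (2*t))\<^sup>2 + (sin (2*t))\<^sup>2"
    by (simp add: cmod_power2)
  also have "\<dots> = 2 - 2 * cos (2 * t)"
    using sin_cos_squared_add[of "2*t"] by (simp add: power2_eq_square algebra_simps)
  also have "\<dots> = 4 * (sin t)\<^sup>2" by (simp add: cos_double_sin)
  finally show ?thesis .
qed

definition mean :: "nat \<Rightarrow> (nat \<Rightarrow> real) \<Rightarrow> real" where
  "mean N x = (\<Sum>k<N. x k) / real N"

text \<open>On mode j the difference acts by a factor of squared modulus 4 sin^2 (pi j / N).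
  Centring removes mode 0, and the smallest factor among the other modes occurs at j = 1.\<close>

lemma discrete_wirtinger:
  assumes N: "N > 0"
  shows "4 * (sin (pi / real N))\<^sup>2 * (\<Sum>k<N. (x k - mean N x)\<^sup>2) \<le> (\<Sum>k<N. (x k - x ((k + 1) mod N))\<^sup>2)"
proof -
  define z where "z k = x k - mean N x" for k
  have z0: "dft N z 0 = 0"
  proof -
    have "dft N z 0 = of_real (\<Sum>k<N. z k)" unfolding dft_def by simp
    also have "(\<Sum>k<N. z k) = 0" unfolding z_def mean_def using N by (simp add: sum_subtractf)
    finally show ?thesis by simp
  qed
  have sinle: "(sin (pi / real N))\<^sup>2 \<le> (sin (pi * real j / real N))\<^sup>2" if "j < N" "j \<noteq> 0" for j
  proof -
    have N2: "N \<ge> 2" using that by auto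
    have "sin (pi / real N) \<le> sin (pi * real j / real N)"
    proof (cases "2 * j \<le> N")
      case True
      have "pi / real N \<le> pi * real j / real N" using that N by (simp add: divide_right_mono)
      moreover have "pi * real j / real N \<le> pi / 2"
      proof -
        have "real j * 2 \<le> real N" using True by linarith
        thus ?thesis using N by (simp add: field_simps)
      qed
      moreover have "- (pi/2) \<le> pi / real N" by (simp add: order.trans[of _ 0])
      ultimately show ?thesis by (intro sin_monotone_2pi_le) auto
    next
      case False
      \<comment> \<open>Modes beyond N / 2 are reflected to N - j, where the sine is
        increasing.\<close>
      have "sin (pi * real j / real N) = sin (pi - pi * real j / real N)" by simp
      also have "pi - pi * real j / real N = pi * real (N - j) / real N"
        using that N by (simp add: field_simps of_nat_diff)
      finally have eq: "sin (pi * real j / real N) = sin (pi * real (N - j) / real N)" .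
      have "pi / real N \<le> pi * real (N - j) / real N" using that N by (simp add: divide_right_mono)
      moreover have "pi * real (N - j) / real N \<le> pi / 2"
      proof -
        have "real (N - j) * 2 \<le> real N" using False by linarith
        thus ?thesis using N by (simp add: field_simps)
      qed
      moreover have "- (pi/2) \<le> pi / real N" by (simp add: order.trans[of _ 0])
      ultimately show ?thesis unfolding eq by (intro sin_monotone_2pi_le) auto
    qed
    moreover have "0 \<le> sin (pi / real N)" using N2 by (intro sin_ge_zero) (auto simp: field_simps)
    ultimately show ?thesis by (intro power_mono)
  qed
  have "real N * (4 * (sin (pi / real N))\<^sup>2 * (\<Sum>k<N. (z k)\<^sup>2))
      = (\<Sum>j<N. 4 * (sin (pi / real N))\<^sup>2 * (cmod (dft N z j))\<^sup>2)"
    by (simp add: dft_parseval[OF N] sum_distrib_left[symmetric])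
  also have "\<dots> \<le> (\<Sum>j<N. (cmod (1 - cis (2 * pi * real j / real N)))\<^sup>2 * (cmod (dft N z j))\<^sup>2)"
  proof (intro sum_mono)
    fix j assume "j \<in> {..<N}"
    show "4 * (sin (pi / real N))\<^sup>2 * (cmod (dft N z j))\<^sup>2
      \<le> (cmod (1 - cis (2 * pi * real j / real N)))\<^sup>2 * (cmod (dft N z j))\<^sup>2"
    proof (cases "j = 0")
      case True thus ?thesis by (simp add: z0)
    next
      case False
      have "(cmod (1 - cis (2 * pi * real j / real N)))\<^sup>2 = 4 * (sin (pi * real j / real N))\<^sup>2"
        using cmod_one_minus_cis[of "pi * real j / real N"] by (simp add: mult.assoc)
      thus ?thesis using sinle[of j] False \<open>j \<in> _\<close> by (intro mult_right_mono) auto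
    qed
  qed
  also have "\<dots> = (\<Sum>j<N. (cmod (dft N (\<lambda>k. z k - z ((k + 1) mod N)) j))\<^sup>2)"
    by (simp only: dft_diff[OF N] norm_mult power_mult_distrib)
  also have "\<dots> = real N * (\<Sum>k<N. (z k - z ((k + 1) mod N))\<^sup>2)" by (rule dft_parseval[OF N])
  finally show ?thesis using N unfolding z_def by simp
qed

text \<open>Two coordinates differ by at most the total variation around the ring, which
  Cauchy-Schwarz bounds by the squared differences; averaging over the second coordinate gives the
  claim. The N^2 matches the growth of the coupling prefactor \<mu> / (8 sin^2 (pi / N)).\<close>

lemma discrete_sobolev:
  assumes k: "k < N"
  shows "real N * (x k)\<^sup>2 \<le> 2 * (\<Sum>j<N. (x j)\<^sup>2) + 2 * (real N)\<^sup>2 * (\<Sum>j<N. (x j - x ((j + 1) mod N))\<^sup>2)"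
proof -
  define S where "S = (\<Sum>j<N. \<bar>x j - x ((j + 1) mod N)\<bar>)"
  have tele: "\<bar>x i - x j\<bar> \<le> S" if "i \<le> j" "j < N" for i j
  proof -
    have "\<bar>x i - x j\<bar> \<le> (\<Sum>l\<in>{i..<j}. \<bar>x l - x (Suc l)\<bar>)" using that(1)
    proof (induction j rule: dec_induct)
      case (step n)
      have "\<bar>x i - x (Suc n)\<bar> \<le> \<bar>x i - x n\<bar> + \<bar>x n - x (Suc n)\<bar>" by linarith
      with step show ?case by simp
    qed simp
    also have "\<dots> = (\<Sum>l\<in>{i..<j}. \<bar>x l - x ((l + 1) mod N)\<bar>)"
      using that by (intro sum.cong refl) auto
    also have "\<dots> \<le> S" unfolding S_def using that by (intro sum_mono2) auto
    finally show ?thesis .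
  qed
  have close: "\<bar>x k - x j\<bar> \<le> S" if "j < N" for j
    using tele[of k j] tele[of j k] that k by (cases "k \<le> j") (auto simp: abs_minus_commute)
  have "S\<^sup>2 \<le> real N * (\<Sum>j<N. (x j - x ((j + 1) mod N))\<^sup>2)"
  proof -
    have "S\<^sup>2 \<le> (\<Sum>j<N. (1::real)\<^sup>2) * (\<Sum>j<N. \<bar>x j - x ((j + 1) mod N)\<bar>\<^sup>2)"
      unfolding S_def using Cauchy_Schwarz_ineq_sum[of "\<lambda>_. 1" "\<lambda>j. \<bar>x j - x ((j + 1) mod N)\<bar>" "{..<N}"] by simp
    thus ?thesis by simp
  qed
  hence S2: "real N * S\<^sup>2 \<le> (real N)\<^sup>2 * (\<Sum>j<N. (x j - x ((j + 1) mod N))\<^sup>2)"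
    using mult_left_mono[of "S\<^sup>2" _ "real N"] by (simp add: power2_eq_square mult.assoc)
  have "real N * (x k)\<^sup>2 = (\<Sum>j<N. (x k)\<^sup>2)" by simp
  also have "\<dots> \<le> (\<Sum>j<N. 2 * (x j)\<^sup>2 + 2 * S\<^sup>2)"
  proof (intro sum_mono)
    fix j assume "j \<in> {..<N}"
    hence "\<bar>x k - x j\<bar>\<^sup>2 \<le> S\<^sup>2" using close by (intro power_mono) auto
    moreover have "(x k)\<^sup>2 \<le> 2 * (x j)\<^sup>2 + 2 * (x k - x j)\<^sup>2"
      using zero_le_power2[of "x k - 2 * x j"] by (simp add: power2_eq_square algebra_simps)
    ultimately show "(x k)\<^sup>2 \<le> 2 * (x j)\<^sup>2 + 2 * S\<^sup>2" by simp
  qed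
  also have "\<dots> = 2 * (\<Sum>j<N. (x j)\<^sup>2) + 2 * (real N * S\<^sup>2)"
    by (simp add: sum.distrib sum_distrib_left)
  finally show ?thesis using S2 by simp
qed

text \<open>A lower bound, uniform in the base point, for half the Hessian of the potential tilted
  by the field: the second derivative 3 x^2 - 1 of the double well is replaced by its minimum
  -1.\<close>

definition quad_form :: "real \<Rightarrow> nat \<Rightarrow> (nat \<Rightarrow> real) \<Rightarrow> real" where
  "quad_form \<mu> N d = \<mu> / (8 * (sin (pi / real N))\<^sup>2) * (\<Sum>k<N. (d k - d ((k + 1) mod N))\<^sup>2)
     - (\<Sum>k<N. (d k)\<^sup>2) / 2 + \<mu> / 2 * real N * (mean N d)\<^sup>2"

lemma sum_sq_mean:
  assumes "N > 0"
  shows "(\<Sum>k<N. (d k - mean N d)\<^sup>2) = (\<Sum>k<N. (d k)\<^sup>2) - real N * (mean N d)\<^sup>2"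
proof -
  have s: "(\<Sum>k<N. d k) = real N * mean N d" using assms by (simp add: mean_def)
  have "(\<Sum>k<N. (d k - mean N d)\<^sup>2) = (\<Sum>k<N. (d k)\<^sup>2) - 2 * mean N d * (\<Sum>k<N. d k) + real N * (mean N d)\<^sup>2"
    by (simp add: power2_diff sum.distrib sum_subtractf sum_distrib_left algebra_simps)
  thus ?thesis unfolding s by (simp add: power2_eq_square algebra_simps)
qed

text \<open>\<open>?B\<close> is the uniform convexity behind the Poincare inequality.
  \<open>?A\<close> gives up half of it in order to keep N^2 times the squared differences, from
  which single coordinates are bounded.\<close>

lemma quad_form_ge:
  fixes \<mu> :: real
  assumes \<mu>: "\<mu> > 1" and N: "N > 0"
  shows "(\<mu> - 1) / 4 * (\<Sum>k<N. (d k)\<^sup>2)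
    + (\<mu> - 1) / (16 * pi\<^sup>2) * (real N)\<^sup>2 * (\<Sum>k<N. (d k - d ((k + 1) mod N))\<^sup>2) \<le> quad_form \<mu> N d" (is ?A)
    and "(\<mu> - 1) / 2 * (\<Sum>k<N. (d k)\<^sup>2) \<le> quad_form \<mu> N d" (is ?B)
proof -
  define D where "D = (\<Sum>k<N. (d k - d ((k + 1) mod N))\<^sup>2)"
  define S where "S = (\<Sum>k<N. (d k)\<^sup>2)"
  define M where "M = real N * (mean N d)\<^sup>2"
  define b where "b = D / (8 * (sin (pi / real N))\<^sup>2)"
  have D0: "D \<ge> 0" unfolding D_def by (simp add: sum_nonneg)
  have M0: "M \<ge> 0" unfolding M_def by simp
  have SM: "S - M = (\<Sum>k<N. (d k - mean N d)\<^sup>2)"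
    using sum_sq_mean[OF N, of d] unfolding S_def M_def by simp
  have Q: "quad_form \<mu> N d = \<mu> * b - S / 2 + \<mu> / 2 * M"
    unfolding quad_form_def b_def D_def S_def M_def by simp
  \<comment> \<open>The first bound is the Wirtinger inequality, the second uses sin t \<le> t. For
    N = 1 the differences and S - M vanish, and the quotient \<open>b\<close> is 0.\<close>
  have b: "b \<ge> (S - M) / 2 \<and> b \<ge> (real N)\<^sup>2 * D / (8 * pi\<^sup>2)"
  proof (cases "N = 1")
    case True
    hence "D = 0" "S - M = 0" unfolding D_def SM by (auto simp: mean_def)
    thus ?thesis unfolding b_def by simp
  next
    case False
    hence N2: "N \<ge> 2" using N by simp
    have sp: "sin (pi / real N) > 0" using N2 by (intro sin_gt_zero) (auto simp: field_simps)
    have "4 * (sin (pi / real N))\<^sup>2 * (S - M) \<le> D"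
      unfolding SM D_def by (rule discrete_wirtinger[OF N])
    hence 1: "b \<ge> (S - M) / 2" unfolding b_def using sp by (simp add: field_simps)
    have "sin (pi / real N) \<le> pi / real N" by (rule sin_x_le_x) simp
    hence "(sin (pi / real N))\<^sup>2 \<le> (pi / real N)\<^sup>2" using sp by (intro power_mono) auto
    hence "D / (8 * (pi / real N)\<^sup>2) \<le> b" unfolding b_def
      using sp D0 N by (intro divide_left_mono) auto
    hence 2: "b \<ge> (real N)\<^sup>2 * D / (8 * pi\<^sup>2)" by (simp add: power_divide mult.commute)
    from 1 2 show ?thesis by simp
  qed
  have "\<mu> * b \<ge> \<mu> * ((S - M) / 2)" using b \<mu> by (intro mult_left_mono) auto
  thus ?B unfolding Q S_def[symmetric] by (simp add: algebra_simps diff_divide_distrib add_divide_distrib)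
  \<comment> \<open>The coupling is split into shares (\<mu> + 1) / 2 and (\<mu> - 1) / 2. The first
    beats the concave part with (\<mu> - 1) / 4 to spare, the second is kept as squared
    differences.\<close>
  have "(\<mu> + 1) / 2 * b \<ge> (\<mu> + 1) / 2 * ((S - M) / 2)" using b \<mu> by (intro mult_left_mono) auto
  moreover have "(\<mu> - 1) / 2 * b \<ge> (\<mu> - 1) / 2 * ((real N)\<^sup>2 * D / (8 * pi\<^sup>2))" using b \<mu> by (intro mult_left_mono) auto
  moreover have "(\<mu> + 1) / 4 * M \<le> \<mu> / 2 * M" using M0 \<mu> by (intro mult_right_mono) auto
  moreover have "\<mu> * b = (\<mu> + 1) / 2 * b + (\<mu> - 1) / 2 * b" by (simp add: field_simps)
  moreover have "(\<mu> + 1) / 2 * ((S - M) / 2) = (\<mu> - 1) / 4 * S + S / 2 - (\<mu> + 1) / 4 * M" by (simp add: field_simps)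
  moreover have "(\<mu> - 1) / 2 * ((real N)\<^sup>2 * D / (8 * pi\<^sup>2)) = (\<mu> - 1) / (16 * pi\<^sup>2) * (real N)\<^sup>2 * D"
    by simp
  ultimately show ?A unfolding Q S_def[symmetric] D_def[symmetric] by linarith
qed

text \<open>The factor 1 / N will cancel the N of the temperature h N, so that a single coordinate
  fluctuates on the scale sqrt h. It comes from the Sobolev inequality, once both terms of the lower
  bound carry the same coefficient.\<close>

lemma coord_le_quad_form:
  fixes \<mu> :: real
  assumes \<mu>: "\<mu> > 1" and k: "k < N"
  shows "(d k)\<^sup>2 \<le> 32 * pi\<^sup>2 / (\<mu> - 1) / real N * quad_form \<mu> N d"
proof -
  have N: "N > 0" using k by simp
  define D where "D = (\<Sum>k<N. (d k - d ((k + 1) mod N))\<^sup>2)"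
  define S where "S = (\<Sum>k<N. (d k)\<^sup>2)"
  have S0: "S \<ge> 0" unfolding S_def by (simp add: sum_nonneg)
  have pi2: "pi\<^sup>2 \<ge> 1" using pi_ge_two by (intro one_le_power) auto
  have "(\<mu> - 1) / (16 * pi\<^sup>2) * S \<le> (\<mu> - 1) / 4 * S"
    using pi2 \<mu> S0 by (intro mult_right_mono divide_left_mono) auto
  with quad_form_ge(1)[OF \<mu> N, of d]
  have "(\<mu> - 1) / (16 * pi\<^sup>2) * S + (\<mu> - 1) / (16 * pi\<^sup>2) * (real N)\<^sup>2 * D \<le> quad_form \<mu> N d"
    unfolding D_def S_def by linarith
  hence "(\<mu> - 1) / (16 * pi\<^sup>2) * (S + (real N)\<^sup>2 * D) \<le> quad_form \<mu> N d"
    by (simp only: distrib_left mult.assoc)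
  moreover have "real N * (d k)\<^sup>2 / 2 \<le> S + (real N)\<^sup>2 * D"
    using discrete_sobolev[OF k, of d] unfolding S_def D_def by simp
  hence "(\<mu> - 1) / (16 * pi\<^sup>2) * (real N * (d k)\<^sup>2 / 2) \<le> (\<mu> - 1) / (16 * pi\<^sup>2) * (S + (real N)\<^sup>2 * D)"
    using \<mu> by (intro mult_left_mono) auto
  ultimately have "(\<mu> - 1) / (16 * pi\<^sup>2) * (real N * (d k)\<^sup>2 / 2) \<le> quad_form \<mu> N d" by linarith
  thus ?thesis using \<mu> N by (simp add: field_simps)
qed

lemma mean_le_quad_form:
  fixes \<mu> :: real
  assumes \<mu>: "\<mu> > 1" and N: "N > 0"
  shows "(mean N d)\<^sup>2 \<le> 32 * pi\<^sup>2 / (\<mu> - 1) / real N * quad_form \<mu> N d"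
proof -
  have "0 \<le> (\<Sum>k<N. (d k - mean N d)\<^sup>2)" by (simp add: sum_nonneg)
  hence "real N * (mean N d)\<^sup>2 \<le> (\<Sum>k<N. (d k)\<^sup>2)" unfolding sum_sq_mean[OF N] by simp
  also have "\<dots> \<le> (\<Sum>k<N. 32 * pi\<^sup>2 / (\<mu> - 1) / real N * quad_form \<mu> N d)"
    by (intro sum_mono coord_le_quad_form[OF \<mu>]) auto
  also have "\<dots> = real N * (32 * pi\<^sup>2 / (\<mu> - 1) / real N * quad_form \<mu> N d)" by simp
  finally show ?thesis using N by (simp only: mult_le_cancel_left_pos of_nat_0_less_iff)
qed

section \<open>Midpoint convexity of the potential at a fixed field\<close>

definition Vxi :: "real \<Rightarrow> nat \<Rightarrow> real \<Rightarrow> (nat \<Rightarrow> real) \<Rightarrow> real" where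
  "Vxi \<mu> N \<xi> x = VN \<mu> N x + \<mu> / 2 * real N * (\<xi> - mean N x)\<^sup>2"

text \<open>The coupling and the field term are quadratic and obey the parallelogram identity. For
  the double well, with midpoint s and half-difference t, the gain over -(a - b)^2 / 4 is 3 s^2 t^2
  + t^4 / 2 \<ge> 0.\<close>

lemma Vxi_midpoint:
  assumes z: "\<And>k. k < N \<Longrightarrow> z k = (x k + y k) / 2" and N: "N > 0"
  shows "quad_form \<mu> N (\<lambda>k. x k - y k) / 2 \<le> Vxi \<mu> N \<xi> x + Vxi \<mu> N \<xi> y - 2 * Vxi \<mu> N \<xi> z"
proof -
  define b where "b = \<mu> / (8 * (sin (pi / real N))\<^sup>2)"
  have mz: "mean N z = (mean N x + mean N y) / 2"
  proof -
    have "(\<Sum>k<N. z k) = ((\<Sum>k<N. x k) + (\<Sum>k<N. y k)) / 2"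
      by (simp add: sum.distrib[symmetric] sum_divide_distrib z del: add_divide_distrib)
    thus ?thesis unfolding mean_def by (simp add: add_divide_distrib)
  qed
  have md: "mean N (\<lambda>k. x k - y k) = mean N x - mean N y"
    unfolding mean_def by (simp add: sum_subtractf diff_divide_distrib)
  have "- ((a - b)\<^sup>2) / 4 \<le> (a\<^sup>2 - 1)\<^sup>2 / 4 + (b\<^sup>2 - 1)\<^sup>2 / 4 - 2 * ((((a + b) / 2)\<^sup>2 - 1)\<^sup>2 / 4)" for a b :: real
  proof -
    define s where "s = (a + b) / 2"
    define t where "t = (a - b) / 2"
    have ab: "a = s + t" "b = s - t" unfolding s_def t_def by (simp_all add: field_simps)
    have "(a\<^sup>2 - 1)\<^sup>2 / 4 + (b\<^sup>2 - 1)\<^sup>2 / 4 - 2 * ((s\<^sup>2 - 1)\<^sup>2 / 4) + (a - b)\<^sup>2 / 4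
        = 3 * s\<^sup>2 * t\<^sup>2 + t\<^sup>2 * t\<^sup>2 / 2"
      unfolding ab by (simp add: power2_eq_square field_simps)
    moreover have "0 \<le> 3 * s\<^sup>2 * t\<^sup>2 + t\<^sup>2 * t\<^sup>2 / 2" by (intro add_nonneg_nonneg) auto
    ultimately show ?thesis unfolding s_def[symmetric] by linarith
  qed
  hence "(\<Sum>k<N. - ((x k - y k)\<^sup>2) / 4) \<le> (\<Sum>k<N. (((x k)\<^sup>2 - 1)\<^sup>2 / 4 + ((y k)\<^sup>2 - 1)\<^sup>2 / 4 - 2 * (((z k)\<^sup>2 - 1)\<^sup>2 / 4)))"
    by (intro sum_mono) (simp only: z lessThan_iff)
  hence 1: "- (\<Sum>k<N. (x k - y k)\<^sup>2) / 4 \<le> (\<Sum>k<N. ((x k)\<^sup>2 - 1)\<^sup>2 / 4) + (\<Sum>k<N. ((y k)\<^sup>2 - 1)\<^sup>2 / 4)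
      - 2 * (\<Sum>k<N. ((z k)\<^sup>2 - 1)\<^sup>2 / 4)"
    by (simp add: sum.distrib sum_subtractf sum_distrib_left sum_negf sum_divide_distrib)
  have "(\<Sum>k<N. (x k - x ((k + 1) mod N))\<^sup>2) + (\<Sum>k<N. (y k - y ((k + 1) mod N))\<^sup>2)
       - 2 * (\<Sum>k<N. (z k - z ((k + 1) mod N))\<^sup>2)
     = (\<Sum>k<N. (x k - x ((k + 1) mod N))\<^sup>2 + (y k - y ((k + 1) mod N))\<^sup>2 - 2 * (z k - z ((k + 1) mod N))\<^sup>2)"
    by (simp add: sum.distrib sum_subtractf sum_distrib_left)
  also have "\<dots> = (\<Sum>k<N. (x k - y k - (x ((k + 1) mod N) - y ((k + 1) mod N)))\<^sup>2 / 2)"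
  proof (intro sum.cong refl)
    fix k assume "k \<in> {..<N}"
    hence "k < N" "(k + 1) mod N < N" using N by auto
    thus "(x k - x ((k + 1) mod N))\<^sup>2 + (y k - y ((k + 1) mod N))\<^sup>2 - 2 * (z k - z ((k + 1) mod N))\<^sup>2
      = (x k - y k - (x ((k + 1) mod N) - y ((k + 1) mod N)))\<^sup>2 / 2"
      by (simp only: z) (simp add: power2_eq_square field_simps)
  qed
  finally have "b * ((\<Sum>k<N. (x k - x ((k + 1) mod N))\<^sup>2) + (\<Sum>k<N. (y k - y ((k + 1) mod N))\<^sup>2)
       - 2 * (\<Sum>k<N. (z k - z ((k + 1) mod N))\<^sup>2))
     = b * ((\<Sum>k<N. (x k - y k - (x ((k + 1) mod N) - y ((k + 1) mod N)))\<^sup>2) / 2)"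
    by (simp add: sum_divide_distrib)
  hence 2: "b * (\<Sum>k<N. (x k - x ((k + 1) mod N))\<^sup>2) + b * (\<Sum>k<N. (y k - y ((k + 1) mod N))\<^sup>2)
       - 2 * (b * (\<Sum>k<N. (z k - z ((k + 1) mod N))\<^sup>2))
     = b * (\<Sum>k<N. (x k - y k - (x ((k + 1) mod N) - y ((k + 1) mod N)))\<^sup>2) / 2"
    by (simp add: algebra_simps)
  have 3: "\<mu> / 2 * real N * (\<xi> - mean N x)\<^sup>2 + \<mu> / 2 * real N * (\<xi> - mean N y)\<^sup>2
      - 2 * (\<mu> / 2 * real N * (\<xi> - mean N z)\<^sup>2) = \<mu> / 2 * real N * (mean N x - mean N y)\<^sup>2 / 2"
    unfolding mz by (simp add: power2_eq_square field_simps)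
  have comb: "(Q - S / 2 + M) / 2 \<le> (X1 + X2 + X3) + (Y1 + Y2 + Y3) - 2 * (Z1 + Z2 + Z3)"
    if "- S / 4 \<le> X1 + Y1 - 2 * Z1" "X2 + Y2 - 2 * Z2 = Q / 2" "X3 + Y3 - 2 * Z3 = M / 2"
    for Q S M X1 X2 X3 Y1 Y2 Y3 Z1 Z2 Z3 :: real
    using that by (simp add: field_simps)
  show ?thesis
    unfolding Vxi_def VN_def quad_form_def md b_def[symmetric] by (rule comb[OF 1 2 3])
qed

section \<open>Measures tilted by the auxiliary field\<close>

lemma has_real_derivative_lebesgue_integral:
  fixes G G' :: "real \<Rightarrow> 'a \<Rightarrow> real"
  assumes der: "\<And>t x. x \<in> space M \<Longrightarrow> \<bar>t - t0\<bar> < 1 \<Longrightarrow> ((\<lambda>t. G t x) has_real_derivative G' t x) (at t)"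
    and bound: "\<And>t x. x \<in> space M \<Longrightarrow> \<bar>t - t0\<bar> < 1 \<Longrightarrow> \<bar>G' t x\<bar> \<le> B x"
    and B: "integrable M B" and G: "\<And>t. integrable M (G t)"
    and G': "G' t0 \<in> borel_measurable M"
  shows "((\<lambda>t. \<integral>x. G t x \<partial>M) has_real_derivative (\<integral>x. G' t0 x \<partial>M)) (at t0)"
proof -
  have at: "at t0 within ball t0 1 = at t0" by (rule at_within_open) auto
  have "((\<lambda>y. ((\<integral>x. G y x \<partial>M) - (\<integral>x. G t0 x \<partial>M)) / (y - t0)) \<longlongrightarrow> (\<integral>x. G' t0 x \<partial>M)) (at t0 within ball t0 1)"
    unfolding tendsto_at_iff_sequentially
  proof (intro allI impI)
    fix X :: "nat \<Rightarrow> real"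
    assume X: "\<forall>i. X i \<in> ball t0 1 - {t0}" and lim: "X \<longlonglongrightarrow> t0"
    have "(\<lambda>n. \<integral>x. (G (X n) x - G t0 x) / (X n - t0) \<partial>M) \<longlonglongrightarrow> (\<integral>x. G' t0 x \<partial>M)"
    proof (rule integral_dominated_convergence[where w = B])
      show "G' t0 \<in> borel_measurable M" by fact
      show "integrable M B" by fact
      show "(\<lambda>x. (G (X n) x - G t0 x) / (X n - t0)) \<in> borel_measurable M" for n
        using G by (intro borel_measurable_divide borel_measurable_diff) auto
      show "AE x in M. (\<lambda>n. (G (X n) x - G t0 x) / (X n - t0)) \<longlonglongrightarrow> G' t0 x"
      proof (rule AE_I2)
        fix x assume x: "x \<in> space M"
        have "((\<lambda>y. (G y x - G t0 x) / (y - t0)) \<longlongrightarrow> G' t0 x) (at t0)"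
          using der[OF x, of t0] by (simp add: has_field_derivative_iff)
        moreover have "filterlim X (at t0) sequentially"
          using X lim by (auto simp: filterlim_at)
        ultimately show "(\<lambda>n. (G (X n) x - G t0 x) / (X n - t0)) \<longlonglongrightarrow> G' t0 x"
          by (rule filterlim_compose)
      qed
      show "AE x in M. norm ((G (X n) x - G t0 x) / (X n - t0)) \<le> B x" for n
      proof (rule AE_I2)
        fix x assume x: "x \<in> space M"
        have "norm (G (X n) x - G t0 x) \<le> B x * norm (X n - t0)"
        proof (rule field_differentiable_bound[where S = "ball t0 1"])
          show "((\<lambda>t. G t x) has_real_derivative G' t x) (at t within ball t0 1)" if "t \<in> ball t0 1" for t
            using der[OF x, of t] that by (auto intro: has_field_derivative_at_within simp: dist_real_def abs_minus_commute)
          show "norm (G' t x) \<le> B x" if "t \<in> ball t0 1" for t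
            using bound[OF x, of t] that by (auto simp: dist_real_def abs_minus_commute)
        qed (use X in auto)
        moreover have "X n \<noteq> t0" using X by auto
        ultimately show "norm ((G (X n) x - G t0 x) / (X n - t0)) \<le> B x"
          by (simp add: field_simps abs_divide)
      qed
    qed
    moreover have "(\<integral>x. (G (X n) x - G t0 x) / (X n - t0) \<partial>M)
        = ((\<integral>x. G (X n) x \<partial>M) - (\<integral>x. G t0 x \<partial>M)) / (X n - t0)" for n
      by (subst Bochner_Integration.integral_diff[OF G G, symmetric]) simp
    ultimately show "((\<lambda>y. ((\<integral>x. G y x \<partial>M) - (\<integral>x. G t0 x \<partial>M)) / (y - t0)) \<circ> X) \<longlonglongrightarrow> (\<integral>x. G' t0 x \<partial>M)"
      by (simp only: comp_def)
  qed
  thus ?thesis unfolding at has_field_derivative_iff .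
qed

interpretation lborel_PiM: product_sigma_finite "\<lambda>_::'i. lborel :: real measure" ..

lemma space_lebN [simp]: "space (lebN N) = RN N"
  by (simp add: lebN_def RN_def space_PiM)

lemma coord_measurable [measurable]: "k < N \<Longrightarrow> (\<lambda>x. x k) \<in> borel_measurable (lebN N)"
  unfolding lebN_def using measurable_component_singleton[of k "{..<N}" "\<lambda>_. lborel"] by simp

lemma sum_coord_measurable [measurable]:
  "(\<And>k. k < N \<Longrightarrow> f k \<in> borel_measurable (lebN N)) \<Longrightarrow> (\<lambda>x. \<Sum>k<N. f k x :: real) \<in> borel_measurable (lebN N)"
  by (intro borel_measurable_sum) auto

lemma mean_measurable [measurable]: "mean N \<in> borel_measurable (lebN N)"
  unfolding mean_def[abs_def] by measurable

lemma VN_measurable [measurable]: "VN \<mu> N \<in> borel_measurable (lebN N)"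
proof (cases "N = 0")
  case False thus ?thesis unfolding VN_def[abs_def]
    by (intro borel_measurable_add borel_measurable_times borel_measurable_const sum_coord_measurable
        borel_measurable_divide borel_measurable_power borel_measurable_diff coord_measurable) auto
qed (simp add: VN_def[abs_def])

lemma weight_measurable [measurable]: "weight \<mu> h N \<in> borel_measurable (lebN N)"
  unfolding weight_def[abs_def] by measurable

text \<open>A class closed under sums and products that contains coordinates, bounded measurable
  functions and exponentials of linear functions, and whose members are integrable against the
  weight for every h > 0. It replaces separate integrability proofs.\<close>

definition egrowth :: "nat \<Rightarrow> ((nat \<Rightarrow> real) \<Rightarrow> real) \<Rightarrow> bool" where
  "egrowth N g \<longleftrightarrow> g \<in> borel_measurable (lebN N) \<and>
     (\<exists>a\<ge>0. \<forall>x\<in>RN N. \<bar>g x\<bar> \<le> exp (a * (1 + (\<Sum>k<N. \<bar>x k\<bar>))))"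

lemma egrowth_measurable [measurable_dest]: "egrowth N g \<Longrightarrow> g \<in> borel_measurable (lebN N)"
  by (simp add: egrowth_def)

lemma egrowthI:
  assumes "g \<in> borel_measurable (lebN N)" "\<And>x. x \<in> RN N \<Longrightarrow> \<bar>g x\<bar> \<le> exp (a * (1 + (\<Sum>k<N. \<bar>x k\<bar>)))"
  shows "egrowth N g"
proof -
  have "a * (1 + (\<Sum>k<N. \<bar>x k\<bar>)) \<le> max a 0 * (1 + (\<Sum>k<N. \<bar>x k\<bar>))" for x :: "nat \<Rightarrow> real"
    by (intro mult_right_mono) (auto intro: sum_nonneg add_nonneg_nonneg)
  hence "\<bar>g x\<bar> \<le> exp (max a 0 * (1 + (\<Sum>k<N. \<bar>x k\<bar>)))" if "x \<in> RN N" for x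
    using assms(2)[OF that] by (meson exp_le_cancel_iff order.trans)
  thus ?thesis unfolding egrowth_def using assms(1) by (intro conjI exI[of _ "max a 0"]) auto
qed

lemma le_exp_self: "(t::real) \<le> exp t"
  using exp_ge_add_one_self[of t] by linarith

lemma egrowth_bounded:
  assumes "g \<in> borel_measurable (lebN N)" "\<And>x. x \<in> RN N \<Longrightarrow> \<bar>g x\<bar> \<le> B"
  shows "egrowth N g"
proof (rule egrowthI[OF assms(1)])
  fix x assume x: "x \<in> RN N"
  have "\<bar>g x\<bar> \<le> \<bar>B\<bar>" using assms(2)[OF x] by linarith
  also have "\<dots> \<le> \<bar>B\<bar> * (1 + (\<Sum>k<N. \<bar>x k\<bar>))" by (simp add: distrib_left sum_nonneg)
  also have "\<dots> \<le> exp (\<bar>B\<bar> * (1 + (\<Sum>k<N. \<bar>x k\<bar>)))" by (rule le_exp_self)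
  finally show "\<bar>g x\<bar> \<le> exp (\<bar>B\<bar> * (1 + (\<Sum>k<N. \<bar>x k\<bar>)))" .
qed

lemma egrowth_const: "egrowth N (\<lambda>_. c)"
  by (rule egrowth_bounded[where B = "\<bar>c\<bar>"]) auto

lemma egrowth_coord: "k < N \<Longrightarrow> egrowth N (\<lambda>x. x k)"
proof (rule egrowthI[where a = 1])
  fix x :: "nat \<Rightarrow> real" assume "k < N"
  hence "\<bar>x k\<bar> \<le> (\<Sum>k<N. \<bar>x k\<bar>)" using member_le_sum[of k "{..<N}" "\<lambda>k. \<bar>x k\<bar>"] by simp
  also have "\<dots> \<le> 1 + (\<Sum>k<N. \<bar>x k\<bar>)" by simp
  also have "\<dots> \<le> exp (1 + (\<Sum>k<N. \<bar>x k\<bar>))" by (rule le_exp_self)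
  finally show "\<bar>x k\<bar> \<le> exp (1 * (1 + (\<Sum>k<N. \<bar>x k\<bar>)))" by simp
qed simp

lemma egrowth_add: assumes "egrowth N f" "egrowth N g" shows "egrowth N (\<lambda>x. f x + g x)"
proof -
  have [measurable]: "f \<in> borel_measurable (lebN N)" "g \<in> borel_measurable (lebN N)"
    using assms by (auto dest: egrowth_measurable)
  obtain a b where a: "a \<ge> 0" "\<And>x. x \<in> RN N \<Longrightarrow> \<bar>f x\<bar> \<le> exp (a * (1 + (\<Sum>k<N. \<bar>x k\<bar>)))"
    and b: "b \<ge> 0" "\<And>x. x \<in> RN N \<Longrightarrow> \<bar>g x\<bar> \<le> exp (b * (1 + (\<Sum>k<N. \<bar>x k\<bar>)))"
    using assms unfolding egrowth_def by metis
  show ?thesis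
  proof (rule egrowthI[where a = "max a b + 1"])
    fix x assume x: "x \<in> RN N"
    define s where "s = 1 + (\<Sum>k<N. \<bar>x k\<bar>)"
    have s: "s \<ge> 1" unfolding s_def by (simp add: sum_nonneg)
    have "a * s \<le> max a b * s" "b * s \<le> max a b * s" using s by (auto intro!: mult_right_mono)
    hence "exp (a * s) \<le> exp (max a b * s)" "exp (b * s) \<le> exp (max a b * s)" by auto
    hence "\<bar>f x + g x\<bar> \<le> 2 * exp (max a b * s)" using a(2)[OF x] b(2)[OF x] unfolding s_def[symmetric] by linarith
    also have "(2::real) \<le> exp s" using s exp_ge_add_one_self[of s] by linarith
    hence "2 * exp (max a b * s) \<le> exp s * exp (max a b * s)" by (intro mult_right_mono) auto
    also have "\<dots> = exp ((max a b + 1) * s)" by (simp add: exp_add[symmetric] algebra_simps)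
    finally show "\<bar>f x + g x\<bar> \<le> exp ((max a b + 1) * (1 + (\<Sum>k<N. \<bar>x k\<bar>)))" unfolding s_def .
  qed measurable
qed

lemma egrowth_mult: assumes "egrowth N f" "egrowth N g" shows "egrowth N (\<lambda>x. f x * g x)"
proof -
  have [measurable]: "f \<in> borel_measurable (lebN N)" "g \<in> borel_measurable (lebN N)"
    using assms by (auto dest: egrowth_measurable)
  obtain a b where a: "a \<ge> 0" "\<And>x. x \<in> RN N \<Longrightarrow> \<bar>f x\<bar> \<le> exp (a * (1 + (\<Sum>k<N. \<bar>x k\<bar>)))"
    and b: "b \<ge> 0" "\<And>x. x \<in> RN N \<Longrightarrow> \<bar>g x\<bar> \<le> exp (b * (1 + (\<Sum>k<N. \<bar>x k\<bar>)))"
    using assms unfolding egrowth_def by metis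
  show ?thesis
  proof (rule egrowthI[where a = "a + b"])
    fix x assume x: "x \<in> RN N"
    show "\<bar>f x * g x\<bar> \<le> exp ((a + b) * (1 + (\<Sum>k<N. \<bar>x k\<bar>)))"
      unfolding abs_mult distrib_right exp_add by (intro mult_mono a b x) auto
  qed measurable
qed

lemma egrowth_minus: "egrowth N f \<Longrightarrow> egrowth N (\<lambda>x. - f x)"
  using egrowth_mult[OF egrowth_const[of N "-1"], of f] by simp

lemma egrowth_diff: "egrowth N f \<Longrightarrow> egrowth N g \<Longrightarrow> egrowth N (\<lambda>x. f x - g x)"
  using egrowth_add[of N f "\<lambda>x. - g x"] egrowth_minus by simp

lemma egrowth_divide: "egrowth N f \<Longrightarrow> egrowth N (\<lambda>x. f x / c)"
  using egrowth_mult[OF egrowth_const[of N "1/c"], of f] by simp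

lemma egrowth_power: "egrowth N f \<Longrightarrow> egrowth N (\<lambda>x. f x ^ n)"
  by (induction n) (auto intro: egrowth_const egrowth_mult)

lemma egrowth_sum: "(\<And>k. k \<in> A \<Longrightarrow> egrowth N (f k)) \<Longrightarrow> egrowth N (\<lambda>x. \<Sum>k\<in>A. f k x)"
  by (induction A rule: infinite_finite_induct) (auto intro: egrowth_const egrowth_add)

lemma egrowth_mean: "egrowth N (mean N)"
  unfolding mean_def[abs_def] by (intro egrowth_divide egrowth_sum egrowth_coord) auto

lemma egrowth_exp_linear:
  assumes "f \<in> borel_measurable (lebN N)" "\<And>x. x \<in> RN N \<Longrightarrow> \<bar>f x\<bar> \<le> a * (1 + (\<Sum>k<N. \<bar>x k\<bar>))"
  shows "egrowth N (\<lambda>x. exp (f x))"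
proof (rule egrowthI[where a = a])
  fix x assume "x \<in> RN N"
  from assms(2)[OF this] show "\<bar>exp (f x)\<bar> \<le> exp (a * (1 + (\<Sum>k<N. \<bar>x k\<bar>)))" by simp
qed (use assms in measurable)

lemma egrowth_abs: "egrowth N f \<Longrightarrow> egrowth N (\<lambda>x. \<bar>f x\<bar>)"
  by (auto simp: egrowth_def)

lemmas egrowth_intros = egrowth_const egrowth_coord egrowth_add egrowth_mult egrowth_minus egrowth_diff
  egrowth_divide egrowth_power egrowth_sum egrowth_mean

lemma integrable_gaussian: "s > 0 \<Longrightarrow> integrable lborel (\<lambda>t::real. exp (- s * t\<^sup>2))"
proof -
  assume s: "s > 0"
  define \<sigma> where "\<sigma> = sqrt (1 / (2 * s))"
  have \<sigma>: "\<sigma> > 0" "\<sigma>\<^sup>2 = 1 / (2 * s)" unfolding \<sigma>_def using s by auto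
  have "integrable lborel (\<lambda>t. sqrt (2 * pi * \<sigma>\<^sup>2) * normal_density 0 \<sigma> t)"
    using \<sigma> by (intro integrable_mult_right integrable_normal_density) auto
  also have "(\<lambda>t. sqrt (2 * pi * \<sigma>\<^sup>2) * normal_density 0 \<sigma> t) = (\<lambda>t. exp (- s * t\<^sup>2))"
    unfolding normal_density_def using \<sigma> s by (auto simp: fun_eq_iff field_simps)
  finally show ?thesis .
qed

lemma integrable_exp_abs_gaussian: "s > 0 \<Longrightarrow> integrable lborel (\<lambda>t::real. exp (a * \<bar>t\<bar> - s * t\<^sup>2))"
proof -
  assume s: "s > 0"
  have "integrable lborel (\<lambda>t. exp (a\<^sup>2 / (2 * s)) * exp (- (s / 2) * t\<^sup>2))"
    using s by (intro integrable_mult_right integrable_gaussian) auto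
  thus ?thesis
  proof (rule Bochner_Integration.integrable_bound)
    show "AE t in lborel. norm (exp (a * \<bar>t\<bar> - s * t\<^sup>2)) \<le> norm (exp (a\<^sup>2 / (2 * s)) * exp (- (s / 2) * t\<^sup>2))"
    proof (rule AE_I2)
      fix t :: real
      have "0 \<le> (a - s * \<bar>t\<bar>)\<^sup>2 / (2 * s)" using s by simp
      also have "\<dots> = a\<^sup>2 / (2 * s) - a * \<bar>t\<bar> + s / 2 * t\<^sup>2"
        using s by (simp add: power2_diff power_mult_distrib field_simps) (simp add: power2_eq_square)
      finally show "norm (exp (a * \<bar>t\<bar> - s * t\<^sup>2)) \<le> norm (exp (a\<^sup>2 / (2 * s)) * exp (- (s / 2) * t\<^sup>2))"
        by (simp flip: exp_add)
    qed
  qed simp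
qed

section \<open>Integrals at a fixed value of the field\<close>

locale chain =
  fixes \<mu> h :: real and N :: nat
  assumes \<mu>: "\<mu> > 1" and h: "h > 0" and N: "N > 0"
begin

text \<open>(t^2 - 2)^2 \<ge> 0 bounds the double well below by a quadratic, and the coupling is
  nonnegative. This gives Gaussian domination of the weight.\<close>

lemma VN_lower: "(\<Sum>k<N. (x k)\<^sup>2 / 2 - 3 / 4) \<le> VN \<mu> N x"
proof -
  have "t\<^sup>2 / 2 - 3 / 4 \<le> (t\<^sup>2 - 1)\<^sup>2 / 4" for t :: real
    using zero_le_power2[of "t\<^sup>2 - 2"] by (simp add: power2_eq_square field_simps)
  hence "(\<Sum>k<N. (x k)\<^sup>2 / 2 - 3 / 4) \<le> (\<Sum>k<N. ((x k)\<^sup>2 - 1)\<^sup>2 / 4)" by (intro sum_mono) auto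
  moreover have "0 \<le> \<mu> / (8 * (sin (pi / real N))\<^sup>2) * (\<Sum>k<N. (x k - x ((k + 1) mod N))\<^sup>2)"
    using \<mu> by (intro mult_nonneg_nonneg divide_nonneg_nonneg sum_nonneg) auto
  ultimately show ?thesis unfolding VN_def by linarith
qed

lemma integrable_egrowth_weight:
  assumes g: "egrowth N g"
  shows "integrable (lebN N) (\<lambda>x. g x * weight \<mu> h N x)"
proof -
  have [measurable]: "g \<in> borel_measurable (lebN N)" using g by (rule egrowth_measurable)
  obtain a where a: "a \<ge> 0" "\<And>x. x \<in> RN N \<Longrightarrow> \<bar>g x\<bar> \<le> exp (a * (1 + (\<Sum>k<N. \<bar>x k\<bar>)))"
    using g unfolding egrowth_def by metis
  define s where "s = 1 / (2 * (h * real N))"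
  have s: "s > 0" unfolding s_def using h N by simp
  define b where "b = exp a * exp ((\<Sum>k<N. 3 / 4) / (h * real N))"
  have "integrable (lebN N) (\<lambda>x. b * (\<Prod>k<N. exp (a * \<bar>x k\<bar> - s * (x k)\<^sup>2)))"
    unfolding lebN_def
    by (intro integrable_mult_right lborel_PiM.product_integrable_prod integrable_exp_abs_gaussian s) auto
  thus ?thesis
  proof (rule Bochner_Integration.integrable_bound)
    show "AE x in lebN N. norm (g x * weight \<mu> h N x) \<le> norm (b * (\<Prod>k<N. exp (a * \<bar>x k\<bar> - s * (x k)\<^sup>2)))"
    proof (rule AE_I2)
      fix x assume "x \<in> space (lebN N)"
      hence x: "x \<in> RN N" by simp
      have "weight \<mu> h N x \<le> exp (- (\<Sum>k<N. (x k)\<^sup>2 / 2 - 3 / 4) / (h * real N))"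
        unfolding weight_def exp_le_cancel_iff using VN_lower[of x] h N by (intro divide_right_mono) auto
      also have "- (\<Sum>k<N. (x k)\<^sup>2 / 2 - 3 / 4) / (h * real N) = (\<Sum>k<N. 3 / 4) / (h * real N) + (\<Sum>k<N. - s * (x k)\<^sup>2)"
      proof -
        have 1: "(\<Sum>k<N. (x k)\<^sup>2 / 2 - 3 / 4) = (\<Sum>k<N. (x k)\<^sup>2) / 2 - (\<Sum>k<N. 3 / 4)"
          by (simp only: sum_subtractf sum_divide_distrib)
        have 2: "(\<Sum>k<N. - s * (x k)\<^sup>2) = - s * (\<Sum>k<N. (x k)\<^sup>2)"
          by (simp only: sum_distrib_left)
        have gen: "- (p / 2 - q) / r = q / r + - (1 / (2 * r)) * p" if "r \<noteq> 0" for p q r :: real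
          using that by (simp add: field_simps)
        show ?thesis unfolding 1 2 unfolding s_def by (rule gen) (use h N in simp)
      qed
      finally have wle: "weight \<mu> h N x \<le> exp ((\<Sum>k<N. 3 / 4) / (h * real N) + (\<Sum>k<N. - s * (x k)\<^sup>2))" .
      have "\<bar>g x\<bar> * weight \<mu> h N x \<le> exp (a * (1 + (\<Sum>k<N. \<bar>x k\<bar>))) * exp ((\<Sum>k<N. 3 / 4) / (h * real N) + (\<Sum>k<N. - s * (x k)\<^sup>2))"
        by (rule mult_mono[OF a(2)[OF x] wle]) (auto simp: weight_def)
      also have "\<dots> = b * exp (\<Sum>k<N. a * \<bar>x k\<bar> - s * (x k)\<^sup>2)"
        unfolding b_def by (simp add: exp_add[symmetric] sum_subtractf sum_negf sum_distrib_left algebra_simps)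
      finally show "norm (g x * weight \<mu> h N x) \<le> norm (b * (\<Prod>k<N. exp (a * \<bar>x k\<bar> - s * (x k)\<^sup>2)))"
        by (simp add: abs_mult exp_sum b_def weight_def prod_nonneg)
    qed
  qed measurable
qed

text \<open>The joint density of chain and field. Dividing the field term by h N leaves a Gaussian
  in \<xi> - \<open>mean N x\<close> of variance h / \<mu>.\<close>

definition W :: "real \<Rightarrow> (nat \<Rightarrow> real) \<Rightarrow> real" where
  "W \<xi> x = exp (- Vxi \<mu> N \<xi> x / (h * real N))"

lemma W_eq: "W \<xi> x = weight \<mu> h N x * exp (- \<mu> * (\<xi> - mean N x)\<^sup>2 / (2 * h))"
  unfolding W_def Vxi_def weight_def using h N by (simp add: exp_add[symmetric] field_simps)

lemma W_pos: "W \<xi> x > 0" unfolding W_def by simp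

lemma W_le_weight: "W \<xi> x \<le> weight \<mu> h N x"
proof -
  have "exp (- \<mu> * (\<xi> - mean N x)\<^sup>2 / (2 * h)) \<le> 1" using \<mu> h by simp
  from mult_left_mono[OF this, of "weight \<mu> h N x"] show ?thesis unfolding W_eq by (simp add: weight_def)
qed

lemma W_measurable [measurable]: "W \<xi> \<in> borel_measurable (lebN N)"
  unfolding W_eq[abs_def] by measurable

lemma integrable_egrowth_W:
  assumes g: "egrowth N g"
  shows "integrable (lebN N) (\<lambda>x. g x * W \<xi> x)"
proof (rule Bochner_Integration.integrable_bound[OF integrable_egrowth_weight[OF g]])
  have [measurable]: "g \<in> borel_measurable (lebN N)" using g by (rule egrowth_measurable)
  show "(\<lambda>x. g x * W \<xi> x) \<in> borel_measurable (lebN N)" by measurable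
  show "AE x in lebN N. norm (g x * W \<xi> x) \<le> norm (g x * weight \<mu> h N x)"
    using W_le_weight W_pos[THEN less_imp_le] by (auto simp: abs_mult weight_def intro!: AE_I2 mult_left_mono)
qed

text \<open>Left unnormalised: its integral over \<xi> is then directly an integral against the
  original weight, and its value on the constant 1 is, up to a constant factor, the density of the
  field.\<close>

definition K :: "real \<Rightarrow> ((nat \<Rightarrow> real) \<Rightarrow> real) \<Rightarrow> real" where
  "K \<xi> g = (\<integral>x. g x * W \<xi> x \<partial>lebN N)"

lemma K_add: "egrowth N f \<Longrightarrow> egrowth N g \<Longrightarrow> K \<xi> (\<lambda>x. f x + g x) = K \<xi> f + K \<xi> g"
  unfolding K_def by (simp add: distrib_right integrable_egrowth_W)

lemma K_diff: "egrowth N f \<Longrightarrow> egrowth N g \<Longrightarrow> K \<xi> (\<lambda>x. f x - g x) = K \<xi> f - K \<xi> g"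
  unfolding K_def by (simp add: left_diff_distrib integrable_egrowth_W)

lemma K_cmult: "K \<xi> (\<lambda>x. c * f x) = c * K \<xi> f"
  unfolding K_def by (simp add: mult.assoc)

lemma K_sum: "(\<And>k. k \<in> A \<Longrightarrow> egrowth N (f k)) \<Longrightarrow> K \<xi> (\<lambda>x. \<Sum>k\<in>A. f k x) = (\<Sum>k\<in>A. K \<xi> (f k))"
  unfolding K_def by (simp add: sum_distrib_right integrable_egrowth_W)

lemma K_mono:
  assumes "egrowth N f" "egrowth N g" "\<And>x. x \<in> RN N \<Longrightarrow> f x \<le> g x"
  shows "K \<xi> f \<le> K \<xi> g"
  unfolding K_def using assms W_pos[THEN less_imp_le]
  by (intro integral_mono integrable_egrowth_W mult_right_mono) auto

lemma K_nonneg: "(\<And>x. x \<in> RN N \<Longrightarrow> 0 \<le> f x) \<Longrightarrow> 0 \<le> K \<xi> f"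
  unfolding K_def using W_pos[THEN less_imp_le] by (intro integral_nonneg_AE AE_I2) auto

lemma emeasure_RN: "emeasure (lebN N) (RN N) = \<infinity>"
proof -
  have "emeasure (lebN N) (RN N) = (\<Prod>k<N. emeasure lborel (UNIV :: real set))"
    unfolding lebN_def RN_def by (rule lborel_PiM.emeasure_PiM) auto
  also have "\<dots> = \<infinity>" using N by (simp add: ennreal_prod_eq_top emeasure_lborel_UNIV)
  finally show ?thesis .
qed

lemma K_one_pos: "K \<xi> (\<lambda>_. 1) > 0"
proof -
  have "K \<xi> (\<lambda>_. 1) \<noteq> 0"
  proof
    assume "K \<xi> (\<lambda>_. 1) = 0"
    hence "AE x in lebN N. 1 * W \<xi> x = 0"
      unfolding K_def using integrable_egrowth_W[OF egrowth_const, of 1] W_pos[THEN less_imp_le]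
      by (subst (asm) integral_nonneg_eq_0_iff_AE) auto
    hence "AE x in lebN N. False" using W_pos by (auto elim!: eventually_mono simp: less_imp_neq[symmetric])
    hence "emeasure (lebN N) (space (lebN N)) = 0"
      by (subst (asm) AE_iff_measurable[OF sets.top]) auto
    thus False using emeasure_RN by simp
  qed
  moreover have "K \<xi> (\<lambda>_. 1) \<ge> 0" by (rule K_nonneg) simp
  ultimately show ?thesis by simp
qed

lemma K_has_derivative:
  assumes g: "egrowth N g"
  shows "((\<lambda>\<xi>. K \<xi> g) has_real_derivative \<mu> / h * (K \<xi> (\<lambda>x. g x * mean N x) - \<xi> * K \<xi> g)) (at \<xi>)"
proof -
  have [measurable]: "g \<in> borel_measurable (lebN N)" using g by (rule egrowth_measurable)
  have "((\<lambda>\<xi>. \<integral>x. g x * W \<xi> x \<partial>lebN N) has_real_derivative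
     (\<integral>x. g x * (\<mu> / h * (mean N x - \<xi>)) * W \<xi> x \<partial>lebN N)) (at \<xi>)"
  proof (rule has_real_derivative_lebesgue_integral
      [where B = "\<lambda>x. (\<bar>g x\<bar> * (\<mu> / h * (\<bar>mean N x\<bar> + (\<bar>\<xi>\<bar> + 1)))) * weight \<mu> h N x"])
    fix t x
    show "((\<lambda>t. g x * W t x) has_real_derivative g x * (\<mu> / h * (mean N x - t)) * W t x) (at t)"
      unfolding W_eq using h by (auto intro!: derivative_eq_intros simp: field_simps)
    assume t: "\<bar>t - \<xi>\<bar> < 1"
    have "\<bar>mean N x - t\<bar> \<le> \<bar>mean N x\<bar> + (\<bar>\<xi>\<bar> + 1)" using t by linarith
    hence "\<bar>g x\<bar> * (\<mu> / h * \<bar>mean N x - t\<bar>) * W t x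
      \<le> (\<bar>g x\<bar> * (\<mu> / h * (\<bar>mean N x\<bar> + (\<bar>\<xi>\<bar> + 1)))) * weight \<mu> h N x"
      using \<mu> h W_le_weight[of t x] W_pos[of t x, THEN less_imp_le]
      by (intro mult_mono mult_left_mono) auto
    thus "\<bar>g x * (\<mu> / h * (mean N x - t)) * W t x\<bar>
      \<le> (\<bar>g x\<bar> * (\<mu> / h * (\<bar>mean N x\<bar> + (\<bar>\<xi>\<bar> + 1)))) * weight \<mu> h N x"
      using \<mu> h W_pos[of t x] by (simp add: abs_mult)
  next
    show "integrable (lebN N) (\<lambda>x. (\<bar>g x\<bar> * (\<mu> / h * (\<bar>mean N x\<bar> + (\<bar>\<xi>\<bar> + 1)))) * weight \<mu> h N x)"
      by (intro integrable_egrowth_weight egrowth_intros egrowth_abs g)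
  qed (auto intro: integrable_egrowth_W g)
  also have "(\<integral>x. g x * (\<mu> / h * (mean N x - \<xi>)) * W \<xi> x \<partial>lebN N) = K \<xi> (\<lambda>x. \<mu> / h * (g x * mean N x - \<xi> * g x))"
    unfolding K_def by (simp add: algebra_simps)
  also have "\<dots> = \<mu> / h * (K \<xi> (\<lambda>x. g x * mean N x) - \<xi> * K \<xi> g)"
    by (simp only: K_cmult K_diff egrowth_intros g)
  finally show ?thesis unfolding K_def[symmetric] .
qed

end

section \<open>Symmetries and integration by parts\<close>

text \<open>Moving all coordinates together leaves the differences, hence the coupling, unchanged.
  The rotation defined next is the symmetry of the ring that gives all coordinates the same
  law.\<close>

definition translate :: "nat \<Rightarrow> real \<Rightarrow> (nat \<Rightarrow> real) \<Rightarrow> nat \<Rightarrow> real" where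
  "translate N \<tau> x = (\<lambda>k\<in>{..<N}. x k + \<tau>)"

definition rotate :: "nat \<Rightarrow> (nat \<Rightarrow> real) \<Rightarrow> nat \<Rightarrow> real" where
  "rotate N x = (\<lambda>k\<in>{..<N}. x ((k + 1) mod N))"

lemma translate_RN [simp]: "translate N \<tau> x \<in> RN N"
  by (auto simp: translate_def RN_def)

lemma rotate_RN [simp]: "rotate N x \<in> RN N"
  by (auto simp: rotate_def RN_def)

lemma translate_nth [simp]: "k < N \<Longrightarrow> translate N \<tau> x k = x k + \<tau>"
  by (simp add: translate_def)

lemma translate_measurable: "translate N \<tau> \<in> measurable (lebN N) (lebN N)"
  unfolding translate_def[abs_def] lebN_def
  by (rule measurable_restrict) (use coord_measurable[unfolded lebN_def] in auto)

lemma translate_measurable_pair: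
  "(\<lambda>p. translate N (fst p) (snd p)) \<in> measurable (lborel \<Otimes>\<^sub>M lebN N) (lebN N)"
proof -
  have "(\<lambda>p. snd p k + fst p) \<in> borel_measurable (lborel \<Otimes>\<^sub>M lebN N)" if "k < N" for k
  proof -
    have [measurable]: "(\<lambda>p. snd p k) \<in> borel_measurable (lborel \<Otimes>\<^sub>M lebN N)"
      using measurable_compose[OF measurable_snd coord_measurable[OF that], of lborel] by simp
    show ?thesis by measurable
  qed
  thus ?thesis unfolding translate_def[abs_def]
    by (subst (2) lebN_def, intro measurable_restrict) auto
qed

lemma rotate_measurable: "rotate N \<in> measurable (lebN N) (lebN N)"
proof -
  have "(\<lambda>x. x ((k + 1) mod N)) \<in> borel_measurable (lebN N)" if "k < N" for k
    using that by (intro coord_measurable) simp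
  thus ?thesis
    unfolding rotate_def[abs_def] by (subst (2) lebN_def, intro measurable_restrict) auto
qed

lemma distr_translate: "distr (lebN N) (lebN N) (translate N \<tau>) = lebN N"
  unfolding lebN_def
proof (rule lborel_PiM.PiM_eqI)
  fix A :: "nat \<Rightarrow> real set" assume A: "\<And>i. i \<in> {..<N} \<Longrightarrow> A i \<in> sets lborel"
  let ?M = "PiM {..<N} (\<lambda>_. lborel :: real measure)"
  have pre: "translate N \<tau> -` (PiE {..<N} A) \<inter> space ?M = PiE {..<N} (\<lambda>k. (\<lambda>y. \<tau> + y) -` A k)"
    by (auto simp: space_PiM PiE_iff translate_def add.commute)
  have m: "emeasure lborel ((\<lambda>y. \<tau> + y) -` B) = emeasure lborel B" if "B \<in> sets lborel" for B :: "real set"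
  proof -
    have "emeasure lborel B = emeasure (distr lborel borel ((+) \<tau>)) B" by (simp add: lborel_distr_plus)
    also have "\<dots> = emeasure lborel ((+) \<tau> -` B \<inter> space lborel)" using that by (intro emeasure_distr) auto
    finally show ?thesis by simp
  qed
  have vs: "(\<lambda>y. \<tau> + y) -` A k \<in> sets lborel" if "k \<in> {..<N}" for k
    using measurable_sets_borel[of "(\<lambda>y. \<tau> + y)" borel "A k"] A[OF that] by simp
  have "emeasure (distr ?M ?M (translate N \<tau>)) (PiE {..<N} A) = emeasure ?M (PiE {..<N} (\<lambda>k. (\<lambda>y. \<tau> + y) -` A k))"
    unfolding pre[symmetric] using A
    by (intro emeasure_distr translate_measurable[unfolded lebN_def] sets_PiM_I_finite) auto
  also have "\<dots> = (\<Prod>k<N. emeasure lborel ((\<lambda>y. \<tau> + y) -` A k))"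
    using vs by (intro lborel_PiM.emeasure_PiM) auto
  also have "\<dots> = (\<Prod>k<N. emeasure lborel (A k))" using m A by (intro prod.cong) auto
  finally show "emeasure (distr ?M ?M (translate N \<tau>)) (PiE {..<N} A) = (\<Prod>k<N. emeasure lborel (A k))" .
qed auto

lemma bij_betw_Suc_mod: "(N::nat) > 0 \<Longrightarrow> bij_betw (\<lambda>k. (k + 1) mod N) {..<N} {..<N}"
proof (rule bij_betw_imageI)
  assume N: "N > 0"
  show inj: "inj_on (\<lambda>k. (k + 1) mod N) {..<N}"
  proof (rule inj_onI)
    fix i j assume "i \<in> {..<N}" "j \<in> {..<N}" "(i + 1) mod N = (j + 1) mod N"
    moreover have "(l + 1) mod N = (if l + 1 = N then 0 else l + 1)" if "l < N" for l
      using that mod_less[of "l + 1" N] mod_self[of N] by (cases "l + 1 = N") (simp_all only: if_True if_False, simp)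
    ultimately show "i = j" by (simp split: if_splits)
  qed
  show "(\<lambda>k. (k + 1) mod N) ` {..<N} = {..<N}"
    by (rule endo_inj_surj[OF _ _ inj]) (use N in auto)
qed

text \<open>The preimage of a box is the box with its sides permuted by the inverse \<open>r\<close>
  of the cyclic shift, and a product of side lengths does not see the permutation.\<close>

lemma distr_rotate:
  assumes N: "N > 0"
  shows "distr (lebN N) (lebN N) (rotate N) = lebN N"
  unfolding lebN_def
proof (rule lborel_PiM.PiM_eqI)
  fix A :: "nat \<Rightarrow> real set" assume A: "\<And>i. i \<in> {..<N} \<Longrightarrow> A i \<in> sets lborel"
  let ?M = "PiM {..<N} (\<lambda>_. lborel :: real measure)" and ?s = "\<lambda>k. (k + 1) mod N"
  define r where "r = the_inv_into {..<N} ?s"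
  note bij = bij_betw_Suc_mod[OF N]
  have rs: "r (?s k) = k" if "k < N" for k
    unfolding r_def using bij that by (intro the_inv_into_f_f) (auto simp: bij_betw_def)
  have sr: "?s (r j) = j" "r j < N" if "j < N" for j
  proof -
    have j: "j \<in> ?s ` {..<N}" using bij that by (simp add: bij_betw_def)
    show "?s (r j) = j" unfolding r_def using bij j by (intro f_the_inv_into_f) (auto simp: bij_betw_def)
    show "r j < N" unfolding r_def using the_inv_into_into[OF bij_betw_imp_inj_on[OF bij] j order.refl] by simp
  qed
  have sN: "?s k < N" for k using N by simp
  have pre: "rotate N -` (PiE {..<N} A) \<inter> space ?M = PiE {..<N} (\<lambda>j. A (r j))" (is "?L = ?R")
  proof (intro set_eqI iffI)
    fix x assume "x \<in> ?L"
    hence x: "x \<in> extensional {..<N}" "\<And>k. k < N \<Longrightarrow> x (?s k) \<in> A k"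
      by (auto simp: space_PiM PiE_iff rotate_def)
    have "x j \<in> A (r j)" if "j < N" for j using x(2)[OF sr(2)[OF that]] sr(1)[OF that] by simp
    thus "x \<in> ?R" using x(1) by (auto simp: PiE_iff)
  next
    fix x assume "x \<in> ?R"
    hence x: "x \<in> extensional {..<N}" "\<And>j. j < N \<Longrightarrow> x j \<in> A (r j)" by (auto simp: PiE_iff)
    have "x (?s k) \<in> A k" if "k < N" for k using x(2)[OF sN[of k]] unfolding rs[OF that] .
    thus "x \<in> ?L" using x(1) by (auto simp: space_PiM PiE_iff rotate_def)
  qed
  have "emeasure (distr ?M ?M (rotate N)) (PiE {..<N} A) = emeasure ?M (PiE {..<N} (\<lambda>j. A (r j)))"
    unfolding pre[symmetric] using A
    by (intro emeasure_distr rotate_measurable[unfolded lebN_def] sets_PiM_I_finite) auto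
  also have "\<dots> = (\<Prod>j<N. emeasure lborel (A (r j)))"
    using A sr by (intro lborel_PiM.emeasure_PiM) auto
  also have "\<dots> = (\<Prod>k<N. emeasure lborel (A (r (?s k))))"
    by (rule prod.reindex_bij_betw[OF bij, symmetric])
  also have "\<dots> = (\<Prod>k<N. emeasure lborel (A k))" using rs by (intro prod.cong) auto
  finally show "emeasure (distr ?M ?M (rotate N)) (PiE {..<N} A) = (\<Prod>k<N. emeasure lborel (A k))" .
qed auto

lemma integral_translate:
  "g \<in> borel_measurable (lebN N) \<Longrightarrow> (\<integral>x. g (translate N \<tau> x) \<partial>lebN N) = (\<integral>x. (g x :: real) \<partial>lebN N)"
  using integral_distr[OF translate_measurable, of g N \<tau>] by (simp add: distr_translate)

lemma integrable_translate:
  fixes g :: "(nat \<Rightarrow> real) \<Rightarrow> real"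
  assumes "integrable (lebN N) g"
  shows "integrable (lebN N) (\<lambda>x. g (translate N \<tau> x))"
  by (rule integrable_distr[OF translate_measurable]) (simp add: distr_translate assms)

lemma sigma_finite_lebN: "sigma_finite_measure (lebN N)"
  unfolding lebN_def by (rule lborel_PiM.sigma_finite) simp

text \<open>The line integral of \<open>H'\<close> over \<open>[0, 1]\<close> in the direction \<open>(1, \<dots>, 1)\<close> is a difference of two
  translates of \<open>H\<close>, whose integrals agree.\<close>
lemma integral_line_derivative_eq_0:
  fixes H H' :: "(nat \<Rightarrow> real) \<Rightarrow> real"
  assumes der: "\<And>x \<tau>. x \<in> RN N \<Longrightarrow> ((\<lambda>t. H (translate N t x)) has_real_derivative H' (translate N \<tau> x)) (at \<tau>)"
    and cont: "\<And>x \<tau>. x \<in> RN N \<Longrightarrow> isCont (\<lambda>t. H' (translate N t x)) \<tau>"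
    and H: "integrable (lebN N) H" and H': "integrable (lebN N) H'"
  shows "(\<integral>x. H' x \<partial>lebN N) = 0"
proof -
  interpret sf: sigma_finite_measure "lebN N" by (rule sigma_finite_lebN)
  interpret pair_sigma_finite lborel "lebN N" ..
  have [measurable]: "H \<in> borel_measurable (lebN N)" "H' \<in> borel_measurable (lebN N)" using H H' by auto
  define P where "P \<tau> x = H' (translate N \<tau> x) * indicator {0..1} \<tau>" for \<tau> :: real and x
  have mP: "case_prod P \<in> borel_measurable (lborel \<Otimes>\<^sub>M lebN N)"
  proof -
    have "(\<lambda>p. H' (translate N (fst p) (snd p))) \<in> borel_measurable (lborel \<Otimes>\<^sub>M lebN N)"
      by (rule measurable_compose[OF translate_measurable_pair]) simp
    thus ?thesis unfolding P_def case_prod_beta by measurable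
  qed
  have int: "integrable (lborel \<Otimes>\<^sub>M lebN N) (case_prod P)"
  proof (rule Fubini_integrable[OF mP])
    have "(\<integral>x. norm (case_prod P (\<tau>, x)) \<partial>lebN N) = (\<integral>x. \<bar>H' x\<bar> \<partial>lebN N) * indicator {0..1} \<tau>" for \<tau>
      using integral_translate[of "\<lambda>x. \<bar>H' x\<bar>" N \<tau>] by (simp add: P_def abs_mult)
    thus "integrable lborel (\<lambda>\<tau>. \<integral>x. norm (case_prod P (\<tau>, x)) \<partial>lebN N)" by simp
    show "AE \<tau> in lborel. integrable (lebN N) (\<lambda>x. case_prod P (\<tau>, x))"
      using integrable_translate[OF H'] by (auto simp: P_def)
  qed
  have "(\<integral>x. (\<integral>\<tau>. P \<tau> x \<partial>lborel) \<partial>lebN N) = (\<integral>\<tau>. (\<integral>x. P \<tau> x \<partial>lebN N) \<partial>lborel)"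
    by (rule Fubini_integral[OF int])
  also have "\<dots> = (\<integral>\<tau>. (\<integral>x. H' x \<partial>lebN N) * indicator {0..1::real} \<tau> \<partial>lborel)"
    unfolding P_def by (rule Bochner_Integration.integral_cong[OF refl]) (simp add: integral_translate)
  also have "\<dots> = (\<integral>x. H' x \<partial>lebN N) * 1 - (\<integral>x. H' x \<partial>lebN N) * 0"
    by (rule integral_FTC_Icc_real[where F = "\<lambda>t. (\<integral>x. H' x \<partial>lebN N) * t"]) (auto intro!: derivative_eq_intros)
  finally have 1: "(\<integral>x. (\<integral>\<tau>. P \<tau> x \<partial>lborel) \<partial>lebN N) = (\<integral>x. H' x \<partial>lebN N)"
    by (simp only: mult_1_right mult_zero_right diff_0_right)
  have "(\<integral>x. (\<integral>\<tau>. P \<tau> x \<partial>lborel) \<partial>lebN N) = (\<integral>x. H (translate N 1 x) - H (translate N 0 x) \<partial>lebN N)"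
  proof (rule Bochner_Integration.integral_cong[OF refl])
    fix x assume "x \<in> space (lebN N)"
    hence x: "x \<in> RN N" by simp
    show "(\<integral>\<tau>. P \<tau> x \<partial>lborel) = H (translate N 1 x) - H (translate N 0 x)"
      unfolding P_def by (rule integral_FTC_Icc_real) (use der[OF x] cont[OF x] in auto)
  qed
  also have "\<dots> = (\<integral>x. H (translate N 1 x) \<partial>lebN N) - (\<integral>x. H (translate N 0 x) \<partial>lebN N)"
    by (intro Bochner_Integration.integral_diff integrable_translate H)
  also have "\<dots> = 0" by (simp add: integral_translate)
  finally show ?thesis using 1 by simp
qed

lemma mean_translate: "N > 0 \<Longrightarrow> mean N (translate N \<tau> x) = mean N x + \<tau>"
  by (simp add: mean_def sum.distrib add_divide_distrib)

lemma VN_rotate: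
  assumes N: "N > 0"
  shows "VN \<mu> N (rotate N x) = VN \<mu> N x" "mean N (rotate N x) = mean N x"
proof -
  have r: "rotate N x k = x ((k + 1) mod N)" if "k < N" for k using that by (simp add: rotate_def)
  have "(\<Sum>k<N. ((rotate N x k)\<^sup>2 - 1)\<^sup>2 / 4) = (\<Sum>k<N. ((x ((k + 1) mod N))\<^sup>2 - 1)\<^sup>2 / 4)"
    by (intro sum.cong) (auto simp: r)
  also have "\<dots> = (\<Sum>k<N. ((x k)\<^sup>2 - 1)\<^sup>2 / 4)" by (rule sum_shift_mod[OF N, of "\<lambda>k. ((x k)\<^sup>2 - 1)\<^sup>2 / 4"])
  finally have 1: "(\<Sum>k<N. ((rotate N x k)\<^sup>2 - 1)\<^sup>2 / 4) = (\<Sum>k<N. ((x k)\<^sup>2 - 1)\<^sup>2 / 4)" .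
  have "(\<Sum>k<N. (rotate N x k - rotate N x ((k + 1) mod N))\<^sup>2)
      = (\<Sum>k<N. (x ((k + 1) mod N) - x (((k + 1) mod N + 1) mod N))\<^sup>2)"
    using N by (intro sum.cong) (auto simp: r)
  also have "\<dots> = (\<Sum>k<N. (x k - x ((k + 1) mod N))\<^sup>2)"
    by (rule sum_shift_mod[OF N, of "\<lambda>k. (x k - x ((k + 1) mod N))\<^sup>2"])
  finally show "VN \<mu> N (rotate N x) = VN \<mu> N x" unfolding VN_def 1 by simp
  have "(\<Sum>k<N. rotate N x k) = (\<Sum>k<N. x ((k + 1) mod N))" by (intro sum.cong) (auto simp: r)
  also have "\<dots> = (\<Sum>k<N. x k)" by (rule sum_shift_mod[OF N])
  finally show "mean N (rotate N x) = mean N x" by (simp add: mean_def)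
qed

text \<open>The source of Cauchy-Schwarz both for \<open>K\<close> and for integrals over intervals;
  the degenerate case C = 0 forces B = 0.\<close>

lemma discriminant_le:
  fixes A B C :: real
  assumes "\<And>t. 0 \<le> A + 2 * t * B + t\<^sup>2 * C" and C: "0 \<le> C"
  shows "B\<^sup>2 \<le> A * C"
proof (cases "C = 0")
  case True
  have "B = 0"
  proof (rule ccontr)
    assume "B \<noteq> 0"
    thus False using assms(1)[of "- (A + 1) / (2 * B)"] True by (simp add: field_simps)
  qed
  thus ?thesis using True by simp
next
  case False
  hence "C > 0" using C by simp
  thus ?thesis using assms(1)[of "- B / C"] by (simp add: power2_eq_square field_simps)
qed

section \<open>Rotation invariance and integration by parts along the constants\<close>

context chain
begin

lemma K_rotate:
  assumes [measurable]: "\<phi> \<in> borel_measurable borel" and k: "k < N"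
  shows "K \<xi> (\<lambda>x. \<phi> (x k)) = K \<xi> (\<lambda>x. \<phi> (x 0))"
  using k
proof (induction k)
  case (Suc k)
  have Wr: "W \<xi> (rotate N x) = W \<xi> x" for x
    unfolding W_def Vxi_def using VN_rotate[OF N] by simp
  have "K \<xi> (\<lambda>x. \<phi> (x k)) = (\<integral>x. \<phi> (x k) * W \<xi> x \<partial>distr (lebN N) (lebN N) (rotate N))"
    unfolding K_def distr_rotate[OF N] ..
  also have "\<dots> = (\<integral>x. \<phi> (rotate N x k) * W \<xi> (rotate N x) \<partial>lebN N)"
    using Suc.prems by (intro integral_distr rotate_measurable) measurable
  also have "\<dots> = K \<xi> (\<lambda>x. \<phi> (x (Suc k)))"
    unfolding K_def Wr using Suc.prems by (simp add: rotate_def)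
  finally show ?case using Suc by simp
qed simp

lemma K_Cauchy_Schwarz:
  assumes "egrowth N f" "egrowth N g"
  shows "(K \<xi> (\<lambda>x. f x * g x))\<^sup>2 \<le> K \<xi> (\<lambda>x. (f x)\<^sup>2) * K \<xi> (\<lambda>x. (g x)\<^sup>2)"
proof (rule discriminant_le)
  fix t
  have "0 \<le> K \<xi> (\<lambda>x. (f x + t * g x)\<^sup>2)" by (rule K_nonneg) simp
  also have "(\<lambda>x. (f x + t * g x)\<^sup>2) = (\<lambda>x. (f x)\<^sup>2 + 2 * t * (f x * g x) + t\<^sup>2 * (g x)\<^sup>2)"
    by (simp add: power2_eq_square algebra_simps)
  also have "K \<xi> \<dots> = K \<xi> (\<lambda>x. (f x)\<^sup>2) + 2 * t * K \<xi> (\<lambda>x. f x * g x) + t\<^sup>2 * K \<xi> (\<lambda>x. (g x)\<^sup>2)"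
    by (simp only: K_add K_cmult egrowth_intros assms)
  finally show "0 \<le> K \<xi> (\<lambda>x. (f x)\<^sup>2) + 2 * t * K \<xi> (\<lambda>x. f x * g x) + t\<^sup>2 * K \<xi> (\<lambda>x. (g x)\<^sup>2)" .
qed (rule K_nonneg, simp)

text \<open>The derivative of \<open>Vxi\<close> in the direction (1, ..., 1), divided by N. The
  coupling sees only differences and does not contribute.\<close>

definition D :: "real \<Rightarrow> (nat \<Rightarrow> real) \<Rightarrow> real" where
  "D \<xi> x = (\<Sum>k<N. (x k) ^ 3) / real N - mean N x + \<mu> * (mean N x - \<xi>)"

lemma egrowth_D: "egrowth N (D \<xi>)"
  unfolding D_def[abs_def] by (intro egrowth_intros) auto

lemma D_translate: "D \<xi> (translate N \<tau> x) = (\<Sum>k<N. (x k + \<tau>) ^ 3) / real N - (mean N x + \<tau>) + \<mu> * (mean N x + \<tau> - \<xi>)"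
  unfolding D_def by (simp add: mean_translate[OF N])

lemma W_translate_deriv:
  "((\<lambda>t. W \<xi> (translate N t x)) has_real_derivative
     - D \<xi> (translate N \<tau> x) / h * W \<xi> (translate N \<tau> x)) (at \<tau>)"
proof -
  define b where "b = \<mu> / (8 * (sin (pi / real N))\<^sup>2) * (\<Sum>k<N. (x k - x ((k + 1) mod N))\<^sup>2)"
  have V: "Vxi \<mu> N \<xi> (translate N t x) = (\<Sum>k<N. ((x k + t)\<^sup>2 - 1)\<^sup>2 / 4) + b + \<mu> / 2 * real N * (\<xi> - mean N x - t)\<^sup>2" for t
  proof -
    have "(\<Sum>k<N. (translate N t x k - translate N t x ((k + 1) mod N))\<^sup>2) = (\<Sum>k<N. (x k - x ((k + 1) mod N))\<^sup>2)"
      using N by (intro sum.cong) auto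
    thus ?thesis unfolding Vxi_def VN_def b_def using N
      by (simp add: mean_translate[OF N] diff_diff_eq)
  qed
  have dV: "((\<lambda>t. Vxi \<mu> N \<xi> (translate N t x)) has_real_derivative real N * D \<xi> (translate N \<tau> x)) (at \<tau>)"
  proof -
    have "((\<lambda>t. (\<Sum>k<N. ((x k + t)\<^sup>2 - 1)\<^sup>2 / 4) + b + \<mu> / 2 * real N * (\<xi> - mean N x - t)\<^sup>2) has_real_derivative
      (\<Sum>k<N. (x k + \<tau>) ^ 3 - (x k + \<tau>)) + 0 + \<mu> / 2 * real N * (2 * (\<xi> - mean N x - \<tau>) * (-1))) (at \<tau>)"
    proof (intro DERIV_add DERIV_sum DERIV_const)
      show "((\<lambda>t. ((x k + t)\<^sup>2 - 1)\<^sup>2 / 4) has_real_derivative (x k + \<tau>) ^ 3 - (x k + \<tau>)) (at \<tau>)" for k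
        by (auto intro!: derivative_eq_intros simp: power2_eq_square power3_eq_cube field_simps)
      show "((\<lambda>t. \<mu> / 2 * real N * (\<xi> - mean N x - t)\<^sup>2) has_real_derivative
          \<mu> / 2 * real N * (2 * (\<xi> - mean N x - \<tau>) * (-1))) (at \<tau>)"
        by (auto intro!: derivative_eq_intros)
    qed
    moreover have "(\<Sum>k<N. (x k + \<tau>) ^ 3 - (x k + \<tau>)) + 0 + \<mu> / 2 * real N * (2 * (\<xi> - mean N x - \<tau>) * (-1))
      = real N * D \<xi> (translate N \<tau> x)"
    proof -
      have "(\<Sum>k<N. x k + \<tau>) = real N * (mean N x + \<tau>)"
        using N by (simp add: mean_def sum.distrib field_simps)
      thus ?thesis unfolding D_translate using N by (simp add: sum_subtractf field_simps)
    qed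
    ultimately show ?thesis unfolding V by simp
  qed
  show ?thesis unfolding W_def
    using h N by (auto intro!: derivative_eq_intros dV simp: field_simps)
qed

text \<open>\<open>G'\<close> is the derivative of \<open>G\<close> in the direction (1, ..., 1),
  and the derivative of \<open>G\<close> times \<open>W\<close> in that direction integrates to 0.
  The N in the derivative of the potential cancels the N of the temperature, leaving the factor
  h.\<close>

lemma K_by_parts:
  assumes der: "\<And>x \<tau>. x \<in> RN N \<Longrightarrow> ((\<lambda>t. G (translate N t x)) has_real_derivative G' (translate N \<tau> x)) (at \<tau>)"
    and cont: "\<And>x \<tau>. x \<in> RN N \<Longrightarrow> isCont (\<lambda>t. G' (translate N t x)) \<tau>"
    and G: "egrowth N G" and G': "egrowth N G'"
  shows "K \<xi> (\<lambda>x. G x * D \<xi> x) = h * K \<xi> G'"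
proof -
  have "(\<integral>x. (G' x - G x * D \<xi> x / h) * W \<xi> x \<partial>lebN N) = 0"
  proof (rule integral_line_derivative_eq_0[where H = "\<lambda>x. G x * W \<xi> x"])
    fix x \<tau> assume x: "x \<in> RN N"
    note dG = der[OF x, of \<tau>]
    show "((\<lambda>t. G (translate N t x) * W \<xi> (translate N t x)) has_real_derivative
      (G' (translate N \<tau> x) - G (translate N \<tau> x) * D \<xi> (translate N \<tau> x) / h) * W \<xi> (translate N \<tau> x)) (at \<tau>)"
      by (rule DERIV_cong[OF DERIV_mult[OF dG W_translate_deriv]]) (simp add: algebra_simps)
    have 1: "isCont (\<lambda>t. G (translate N t x)) \<tau>" "isCont (\<lambda>t. W \<xi> (translate N t x)) \<tau>"
      using dG W_translate_deriv by (auto intro: DERIV_isCont)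
    have 2: "isCont (\<lambda>t. D \<xi> (translate N t x)) \<tau>" unfolding D_translate by (intro continuous_intros) (use N in auto)
    show "isCont (\<lambda>t. (G' (translate N t x) - G (translate N t x) * D \<xi> (translate N t x) / h) * W \<xi> (translate N t x)) \<tau>"
      using h by (intro continuous_intros 1 2 cont[OF x]) auto
  qed (intro integrable_egrowth_W egrowth_intros G G' egrowth_D)+
  hence "K \<xi> (\<lambda>x. G' x - (1 / h) * (G x * D \<xi> x)) = 0" unfolding K_def by simp
  moreover have "K \<xi> (\<lambda>x. G' x - (1 / h) * (G x * D \<xi> x)) = K \<xi> G' - (1 / h) * K \<xi> (\<lambda>x. G x * D \<xi> x)"
    by (simp only: K_diff K_cmult egrowth_intros G G' egrowth_D)
  ultimately show ?thesis using h by (simp add: field_simps)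
qed

text \<open>Integration by parts is applied to 1 here and to \<open>mean N\<close> and
  \<open>D \<xi>\<close> in the next two lemmas. The results are the stationarity equation and the
  two ingredients of the Cramer-Rao bound: the covariance with \<open>D\<close> and its second
  moment.\<close>

lemma K_D: "K \<xi> (D \<xi>) = 0"
proof -
  have "K \<xi> (\<lambda>x. 1 * D \<xi> x) = h * K \<xi> (\<lambda>_. 0)"
    by (rule K_by_parts) (auto intro: egrowth_const)
  thus ?thesis by (simp add: K_def)
qed

lemma K_mean_D: "K \<xi> (\<lambda>x. mean N x * D \<xi> x) = h * K \<xi> (\<lambda>_. 1)"
  by (rule K_by_parts) (auto simp: mean_translate[OF N] intro!: egrowth_intros derivative_eq_intros)

lemma K_D_squared: "K \<xi> (\<lambda>x. D \<xi> x * D \<xi> x) = h * K \<xi> (\<lambda>x. 3 * ((\<Sum>k<N. (x k)\<^sup>2) / real N) + (\<mu> - 1))"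
proof (rule K_by_parts)
  fix x \<tau>
  have "((\<lambda>t. (\<Sum>k<N. (x k + t) ^ 3) / real N - (mean N x + t) + \<mu> * (mean N x + t - \<xi>)) has_real_derivative
    (\<Sum>k<N. 3 * (x k + \<tau>)\<^sup>2) / real N - 1 + \<mu> * 1) (at \<tau>)"
    by (intro DERIV_add DERIV_diff DERIV_cdivide DERIV_sum DERIV_cmult)
      (use N in \<open>auto intro!: derivative_eq_intros simp: power2_eq_square\<close>)
  thus "((\<lambda>t. D \<xi> (translate N t x)) has_real_derivative
    3 * ((\<Sum>k<N. (translate N \<tau> x k)\<^sup>2) / real N) + (\<mu> - 1)) (at \<tau>)"
    unfolding D_translate by (simp add: sum_distrib_left algebra_simps)
  have "isCont (\<lambda>t. 3 * ((\<Sum>k<N. (x k + t)\<^sup>2) / real N) + (\<mu> - 1)) \<tau>"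
    using N by (intro continuous_intros) auto
  thus "isCont (\<lambda>t. 3 * ((\<Sum>k<N. (translate N t x k)\<^sup>2) / real N) + (\<mu> - 1)) \<tau>" by simp
next
  show "egrowth N (\<lambda>x. 3 * ((\<Sum>k<N. (x k)\<^sup>2) / real N) + (\<mu> - 1))" by (intro egrowth_intros) auto
qed (rule egrowth_D)

end

section \<open>Moments and the Poincare inequality at a fixed field\<close>

text \<open>Holds for both signs of s. It serves to expand exponential moments to second order with
  an explicit error, whose coefficient is irrelevant in the limit.\<close>

lemma exp_lower_cubic: "1 + s + s\<^sup>2 / 2 - \<bar>s\<bar> ^ 3 \<le> exp (s::real)"
proof -
  obtain t where t: "exp s = (\<Sum>m<4. s ^ m / fact m) + exp t / fact 4 * s ^ 4"
    using Maclaurin_exp_le[of s 4] by auto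
  have "(\<Sum>m<4. s ^ m / fact m) = 1 + s + s\<^sup>2 / 2 + s ^ 3 / 6"
    by (simp add: eval_nat_numeral)
  moreover have "exp t / fact 4 * s ^ 4 \<ge> 0" by (intro mult_nonneg_nonneg) auto
  moreover have "- (\<bar>s\<bar> ^ 3) \<le> s ^ 3 / 6"
  proof -
    have "\<bar>s ^ 3\<bar> = \<bar>s\<bar> ^ 3" by (simp add: power_abs)
    thus ?thesis by linarith
  qed
  ultimately show ?thesis using t by linarith
qed

lemma square_le_exp: "s\<^sup>2 \<le> 2 * (exp s + exp (- s :: real))"
proof -
  have "1 + \<bar>s\<bar> + \<bar>s\<bar>\<^sup>2 / 2 \<le> exp \<bar>s\<bar>" by (rule exp_lower_Taylor_quadratic) simp
  moreover have "exp \<bar>s\<bar> \<le> exp s + exp (- s)" by (cases "s \<ge> 0") auto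
  ultimately show ?thesis by simp
qed

lemma abs_cube_le_exp: "\<bar>s\<bar> ^ 3 \<le> 27 * (exp s + exp (- s :: real))"
proof -
  have "(\<bar>s\<bar> / 3) ^ 3 \<le> exp (\<bar>s\<bar> / 3) ^ 3"
    by (intro power_mono le_exp_self) auto
  also have "\<dots> = exp \<bar>s\<bar>" by (simp flip: exp_of_nat_mult)
  also have "\<dots> \<le> exp s + exp (- s)" by (cases "s \<ge> 0") auto
  finally show ?thesis by (simp add: power_divide)
qed

context chain
begin

definition E :: "real \<Rightarrow> ((nat \<Rightarrow> real) \<Rightarrow> real) \<Rightarrow> real" where
  "E \<xi> g = K \<xi> g / K \<xi> (\<lambda>_. 1)"

lemma E_const [simp]: "E \<xi> (\<lambda>_. c) = c"
  using K_cmult[of \<xi> c "\<lambda>_. 1"] K_one_pos[of \<xi>] by (simp add: E_def)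

lemma E_add: "egrowth N f \<Longrightarrow> egrowth N g \<Longrightarrow> E \<xi> (\<lambda>x. f x + g x) = E \<xi> f + E \<xi> g"
  by (simp add: E_def K_add add_divide_distrib)

lemma E_diff: "egrowth N f \<Longrightarrow> egrowth N g \<Longrightarrow> E \<xi> (\<lambda>x. f x - g x) = E \<xi> f - E \<xi> g"
  by (simp add: E_def K_diff diff_divide_distrib)

lemma E_cmult: "E \<xi> (\<lambda>x. c * f x) = c * E \<xi> f"
  by (simp add: E_def K_cmult)

lemma E_mono: "egrowth N f \<Longrightarrow> egrowth N g \<Longrightarrow> (\<And>x. x \<in> RN N \<Longrightarrow> f x \<le> g x) \<Longrightarrow> E \<xi> f \<le> E \<xi> g"
  using K_one_pos[of \<xi>] by (simp add: E_def K_mono divide_right_mono)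

lemma E_nonneg: "(\<And>x. x \<in> RN N \<Longrightarrow> 0 \<le> f x) \<Longrightarrow> 0 \<le> E \<xi> f"
  using K_one_pos[of \<xi>] by (simp add: E_def K_nonneg)

text \<open>An infimum-convolution inequality in the spirit of Maurey: Prekopa-Leindler with the
  upper function \<open>W \<xi>\<close> itself, where the convexity of the potential between x and y
  pays for \<open>p x + q y\<close>. The moment bounds and the Poincare inequality come from
  different choices of \<open>p\<close> and \<open>q\<close>.\<close>

lemma K_prekopa_leindler:
  assumes p: "egrowth N (\<lambda>x. exp (p x))" "p \<in> borel_measurable (lebN N)"
    and q: "egrowth N (\<lambda>x. exp (q x))" "q \<in> borel_measurable (lebN N)"
    and gap: "\<And>x y. x \<in> RN N \<Longrightarrow> y \<in> RN N \<Longrightarrow>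
      p x + q y \<le> quad_form \<mu> N (\<lambda>k. x k - y k) / (2 * (h * real N))"
  shows "E \<xi> (\<lambda>x. exp (p x)) * E \<xi> (\<lambda>x. exp (q x)) \<le> 1"
proof -
  have nn: "(\<integral>\<^sup>+x. ennreal (f x * W \<xi> x) \<partial>lebN N) = ennreal (K \<xi> f)"
    if "egrowth N f" "\<And>x. f x \<ge> 0" for f
    unfolding K_def using W_pos[THEN less_imp_le] that
    by (intro nn_integral_eq_integral integrable_egrowth_W) auto
  have "(\<integral>\<^sup>+x. ennreal (exp (p x) * W \<xi> x) \<partial>lebN N) * (\<integral>\<^sup>+x. ennreal (exp (q x) * W \<xi> x) \<partial>lebN N)
    \<le> (\<integral>\<^sup>+x. ennreal (1 * W \<xi> x) \<partial>lebN N)\<^sup>2"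
    unfolding lebN_def
  proof (rule prekopa_leindler_PiM)
    fix x y :: "nat \<Rightarrow> real" assume "x \<in> PiE {..<N} (\<lambda>_. UNIV)" "y \<in> PiE {..<N} (\<lambda>_. UNIV)"
    hence xy: "x \<in> RN N" "y \<in> RN N" by (auto simp: RN_def)
    define z where "z = (\<lambda>i\<in>{..<N}. (x i + y i) / 2)"
    have "quad_form \<mu> N (\<lambda>k. x k - y k) / 2 \<le> Vxi \<mu> N \<xi> x + Vxi \<mu> N \<xi> y - 2 * Vxi \<mu> N \<xi> z"
      by (rule Vxi_midpoint[OF _ N]) (auto simp: z_def)
    hence "quad_form \<mu> N (\<lambda>k. x k - y k) / 2 / (h * real N)
      \<le> (Vxi \<mu> N \<xi> x + Vxi \<mu> N \<xi> y - 2 * Vxi \<mu> N \<xi> z) / (h * real N)"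
      using h by (intro divide_right_mono) auto
    hence "p x + q y \<le> (Vxi \<mu> N \<xi> x + Vxi \<mu> N \<xi> y - 2 * Vxi \<mu> N \<xi> z) / (h * real N)"
      using gap[OF xy] by (simp only: divide_divide_eq_left)
    hence "exp (p x + (- Vxi \<mu> N \<xi> x / (h * real N)) + (q y + (- Vxi \<mu> N \<xi> y / (h * real N))))
       \<le> exp (2 * (- Vxi \<mu> N \<xi> z / (h * real N)))"
      by (simp add: add_divide_distrib diff_divide_distrib)
    hence "exp (p x) * W \<xi> x * (exp (q y) * W \<xi> y) \<le> (1 * W \<xi> z)\<^sup>2"
      unfolding W_def exp_add exp_double by simp
    thus "ennreal (exp (p x) * W \<xi> x) * ennreal (exp (q y) * W \<xi> y)
      \<le> (ennreal (1 * W \<xi> (\<lambda>i\<in>{..<N}. (x i + y i) / 2)))\<^sup>2"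
      unfolding z_def[symmetric] using W_pos[THEN less_imp_le]
      by (simp add: ennreal_mult[symmetric] ennreal_power)
  next
    note [measurable] = p(2) q(2)
    show "(\<lambda>x. ennreal (exp (p x) * W \<xi> x)) \<in> borel_measurable (PiM {..<N} (\<lambda>_. lborel))"
      "(\<lambda>x. ennreal (exp (q x) * W \<xi> x)) \<in> borel_measurable (PiM {..<N} (\<lambda>_. lborel))"
      "(\<lambda>x. ennreal (1 * W \<xi> x)) \<in> borel_measurable (PiM {..<N} (\<lambda>_. lborel))"
      unfolding lebN_def[symmetric] by measurable
  qed simp
  hence "ennreal (K \<xi> (\<lambda>x. exp (p x))) * ennreal (K \<xi> (\<lambda>x. exp (q x))) \<le> (ennreal (K \<xi> (\<lambda>_. 1)))\<^sup>2"
    by (subst (asm) (1 2 3) nn) (auto intro: p q egrowth_const)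
  hence "K \<xi> (\<lambda>x. exp (p x)) * K \<xi> (\<lambda>x. exp (q x)) \<le> (K \<xi> (\<lambda>_. 1))\<^sup>2"
    using K_one_pos[of \<xi>] by (simp add: ennreal_mult[symmetric] ennreal_power K_nonneg)
  thus ?thesis unfolding E_def using K_one_pos[of \<xi>] by (simp add: power2_eq_square)
qed

text \<open>Chosen so that (l x - l y)^2 / (4 \<tau>) stays within the gap allowed by
  \<open>K_prekopa_leindler\<close> when l is a coordinate or the mean. It is the variance scale,
  proportional to h and free of N.\<close>

definition \<tau> :: real where "\<tau> = 16 * pi\<^sup>2 / (\<mu> - 1) * h"

lemma \<tau>_pos: "\<tau> > 0" unfolding \<tau>_def using \<mu> h by simp

text \<open>With the exponents t X - 1 and - t X at t = 1 / sqrt \<tau>, where X is the centred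
  observable, the exponential moments of t X and - t X have product at most e. Each is at least 1
  because X is centred, hence each is at most 3. Pointwise bounds by exp s + exp (- s) then give the
  moments: 12 = 2 * 6 and 162 = 27 * 6.\<close>

lemma linear_moments:
  assumes lin: "egrowth N l" "\<And>t. egrowth N (\<lambda>x. exp (t * l x))"
    and quad: "\<And>x y. (l x - l y)\<^sup>2 \<le> 32 * pi\<^sup>2 / (\<mu> - 1) / real N * quad_form \<mu> N (\<lambda>k. x k - y k)"
  shows "E \<xi> (\<lambda>x. (l x - E \<xi> l)\<^sup>2) \<le> 12 * \<tau>"
    and "E \<xi> (\<lambda>x. \<bar>l x - E \<xi> l\<bar> ^ 3) \<le> 162 * (\<tau> * sqrt \<tau>)"
proof -
  have [measurable]: "l \<in> borel_measurable (lebN N)" using lin(1) by (rule egrowth_measurable)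
  define t where "t = 1 / sqrt \<tau>"
  have t: "t > 0" "t\<^sup>2 * \<tau> = 1" unfolding t_def using \<tau>_pos by (auto simp: power_divide)
  define c where "c = E \<xi> l"
  define X where "X x = l x - c" for x
  have [measurable]: "X \<in> borel_measurable (lebN N)" unfolding X_def by measurable
  have ex: "egrowth N (\<lambda>x. exp (s * X x + r))" for s r
  proof -
    have "(\<lambda>x. exp (s * X x + r)) = (\<lambda>x. exp (- s * c + r) * exp (s * l x))"
      unfolding X_def by (simp add: exp_add[symmetric] algebra_simps)
    thus ?thesis by (simp only:) (intro egrowth_mult egrowth_const lin)
  qed
  have exs: "egrowth N (\<lambda>x. exp (s * X x))" for s using ex[of s 0] by simp
  have "E \<xi> (\<lambda>x. exp (t * X x + (-1))) * E \<xi> (\<lambda>x. exp (- t * X x + 0)) \<le> 1"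
  proof (rule K_prekopa_leindler)
    fix x y
    define d where "d = l x - l y"
    \<comment> \<open>Completing the square: t d exceeds d^2 / (4 \<tau>) by at most t^2 \<tau> = 1,
      which explains the -1 in the first exponent.\<close>
    have "0 \<le> (d - 2 * t * \<tau>)\<^sup>2 / (4 * \<tau>)" using \<tau>_pos by simp
    also have "\<dots> = d\<^sup>2 / (4 * \<tau>) - t * d + t\<^sup>2 * \<tau>" using \<tau>_pos by (simp add: power2_eq_square field_simps)
    finally have 1: "t * d - 1 \<le> d\<^sup>2 / (4 * \<tau>)" using t by simp
    also have "\<dots> \<le> (32 * pi\<^sup>2 / (\<mu> - 1) / real N * quad_form \<mu> N (\<lambda>k. x k - y k)) / (4 * \<tau>)"
      unfolding d_def using quad \<tau>_pos by (intro divide_right_mono) auto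
    also have "\<dots> = quad_form \<mu> N (\<lambda>k. x k - y k) / (2 * (h * real N))"
      unfolding \<tau>_def using \<mu> h N by (simp add: field_simps)
    finally show "t * X x + (-1) + (- t * X y + 0) \<le> quad_form \<mu> N (\<lambda>k. x k - y k) / (2 * (h * real N))"
      unfolding X_def d_def by (simp add: algebra_simps)
  qed (use ex in measurable)
  moreover have "(\<lambda>x. exp (t * X x + (-1))) = (\<lambda>x. exp (-1) * exp (t * X x))" by (simp add: exp_add[symmetric] fun_eq_iff)
  ultimately have "exp (-1) * (E \<xi> (\<lambda>x. exp (t * X x)) * E \<xi> (\<lambda>x. exp (- t * X x))) \<le> 1"
    by (simp only: E_cmult) simp
  hence prod: "E \<xi> (\<lambda>x. exp (t * X x)) * E \<xi> (\<lambda>x. exp (- t * X x)) \<le> exp 1"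
    by (simp add: exp_minus field_simps)
  have ge1: "1 \<le> E \<xi> (\<lambda>x. exp (s * X x))" for s
  proof -
    have "E \<xi> (\<lambda>x. 1 + s * (l x - c)) = 1 + s * (E \<xi> l - c)"
      by (simp only: E_add E_diff E_cmult E_const egrowth_intros lin)
    also have "\<dots> = 1" unfolding c_def by simp
    finally have "1 = E \<xi> (\<lambda>x. 1 + s * X x)" unfolding X_def by simp
    also have "\<dots> \<le> E \<xi> (\<lambda>x. exp (s * X x))"
    proof (rule E_mono)
      show "egrowth N (\<lambda>x. 1 + s * X x)" unfolding X_def by (intro egrowth_intros lin)
      show "1 + s * X x \<le> exp (s * X x)" for x using exp_ge_add_one_self[of "s * X x"] by simp
    qed (rule exs)
    finally show ?thesis .
  qed
  have a: "E \<xi> (\<lambda>x. exp (t * X x)) \<le> 3" "E \<xi> (\<lambda>x. exp (- t * X x)) \<le> 3"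
  proof -
    have e3: "exp (1::real) \<le> 3" by (rule exp_le)
    show "E \<xi> (\<lambda>x. exp (t * X x)) \<le> 3"
      using mult_left_mono[OF ge1[of "-t"], of "E \<xi> (\<lambda>x. exp (t * X x))"] ge1[of t] prod e3 by linarith
    show "E \<xi> (\<lambda>x. exp (- t * X x)) \<le> 3"
      using mult_right_mono[OF ge1[of t], of "E \<xi> (\<lambda>x. exp (- t * X x))"] ge1[of "-t"] prod e3 by linarith
  qed
  have E6: "E \<xi> (\<lambda>x. exp (t * X x) + exp (- t * X x)) \<le> 6"
    using a exs[of t] exs[of "-t"] by (simp add: E_add)
  have X: "egrowth N X" unfolding X_def by (intro egrowth_intros lin)
  have "t\<^sup>2 * E \<xi> (\<lambda>x. (X x)\<^sup>2) = E \<xi> (\<lambda>x. t\<^sup>2 * (X x)\<^sup>2)" by (simp only: E_cmult)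
  also have "\<dots> \<le> E \<xi> (\<lambda>x. 2 * (exp (t * X x) + exp (- t * X x)))"
  proof (rule E_mono)
    show "t\<^sup>2 * (X x)\<^sup>2 \<le> 2 * (exp (t * X x) + exp (- t * X x))" for x
      using square_le_exp[of "t * X x"] by (simp add: power_mult_distrib)
  qed (intro egrowth_intros exs X)+
  also have "\<dots> \<le> 12" using E6 by (simp only: E_cmult)
  finally have "\<tau> * (t\<^sup>2 * E \<xi> (\<lambda>x. (X x)\<^sup>2)) \<le> \<tau> * 12" using \<tau>_pos by (intro mult_left_mono) auto
  moreover have "\<tau> * (t\<^sup>2 * E \<xi> (\<lambda>x. (X x)\<^sup>2)) = (t\<^sup>2 * \<tau>) * E \<xi> (\<lambda>x. (X x)\<^sup>2)" by (simp only: mult_ac)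
  ultimately have "E \<xi> (\<lambda>x. (X x)\<^sup>2) \<le> 12 * \<tau>" unfolding t(2) by (simp only: mult_1 mult.commute)
  thus "E \<xi> (\<lambda>x. (l x - E \<xi> l)\<^sup>2) \<le> 12 * \<tau>" unfolding X_def c_def .
  have "t ^ 3 * E \<xi> (\<lambda>x. \<bar>X x\<bar> ^ 3) = E \<xi> (\<lambda>x. t ^ 3 * \<bar>X x\<bar> ^ 3)" by (simp only: E_cmult)
  also have "\<dots> \<le> E \<xi> (\<lambda>x. 27 * (exp (t * X x) + exp (- t * X x)))"
  proof (rule E_mono)
    show "t ^ 3 * \<bar>X x\<bar> ^ 3 \<le> 27 * (exp (t * X x) + exp (- t * X x))" for x
      using abs_cube_le_exp[of "t * X x"] t by (simp add: power_mult_distrib abs_mult)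
  qed (intro egrowth_intros egrowth_abs exs X)+
  also have "\<dots> \<le> 162" using E6 by (simp only: E_cmult)
  finally have "(\<tau> * sqrt \<tau>) * (t ^ 3 * E \<xi> (\<lambda>x. \<bar>X x\<bar> ^ 3)) \<le> (\<tau> * sqrt \<tau>) * 162"
    using \<tau>_pos by (intro mult_left_mono) auto
  moreover have "(\<tau> * sqrt \<tau>) * t ^ 3 = 1"
    unfolding t_def using \<tau>_pos by (simp add: power_divide power3_eq_cube)
  hence "(\<tau> * sqrt \<tau>) * (t ^ 3 * E \<xi> (\<lambda>x. \<bar>X x\<bar> ^ 3)) = E \<xi> (\<lambda>x. \<bar>X x\<bar> ^ 3)"
    by (simp only: mult.assoc[symmetric] mult_1)
  ultimately have "E \<xi> (\<lambda>x. \<bar>X x\<bar> ^ 3) \<le> 162 * (\<tau> * sqrt \<tau>)" by (simp only: mult.commute)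
  thus "E \<xi> (\<lambda>x. \<bar>l x - E \<xi> l\<bar> ^ 3) \<le> 162 * (\<tau> * sqrt \<tau>)" unfolding X_def c_def .
qed

lemma coord_moments:
  assumes k: "k < N"
  shows "E \<xi> (\<lambda>x. (x k - E \<xi> (\<lambda>x. x k))\<^sup>2) \<le> 12 * \<tau>"
    and "E \<xi> (\<lambda>x. \<bar>x k - E \<xi> (\<lambda>x. x k)\<bar> ^ 3) \<le> 162 * (\<tau> * sqrt \<tau>)"
proof -
  have e: "egrowth N (\<lambda>x. exp (t * x k))" for t
  proof (rule egrowth_exp_linear[where a = "\<bar>t\<bar>"])
    fix x :: "nat \<Rightarrow> real"
    have "\<bar>x k\<bar> \<le> (\<Sum>k<N. \<bar>x k\<bar>)" using member_le_sum[of k "{..<N}" "\<lambda>k. \<bar>x k\<bar>"] k by simp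
    also have "\<dots> \<le> 1 + (\<Sum>k<N. \<bar>x k\<bar>)" by simp
    finally show "\<bar>t * x k\<bar> \<le> \<bar>t\<bar> * (1 + (\<Sum>k<N. \<bar>x k\<bar>))" unfolding abs_mult by (intro mult_left_mono) auto
  qed (use k in measurable)
  note m = linear_moments[OF egrowth_coord[OF k] e coord_le_quad_form[OF \<mu> k]]
  show "E \<xi> (\<lambda>x. (x k - E \<xi> (\<lambda>x. x k))\<^sup>2) \<le> 12 * \<tau>" by (rule m(1))
  show "E \<xi> (\<lambda>x. \<bar>x k - E \<xi> (\<lambda>x. x k)\<bar> ^ 3) \<le> 162 * (\<tau> * sqrt \<tau>)" by (rule m(2))
qed

lemma mean_variance: "E \<xi> (\<lambda>x. (mean N x - E \<xi> (mean N))\<^sup>2) \<le> 12 * \<tau>"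
proof (rule linear_moments(1))
  show "egrowth N (\<lambda>x. exp (t * mean N x))" for t
  proof (rule egrowth_exp_linear[where a = "\<bar>t\<bar>"])
    fix x :: "nat \<Rightarrow> real"
    have "\<bar>mean N x\<bar> \<le> (\<Sum>k<N. \<bar>x k\<bar>) / real N" unfolding mean_def abs_divide
      by (simp add: divide_right_mono)
    also have "\<dots> \<le> (\<Sum>k<N. \<bar>x k\<bar>) / 1" using N by (intro divide_left_mono) (auto simp: sum_nonneg)
    also have "\<dots> \<le> 1 + (\<Sum>k<N. \<bar>x k\<bar>)" by simp
    finally show "\<bar>t * mean N x\<bar> \<le> \<bar>t\<bar> * (1 + (\<Sum>k<N. \<bar>x k\<bar>))" unfolding abs_mult by (intro mult_left_mono) auto
  qed measurable
  show "(mean N x - mean N y)\<^sup>2 \<le> 32 * pi\<^sup>2 / (\<mu> - 1) / real N * quad_form \<mu> N (\<lambda>k. x k - y k)" for x y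
    using mean_le_quad_form[OF \<mu> N, of "\<lambda>k. x k - y k"]
    by (simp add: mean_def sum_subtractf diff_divide_distrib)
qed (rule egrowth_mean)

text \<open>The product inequality is linearised with exponents \<open>q\<close> = e X - e^2 m g and
  - e X, where X is \<open>f\<close> centred and g the squared gradient. The first-order terms
  vanish under \<open>E\<close>, and the order e^2 says that the variance is at most m times the
  mean of g. The functions \<open>p k\<close> play the role of partial derivatives, and the Taylor
  constant \<open>B\<close> only affects m e at e > 0, not its limit.\<close>

lemma poincare:
  assumes f: "f \<in> borel_measurable (lebN N)" "\<And>x. x \<in> RN N \<Longrightarrow> \<bar>f x\<bar> \<le> F"
    and G: "\<And>k. k < N \<Longrightarrow> p k \<in> borel_measurable (lebN N)" "\<And>x k. k < N \<Longrightarrow> x \<in> RN N \<Longrightarrow> \<bar>p k x\<bar> \<le> P"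
    and taylor: "\<And>x y. x \<in> RN N \<Longrightarrow> y \<in> RN N \<Longrightarrow>
      f x - f y \<le> (\<Sum>k<N. p k x * (x k - y k)) + B * (\<Sum>k<N. (x k - y k)\<^sup>2)"
  shows "E \<xi> (\<lambda>x. (f x)\<^sup>2) - (E \<xi> f)\<^sup>2 \<le> h * real N / (\<mu> - 1) * E \<xi> (\<lambda>x. \<Sum>k<N. (p k x)\<^sup>2)"
proof -
  note [measurable] = f(1) G(1)
  define \<kappa> where "\<kappa> = (\<mu> - 1) / (h * real N)"
  have \<kappa>: "\<kappa> > 0" unfolding \<kappa>_def using \<mu> h N by simp
  define c where "c = E \<xi> f"
  define X where "X x = f x - c" for x
  define g where "g x = (\<Sum>k<N. (p k x)\<^sup>2)" for x
  define A where "A = \<bar>F\<bar> + \<bar>c\<bar>"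
  define L where "L = real N * P\<^sup>2 * 2 / \<kappa>"
  have [measurable]: "X \<in> borel_measurable (lebN N)" "g \<in> borel_measurable (lebN N)" unfolding X_def g_def by measurable
  have XA: "\<bar>X x\<bar> \<le> A" if "x \<in> RN N" for x using f(2)[OF that] unfolding X_def A_def by linarith
  have g0: "g x \<ge> 0" for x unfolding g_def by (simp add: sum_nonneg)
  have gle: "g x \<le> real N * P\<^sup>2" if "x \<in> RN N" for x
  proof -
    have "g x \<le> (\<Sum>k<N. P\<^sup>2)" unfolding g_def
      using G(2)[OF _ that] by (intro sum_mono) (metis abs_ge_zero lessThan_iff power2_abs power_mono)
    thus ?thesis by simp
  qed
  have ef: "egrowth N f" by (rule egrowth_bounded[OF f])
  have eX: "egrowth N X" unfolding X_def by (intro egrowth_intros ef)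
  have eg: "egrowth N g" by (rule egrowth_bounded[where B = "real N * P\<^sup>2"]) (use g0 gle in auto)
  have EX: "E \<xi> X = 0" unfolding X_def by (simp add: E_diff ef egrowth_const c_def)
  define V where "V = E \<xi> (\<lambda>x. (X x)\<^sup>2)"
  \<comment> \<open>Bounds the third-order error in expanding \<open>exp (q x)\<close>:
    \<open>A * L\<close> for the cross term in the square of \<open>q x\<close>, the cube for the
    remainder of the exponential.\<close>
  define C2 where "C2 = A * L + (A + L) ^ 3"
  \<comment> \<open>Out of the convexity \<open>\<kappa>\<close>, the Taylor remainder consumes 4 e
    |B|; completing the square against what is left produces \<open>m e\<close>. Below
    \<open>e0\<close> at least \<kappa> / 2 is left, and e \<le> 1 gives e^2 \<le> e.\<close>
  define m where "m e = 1 / (\<kappa> - 4 * e * \<bar>B\<bar>)" for e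
  define e0 where "e0 = min 1 (\<kappa> / (8 * (\<bar>B\<bar> + 1)))"
  have e0: "e0 > 0" unfolding e0_def using \<kappa> by simp
  have key: "(1 + e\<^sup>2 * (V / 2 - e * A ^ 3)) * (1 + e\<^sup>2 * (V / 2 - m e * E \<xi> g - e * C2)) \<le> 1"
    if e: "0 < e" "e < e0" and small: "1 + e\<^sup>2 * (V / 2 - e * A ^ 3) \<ge> 0" for e
  proof -
    have e1: "e \<le> 1" using e unfolding e0_def by simp
    have "e * (8 * (\<bar>B\<bar> + 1)) \<le> \<kappa>" using e unfolding e0_def by (simp add: field_simps)
    hence half: "\<kappa> - 4 * e * \<bar>B\<bar> \<ge> \<kappa> / 2" using e by (simp add: algebra_simps)
    hence mp: "m e > 0" "m e \<le> 2 / \<kappa>" unfolding m_def using \<kappa>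
      by (auto intro!: divide_pos_pos simp: field_simps)
    have mg: "0 \<le> m e * g x" "x \<in> RN N \<Longrightarrow> m e * g x \<le> L" for x
    proof -
      show "0 \<le> m e * g x" using mp g0[of x] by simp
      assume "x \<in> RN N"
      hence "m e * g x \<le> 2 / \<kappa> * (real N * P\<^sup>2)" using mp gle g0 \<kappa> by (intro mult_mono) auto
      thus "m e * g x \<le> L" unfolding L_def by (simp add: mult.commute)
    qed
    define q where "q x = e * X x - e\<^sup>2 * (m e * g x)" for x
    have [measurable]: "q \<in> borel_measurable (lebN N)" unfolding q_def by measurable
    have qb: "\<bar>q x\<bar> \<le> e * (A + L)" if "x \<in> RN N" for x
    proof -
      have "\<bar>q x\<bar> \<le> e * \<bar>X x\<bar> + e\<^sup>2 * (m e * g x)"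
        unfolding q_def using e mg(1)[of x] abs_triangle_ineq4[of "e * X x" "e\<^sup>2 * (m e * g x)"]
        by (simp add: abs_mult del: mult_nonneg_nonneg) (metis abs_mult abs_of_nonneg)
      also have "\<dots> \<le> e * A + e * L"
      proof (intro add_mono mult_mono)
        show "e\<^sup>2 \<le> e" using e e1 by (simp add: power2_eq_square mult_left_le)
      qed (use e XA[OF that] mg that in auto)
      finally show ?thesis by (simp add: distrib_left)
    qed
    have eexp: "egrowth N (\<lambda>x. exp (r x))" if "r \<in> borel_measurable (lebN N)" "\<And>x. x \<in> RN N \<Longrightarrow> \<bar>r x\<bar> \<le> b" for r b
    proof (rule egrowth_bounded[where B = "exp b"])
      show "\<bar>exp (r x)\<bar> \<le> exp b" if "x \<in> RN N" for x using \<open>\<And>x. x \<in> RN N \<Longrightarrow> \<bar>r x\<bar> \<le> b\<close>[OF that] by auto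
    qed (use that in measurable)
    have eexp1: "egrowth N (\<lambda>x. exp (q x))" by (rule eexp[OF _ qb]) auto
    have Xb: "\<bar>- e * X x\<bar> \<le> e * A" if "x \<in> RN N" for x
      using XA[OF that] e by (simp add: abs_mult mult_left_mono)
    have eexp2: "egrowth N (\<lambda>x. exp (- e * X x))" by (rule eexp[OF _ Xb]) auto
    have prod: "E \<xi> (\<lambda>x. exp (q x)) * E \<xi> (\<lambda>x. exp (- e * X x)) \<le> 1"
    proof (rule K_prekopa_leindler[OF eexp1 _ eexp2])
      fix x y assume xy: "x \<in> RN N" "y \<in> RN N"
      define S where "S = (\<Sum>k<N. (x k - y k)\<^sup>2)"
      have S0: "S \<ge> 0" unfolding S_def by (simp add: sum_nonneg)
      have "f x - f y \<le> (\<Sum>k<N. p k x * (x k - y k)) + B * S" unfolding S_def by (rule taylor[OF xy])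
      also have "B * S \<le> \<bar>B\<bar> * S" using S0 by (intro mult_right_mono) auto
      finally have "e * (f x - f y) \<le> e * ((\<Sum>k<N. p k x * (x k - y k)) + \<bar>B\<bar> * S)"
        using e by (intro mult_left_mono) auto
      also have "\<dots> = (\<Sum>k<N. e * p k x * (x k - y k) + e * \<bar>B\<bar> * (x k - y k)\<^sup>2)"
        unfolding S_def by (simp only: sum.distrib sum_distrib_left distrib_left mult.assoc)
      also have "\<dots> \<le> (\<Sum>k<N. e\<^sup>2 * m e * (p k x)\<^sup>2 + \<kappa> / 4 * (x k - y k)\<^sup>2)"
      proof (rule sum_mono)
        fix k
        define d where "d = x k - y k"
        define r where "r = \<kappa> - 4 * e * \<bar>B\<bar>"
        have r: "r > 0" unfolding r_def using half \<kappa> by linarith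
        have "0 \<le> (2 * e * p k x - r * d)\<^sup>2 / (4 * r)" using r by simp
        also have "\<dots> = e\<^sup>2 * (1 / r) * (p k x)\<^sup>2 - e * p k x * d + r / 4 * d\<^sup>2"
          using r by (simp add: power2_eq_square field_simps)
        finally have "e * p k x * d \<le> e\<^sup>2 * m e * (p k x)\<^sup>2 + r / 4 * d\<^sup>2" unfolding m_def r_def by linarith
        thus "e * p k x * (x k - y k) + e * \<bar>B\<bar> * (x k - y k)\<^sup>2 \<le> e\<^sup>2 * m e * (p k x)\<^sup>2 + \<kappa> / 4 * (x k - y k)\<^sup>2"
          unfolding d_def[symmetric] r_def by (simp add: field_simps)
      qed
      also have "\<dots> = e\<^sup>2 * (m e * g x) + \<kappa> / 4 * S"
        unfolding g_def S_def by (simp add: sum.distrib sum_distrib_left mult.assoc)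
      finally have "q x + - e * X y \<le> \<kappa> / 4 * S" unfolding q_def X_def by (simp add: algebra_simps)
      also have "\<kappa> / 4 * S = ((\<mu> - 1) / 2 * S) / (2 * (h * real N))" unfolding \<kappa>_def by simp
      also have "\<dots> \<le> quad_form \<mu> N (\<lambda>k. x k - y k) / (2 * (h * real N))"
        unfolding S_def using quad_form_ge(2)[OF \<mu> N, of "\<lambda>k. x k - y k"] h N by (intro divide_right_mono) auto
      finally show "q x + - e * X y \<le> quad_form \<mu> N (\<lambda>k. x k - y k) / (2 * (h * real N))" .
    qed auto
    have lowX: "1 + e\<^sup>2 * (V / 2 - e * A ^ 3) \<le> E \<xi> (\<lambda>x. exp (- e * X x))"
    proof -
      have "E \<xi> (\<lambda>x. 1 + (- e) * X x + (e\<^sup>2 / 2) * (X x)\<^sup>2 - e ^ 3 * A ^ 3) = 1 + (- e) * E \<xi> X + (e\<^sup>2 / 2) * V - e ^ 3 * A ^ 3"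
        unfolding V_def by (simp only: E_diff E_add E_cmult E_const egrowth_intros eX)
      hence "1 + e\<^sup>2 * (V / 2 - e * A ^ 3) = E \<xi> (\<lambda>x. 1 + (- e) * X x + (e\<^sup>2 / 2) * (X x)\<^sup>2 - e ^ 3 * A ^ 3)"
        unfolding EX by (simp add: power2_eq_square power3_eq_cube algebra_simps)
      also have "\<dots> \<le> E \<xi> (\<lambda>x. exp (- e * X x))"
      proof (rule E_mono)
        fix x assume x: "x \<in> RN N"
        have "\<bar>- e * X x\<bar> ^ 3 \<le> (e * A) ^ 3" using Xb[OF x] by (intro power_mono) auto
        thus "1 + (- e) * X x + (e\<^sup>2 / 2) * (X x)\<^sup>2 - e ^ 3 * A ^ 3 \<le> exp (- e * X x)"
          using exp_lower_cubic[of "- e * X x"] by (simp add: power_mult_distrib)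
      qed (intro egrowth_intros eX eexp2)+
      finally show ?thesis .
    qed
    have lowq: "1 + e\<^sup>2 * (V / 2 - m e * E \<xi> g - e * C2) \<le> E \<xi> (\<lambda>x. exp (q x))"
    proof -
      have "E \<xi> (\<lambda>x. 1 + (e * X x - e\<^sup>2 * m e * g x) + (e\<^sup>2 / 2) * (X x)\<^sup>2 - e ^ 3 * C2)
        = 1 + (e * E \<xi> X - e\<^sup>2 * m e * E \<xi> g) + (e\<^sup>2 / 2) * V - e ^ 3 * C2"
        unfolding V_def by (simp only: E_diff E_add E_cmult E_const egrowth_intros eX eg)
      hence "1 + e\<^sup>2 * (V / 2 - m e * E \<xi> g - e * C2)
        = E \<xi> (\<lambda>x. 1 + (e * X x - e\<^sup>2 * m e * g x) + (e\<^sup>2 / 2) * (X x)\<^sup>2 - e ^ 3 * C2)"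
        unfolding EX by (simp add: power2_eq_square power3_eq_cube algebra_simps)
      also have "\<dots> \<le> E \<xi> (\<lambda>x. exp (q x))"
      proof (rule E_mono)
        fix x assume x: "x \<in> RN N"
        have "\<bar>q x\<bar> ^ 3 \<le> (e * (A + L)) ^ 3" using qb[OF x] by (intro power_mono) auto
        hence 1: "\<bar>q x\<bar> ^ 3 \<le> e ^ 3 * (A + L) ^ 3" by (simp add: power_mult_distrib)
        have "\<bar>X x * (m e * g x)\<bar> \<le> A * L" unfolding abs_mult using XA[OF x] mg(1)[of x] mg(2)[OF x]
          by (intro mult_mono) auto
        hence "X x * (m e * g x) \<le> A * L" by linarith
        hence 2: "e ^ 3 * (X x * (m e * g x)) \<le> e ^ 3 * (A * L)" using e by (intro mult_left_mono) auto
        have "(q x)\<^sup>2 = e\<^sup>2 * (X x)\<^sup>2 - 2 * (e ^ 3 * (X x * (m e * g x))) + (e\<^sup>2 * (m e * g x))\<^sup>2"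
          unfolding q_def by (simp add: power2_eq_square power3_eq_cube algebra_simps)
        moreover have "0 \<le> (e\<^sup>2 * (m e * g x))\<^sup>2" by simp
        moreover have "(e\<^sup>2 / 2) * (X x)\<^sup>2 = e\<^sup>2 * (X x)\<^sup>2 / 2" by simp
        ultimately have 3: "(q x)\<^sup>2 / 2 \<ge> (e\<^sup>2 / 2) * (X x)\<^sup>2 - e ^ 3 * (A * L)" using 2 by linarith
        have "e ^ 3 * C2 = e ^ 3 * (A * L) + e ^ 3 * (A + L) ^ 3" unfolding C2_def by (simp add: distrib_left)
        moreover have "q x = e * X x - e\<^sup>2 * m e * g x" unfolding q_def by simp
        ultimately show "1 + (e * X x - e\<^sup>2 * m e * g x) + (e\<^sup>2 / 2) * (X x)\<^sup>2 - e ^ 3 * C2 \<le> exp (q x)"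
          using exp_lower_cubic[of "q x"] 1 3 by linarith
      qed (intro egrowth_intros eX eg eexp1)+
      finally show ?thesis .
    qed
    have "(1 + e\<^sup>2 * (V / 2 - e * A ^ 3)) * (1 + e\<^sup>2 * (V / 2 - m e * E \<xi> g - e * C2))
      \<le> (1 + e\<^sup>2 * (V / 2 - e * A ^ 3)) * E \<xi> (\<lambda>x. exp (q x))"
      by (intro mult_left_mono lowq small)
    also have "\<dots> \<le> E \<xi> (\<lambda>x. exp (- e * X x)) * E \<xi> (\<lambda>x. exp (q x))"
      by (intro mult_right_mono lowX E_nonneg) auto
    also have "\<dots> \<le> 1" using prod by (simp add: mult.commute)
    finally show ?thesis .
  qed
  \<comment> \<open>\<open>key\<close> with 1 subtracted and divided by e^2; as e decreases to 0 it
    tends to V - \<open>m 0\<close> times the mean of \<open>g\<close>.\<close>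
  define u where "u e = (V / 2 - e * A ^ 3) + (V / 2 - m e * E \<xi> g - e * C2)
      + e\<^sup>2 * ((V / 2 - e * A ^ 3) * (V / 2 - m e * E \<xi> g - e * C2))" for e
  have mlim: "(m \<longlongrightarrow> m 0) (at_right 0)"
    unfolding m_def using \<kappa> by (intro tendsto_intros) auto
  have "(u \<longlongrightarrow> (V / 2 - 0 * A ^ 3) + (V / 2 - m 0 * E \<xi> g - 0 * C2)
      + 0\<^sup>2 * ((V / 2 - 0 * A ^ 3) * (V / 2 - m 0 * E \<xi> g - 0 * C2))) (at_right 0)"
    unfolding u_def by (intro tendsto_intros mlim)
  hence ulim: "(u \<longlongrightarrow> V - m 0 * E \<xi> g) (at_right 0)" by simp
  have "((\<lambda>e. 1 + e\<^sup>2 * (V / 2 - e * A ^ 3)) \<longlongrightarrow> 1 + 0\<^sup>2 * (V / 2 - 0 * A ^ 3)) (at_right 0)"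
    by (intro tendsto_intros)
  hence "eventually (\<lambda>e. 1 + e\<^sup>2 * (V / 2 - e * A ^ 3) > 0) (at_right 0)"
    by (rule order_tendstoD) simp
  moreover have "eventually (\<lambda>e. e \<in> {0<..<e0}) (at_right (0::real))"
    using e0 by (rule eventually_at_right_real)
  ultimately have "eventually (\<lambda>e. u e \<le> 0) (at_right 0)"
  proof eventually_elim
    case (elim e)
    have "(1 + e\<^sup>2 * (V / 2 - e * A ^ 3)) * (1 + e\<^sup>2 * (V / 2 - m e * E \<xi> g - e * C2)) \<le> 1"
      using elim by (intro key) auto
    moreover have "(1 + e\<^sup>2 * a) * (1 + e\<^sup>2 * b) = 1 + e\<^sup>2 * (a + b + e\<^sup>2 * (a * b))" for a b
      by (simp add: algebra_simps power2_eq_square)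
    ultimately have "e\<^sup>2 * u e \<le> 0" unfolding u_def by simp
    thus ?case using elim by (simp add: mult_le_0_iff)
  qed
  from tendsto_upperbound[OF ulim this] have "V \<le> m 0 * E \<xi> g" by simp
  moreover have "V = E \<xi> (\<lambda>x. (f x)\<^sup>2) - (E \<xi> f)\<^sup>2"
  proof -
    have "V = E \<xi> (\<lambda>x. (f x)\<^sup>2 - (2 * c) * f x + c\<^sup>2)"
      unfolding V_def X_def by (simp add: power2_diff algebra_simps)
    also have "\<dots> = E \<xi> (\<lambda>x. (f x)\<^sup>2) - (2 * c) * E \<xi> f + c\<^sup>2"
      by (simp only: E_diff E_add E_cmult E_const egrowth_intros ef)
    finally show ?thesis unfolding c_def by (simp add: power2_eq_square)
  qed
  moreover have "m 0 = h * real N / (\<mu> - 1)" unfolding m_def \<kappa>_def by simp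
  ultimately show ?thesis unfolding g_def by simp
qed

end

section \<open>The one-dimensional problem in the field\<close>

text \<open>In a window of radius c sqrt h the bound on \<open>P'\<close> keeps the slope
  \<open>P\<close> of order sqrt h, so ln p varies by at most a constant free of h, and the density
  may be treated as constant. Since \<open>F\<close> vanishes at the centre, integrating
  \<open>F'\<close> from there with Cauchy-Schwarz bounds \<open>F\<close>; the squared radius
  supplies the factor h.\<close>

lemma window_poincare:
  fixes F F' p P :: "real \<Rightarrow> real"
  assumes h: "h > 0" and c: "c > 0" "c3 \<ge> 0" "c4 \<ge> 0"
    and p: "\<And>x. p x > 0" "\<And>x. (p has_real_derivative - (P x / h) * p x) (at x)"
    and P: "\<And>x. (P has_real_derivative P' x) (at x)" "\<And>x. \<bar>P' x\<bar> \<le> c3" "\<bar>P s\<bar> \<le> c4 * sqrt h"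
    and F: "\<And>x. (F has_real_derivative F' x) (at x)" "continuous_on UNIV F'" "F s = 0"
  shows "integral {s - c * sqrt h..s + c * sqrt h} (\<lambda>x. (F x)\<^sup>2 * p x)
    \<le> 2 * c\<^sup>2 * exp (2 * c * (c4 + c3 * c)) * (h * integral {s - c * sqrt h..s + c * sqrt h} (\<lambda>x. (F' x)\<^sup>2 * p x))"
proof -
  define r where "r = c * sqrt h"
  define S where "S = {s - r..s + r}"
  define \<Lambda> where "\<Lambda> = exp (2 * c * (c4 + c3 * c))"
  have r: "r > 0" unfolding r_def using c h by simp
  have contp: "continuous_on A p" for A
    by (rule DERIV_continuous_on) (rule has_field_derivative_at_within[OF p(2)])
  have contF: "continuous_on A F" for A
    by (rule DERIV_continuous_on) (rule has_field_derivative_at_within[OF F(1)])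
  have PS: "\<bar>P x\<bar> \<le> (c4 + c3 * c) * sqrt h" if "x \<in> S" for x
  proof -
    have "norm (P x - P s) \<le> c3 * norm (x - s)"
    proof (rule field_differentiable_bound[where S = UNIV])
      show "(P has_real_derivative P' z) (at z within UNIV)" for z by (rule has_field_derivative_at_within[OF P(1)])
      show "norm (P' z) \<le> c3" for z using P(2)[of z] by simp
    qed auto
    also have "\<dots> \<le> c3 * r" using that c unfolding S_def by (intro mult_left_mono) auto
    finally have "\<bar>P x\<bar> \<le> c4 * sqrt h + c3 * r" using P(3) by simp
    also have "\<dots> = (c4 + c3 * c) * sqrt h" unfolding r_def by (simp only: distrib_right mult.assoc)
    finally show ?thesis .
  qed
  have ratio: "p x \<le> \<Lambda> * p y" if "x \<in> S" "y \<in> S" for x y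
  proof -
    have "norm (ln (p x) - ln (p y)) \<le> ((c4 + c3 * c) * sqrt h / h) * norm (x - y)"
    proof (rule field_differentiable_bound[where S = S and f' = "\<lambda>x. - (P x / h)"])
      show "((\<lambda>x. ln (p x)) has_real_derivative - (P z / h)) (at z within S)" if "z \<in> S" for z
      proof (rule has_field_derivative_at_within)
        show "((\<lambda>x. ln (p x)) has_real_derivative - (P z / h)) (at z)"
          by (rule DERIV_cong[OF DERIV_chain2[OF DERIV_ln_divide[OF p(1)] p(2)]]) (use p(1)[of z] in simp)
      qed
      show "norm (- (P z / h)) \<le> (c4 + c3 * c) * sqrt h / h" if "z \<in> S" for z
        using PS[OF that] h by (simp add: divide_right_mono)
    qed (use that in \<open>auto simp: S_def\<close>)
    also have "\<dots> \<le> ((c4 + c3 * c) * sqrt h / h) * (2 * r)"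
      using that c h unfolding S_def by (intro mult_left_mono) auto
    also have "\<dots> = 2 * c * (c4 + c3 * c)"
    proof -
      have "((c4 + c3 * c) * sqrt h / h) * (2 * r) = 2 * c * (c4 + c3 * c) * ((sqrt h * sqrt h) / h)"
        unfolding r_def by simp
      also have "(sqrt h * sqrt h) / h = 1" using h by simp
      finally show ?thesis by simp
    qed
    finally have "ln (p x) \<le> 2 * c * (c4 + c3 * c) + ln (p y)" by simp
    hence "exp (ln (p x)) \<le> exp (2 * c * (c4 + c3 * c) + ln (p y))" by simp
    thus ?thesis using p(1) by (simp add: exp_add \<Lambda>_def)
  qed
  define J where "J = integral S (\<lambda>x. (F' x)\<^sup>2 * p x)"
  have intg: "g integrable_on S" if "continuous_on UNIV g" for g :: "real \<Rightarrow> real"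
    unfolding S_def using that by (intro integrable_continuous_interval continuous_on_subset[OF that]) auto
  have F2: "(F x)\<^sup>2 \<le> r * integral S (\<lambda>y. (F' y)\<^sup>2)" if x: "x \<in> S" for x
  proof -
    define T where "T = {min s x..max s x}"
    have TS: "T \<subseteq> S" using x r unfolding T_def S_def by auto
    have ci: "g integrable_on T" if "continuous_on UNIV g" for g :: "real \<Rightarrow> real"
      unfolding T_def using that by (intro integrable_continuous_interval continuous_on_subset[OF that]) auto
    have ft: "(F' has_integral F (max s x) - F (min s x)) T"
      unfolding T_def using F(1)
      by (intro fundamental_theorem_of_calculus) (auto simp: has_real_derivative_iff_has_vector_derivative[symmetric]
          intro: has_field_derivative_at_within)
    define I where "I = integral T F'"
    have I: "I = F (max s x) - F (min s x)" unfolding I_def using ft by (rule integral_unique)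
    \<comment> \<open>Cauchy-Schwarz on the segment between s and x, from the nonnegativity of the
      integral of (F' + t)^2 for every t.\<close>
    have "I\<^sup>2 \<le> integral T (\<lambda>y. (F' y)\<^sup>2) * \<bar>x - s\<bar>"
    proof (rule discriminant_le)
      fix t
      have "0 \<le> integral T (\<lambda>y. (F' y + t)\<^sup>2)"
        by (intro integral_nonneg ci continuous_intros F) auto
      also have "(\<lambda>y. (F' y + t)\<^sup>2) = (\<lambda>y. (F' y)\<^sup>2 + 2 * t * F' y + t\<^sup>2)"
        by (simp add: power2_eq_square algebra_simps)
      also have "integral T \<dots> = integral T (\<lambda>y. (F' y)\<^sup>2 + 2 * t * F' y) + integral T (\<lambda>_. t\<^sup>2)"
        by (intro Henstock_Kurzweil_Integration.integral_add ci continuous_intros F)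
      also have "integral T (\<lambda>y. (F' y)\<^sup>2 + 2 * t * F' y) = integral T (\<lambda>y. (F' y)\<^sup>2) + integral T (\<lambda>y. 2 * t * F' y)"
        by (intro Henstock_Kurzweil_Integration.integral_add ci continuous_intros F)
      also have "integral T (\<lambda>y. 2 * t * F' y) = 2 * t * I" unfolding I_def by simp
      also have "integral T (\<lambda>_. t\<^sup>2) = t\<^sup>2 * \<bar>x - s\<bar>" unfolding T_def by (auto simp: max_def min_def)
      finally show "0 \<le> integral T (\<lambda>y. (F' y)\<^sup>2) + 2 * t * I + t\<^sup>2 * \<bar>x - s\<bar>" .
    qed simp
    also have "\<dots> \<le> integral S (\<lambda>y. (F' y)\<^sup>2) * r"
    proof (intro mult_mono)
      show "integral T (\<lambda>y. (F' y)\<^sup>2) \<le> integral S (\<lambda>y. (F' y)\<^sup>2)"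
        by (intro integral_subset_le TS ci intg continuous_intros F) auto
      show "\<bar>x - s\<bar> \<le> r" using x unfolding S_def by auto
      show "0 \<le> integral S (\<lambda>y. (F' y)\<^sup>2)" by (intro integral_nonneg intg continuous_intros F) auto
    qed simp
    also have "I\<^sup>2 = (F x)\<^sup>2" unfolding I using F(3) by (auto simp: max_def min_def)
    finally show ?thesis by (simp add: mult.commute)
  qed
  have "integral S (\<lambda>x. (F x)\<^sup>2 * p x) \<le> integral S (\<lambda>x. r * \<Lambda> * J)"
  proof (rule integral_le)
    fix x assume x: "x \<in> S"
    have "(F x)\<^sup>2 * p x \<le> r * integral S (\<lambda>y. (F' y)\<^sup>2) * p x"
      using F2[OF x] p(1)[of x] by (intro mult_right_mono) auto
    also have "\<dots> = r * integral S (\<lambda>y. (F' y)\<^sup>2 * p x)" by simp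
    also have "\<dots> \<le> r * integral S (\<lambda>y. \<Lambda> * ((F' y)\<^sup>2 * p y))"
    proof (intro mult_left_mono integral_le intg continuous_intros F contp)
      fix y assume y: "y \<in> S"
      show "(F' y)\<^sup>2 * p x \<le> \<Lambda> * ((F' y)\<^sup>2 * p y)"
        using mult_left_mono[OF ratio[OF x y], of "(F' y)\<^sup>2"] by (simp add: mult_ac)
    qed (use r in auto)
    also have "\<dots> = r * \<Lambda> * J" unfolding J_def by simp
    finally show "(F x)\<^sup>2 * p x \<le> r * \<Lambda> * J" .
  qed (intro intg continuous_intros contF contp)+
  also have "\<dots> = 2 * r * (r * \<Lambda> * J)" unfolding S_def using r by simp
  also have "\<dots> = 2 * c\<^sup>2 * \<Lambda> * (h * J)" unfolding r_def using h by (simp add: power2_eq_square)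
  finally show ?thesis unfolding J_def S_def r_def \<Lambda>_def .
qed

text \<open>The leading 4 inverts the bound 1 / 4 on the effective potential away from the wells; 1
  / 4 + \<mu> / 2 is the deficit of the potential inside them; the last factor is the window
  constant, taken once for each well.\<close>

definition line_const :: "real \<Rightarrow> real \<Rightarrow> real \<Rightarrow> real \<Rightarrow> real" where
  "line_const \<mu> c c3 c4 = 4 * (1 + (1 / 4 + \<mu> / 2) * (2 * (2 * c\<^sup>2 * exp (2 * c * (c4 + c3 * c)))))"

text \<open>Integrating \<open>h (F' - (P / (2 h)) F)\<^sup>2 p \<ge> 0\<close> by parts bounds the energy from below by the potential
  \<open>P\<^sup>2 / (4 h) - P' / 2\<close>, which is only negative near the two wells, where \<open>F\<close> vanishes.\<close>
lemma double_well_poincare: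
  fixes F F' p P :: "real \<Rightarrow> real"
  assumes h: "h > 0" and c: "c > 0" "c3 \<ge> 0" "c4 \<ge> 0" and \<mu>: "\<mu> > 0"
    and p: "\<And>x. p x > 0" "\<And>x. (p has_real_derivative - (P x / h) * p x) (at x)"
    and P: "\<And>x. (P has_real_derivative P' x) (at x)" "continuous_on UNIV P'"
      "\<And>x. \<bar>P' x\<bar> \<le> c3" "\<And>x. P' x \<le> \<mu>" "\<bar>P 1\<bar> \<le> c4 * sqrt h" "\<bar>P (-1)\<bar> \<le> c4 * sqrt h"
    and F: "\<And>x. (F has_real_derivative F' x) (at x)" "continuous_on UNIV F'" "F 1 = 0" "F (-1) = 0"
    and pot: "\<And>x. (P x)\<^sup>2 / (4 * h) - P' x / 2 \<ge> 1 / 4 \<or> \<bar>x - 1\<bar> \<le> c * sqrt h \<or> \<bar>x + 1\<bar> \<le> c * sqrt h"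
    and R: "R \<ge> 1 + c * sqrt h"
  shows "integral {-R..R} (\<lambda>x. (F x)\<^sup>2 * p x)
    \<le> line_const \<mu> c c3 c4 * (h * integral {-R..R} (\<lambda>x. (F' x)\<^sup>2 * p x))
      + 2 * \<bar>P R * (F R)\<^sup>2 * p R\<bar> + 2 * \<bar>P (-R) * (F (-R))\<^sup>2 * p (-R)\<bar>"
proof -
  define S where "S s = {s - c * sqrt h..s + c * sqrt h}" for s :: real
  define I where "I = {-R..R}"
  define J where "J = integral I (\<lambda>x. (F' x)\<^sup>2 * p x)"
  define Cw where "Cw = 2 * c\<^sup>2 * exp (2 * c * (c4 + c3 * c))"
  define c5 where "c5 = 1 / 4 + \<mu> / 2"
  have rpos: "c * sqrt h > 0" using c h by simp
  have SI: "S 1 \<subseteq> I" "S (-1) \<subseteq> I" unfolding S_def I_def using R rpos by auto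
  have contp: "continuous_on A p" for A
    by (rule DERIV_continuous_on) (rule has_field_derivative_at_within[OF p(2)])
  have contF: "continuous_on A F" for A
    by (rule DERIV_continuous_on) (rule has_field_derivative_at_within[OF F(1)])
  have contP: "continuous_on A P" for A
    by (rule DERIV_continuous_on) (rule has_field_derivative_at_within[OF P(1)])
  have contF': "continuous_on A F'" for A by (rule continuous_on_subset[OF F(2)]) simp
  have contP': "continuous_on A P'" for A by (rule continuous_on_subset[OF P(2)]) simp
  note conts = contp contF contP contF' contP'
  have intI: "g integrable_on I" if "continuous_on UNIV g" for g :: "real \<Rightarrow> real"
    unfolding I_def using that by (intro integrable_continuous_interval continuous_on_subset[OF that]) auto
  have intS: "g integrable_on S s" if "continuous_on UNIV g" for g :: "real \<Rightarrow> real" and s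
    unfolding S_def using that by (intro integrable_continuous_interval continuous_on_subset[OF that]) auto
  \<comment> \<open>The primitive that turns the cross term P F F' p of the square into boundary
    values.\<close>
  define B where "B x = P x / 2 * (F x)\<^sup>2 * p x" for x
  define B' where "B' x = (P' x / 2 * (F x)\<^sup>2 + P x * F x * F' x - (P x)\<^sup>2 / (2 * h) * (F x)\<^sup>2) * p x" for x
  have dB: "(B has_real_derivative B' x) (at x)" for x
    unfolding B_def B'_def using h
    by (auto intro!: derivative_eq_intros P(1) F(1) p(2) simp: power2_eq_square field_simps)
  have contB': "continuous_on UNIV B'" unfolding B'_def by (intro continuous_intros conts) (use h in auto)
  have intB': "integral I B' = B R - B (-R)"
  proof -
    have "-R \<le> R" using R rpos by simp
    hence "(B' has_integral B R - B (-R)) I" unfolding I_def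
      by (intro fundamental_theorem_of_calculus) (auto simp: has_real_derivative_iff_has_vector_derivative[symmetric]
          intro: has_field_derivative_at_within dB)
    thus ?thesis by (rule integral_unique)
  qed
  \<comment> \<open>Extension by 0 allows a pointwise comparison on the whole interval; the sum of
    the two functions also covers overlapping windows.\<close>
  define w where "w s x = (if x \<in> S s then (F x)\<^sup>2 * p x else 0)" for s x
  have w0: "w s x \<ge> 0" for s x unfolding w_def using p(1)[of x] by auto
  have intw: "w s integrable_on I" "integral I (w s) = integral (S s) (\<lambda>x. (F x)\<^sup>2 * p x)" if "S s \<subseteq> I" for s
  proof -
    have eq: "I \<inter> S s = S s" "S s \<inter> I = S s" using that by auto
    have "(\<lambda>x. (F x)\<^sup>2 * p x) integrable_on S s" by (intro intS continuous_intros conts)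
    thus "w s integrable_on I" unfolding w_def[abs_def]
      using integrable_restrict_Int[of "S s" "\<lambda>x. (F x)\<^sup>2 * p x" I] eq by simp
    show "integral I (w s) = integral (S s) (\<lambda>x. (F x)\<^sup>2 * p x)" unfolding w_def[abs_def]
      using integral_restrict_Int[of I "S s" "\<lambda>x. (F x)\<^sup>2 * p x"] eq by simp
  qed
  have win: "integral I (w s) \<le> Cw * (h * J)" if "s = 1 \<or> s = -1" for s
  proof -
    have sub: "S s \<subseteq> I" using that SI by auto
    have "integral (S s) (\<lambda>x. (F x)\<^sup>2 * p x) \<le> Cw * (h * integral (S s) (\<lambda>x. (F' x)\<^sup>2 * p x))"
      unfolding S_def Cw_def
    proof (rule window_poincare[OF h c p P(1) P(3) _ F(1,2)])
      show "\<bar>P s\<bar> \<le> c4 * sqrt h" using that P(5,6) by blast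
      show "F s = 0" using that F(3,4) by blast
    qed
    also have "\<dots> \<le> Cw * (h * J)" unfolding J_def
    proof (intro mult_left_mono)
      have "0 \<le> (F' x)\<^sup>2 * p x" for x using less_imp_le[OF p(1)[of x]] by (intro mult_nonneg_nonneg) auto
      thus "integral (S s) (\<lambda>x. (F' x)\<^sup>2 * p x) \<le> integral I (\<lambda>x. (F' x)\<^sup>2 * p x)"
        by (intro integral_subset_le sub intI intS continuous_intros conts) auto
      show "0 \<le> h" using h by simp
      show "0 \<le> Cw" unfolding Cw_def by simp
    qed
    finally show ?thesis using intw[OF sub] by simp
  qed
  have pw: "(F x)\<^sup>2 * p x \<le> 4 * (h * ((F' x)\<^sup>2 * p x)) - 4 * B' x + 4 * c5 * (w 1 x + w (-1) x)" for x
  proof -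
    define k where "k = (P x)\<^sup>2 / (4 * h) - P' x / 2"
    have "0 \<le> h * (F' x - P x / (2 * h) * F x)\<^sup>2 * p x"
      using h p(1)[of x] by (intro mult_nonneg_nonneg) auto
    also have "\<dots> = h * ((F' x)\<^sup>2 * p x) - B' x - k * ((F x)\<^sup>2 * p x)"
      unfolding B'_def k_def using h by (simp add: power2_eq_square field_simps)
    finally have 1: "k * ((F x)\<^sup>2 * p x) \<le> h * ((F' x)\<^sup>2 * p x) - B' x" by simp
    have fp: "(F x)\<^sup>2 * p x \<ge> 0" using p(1)[of x] by simp
    have "(1 / 4) * ((F x)\<^sup>2 * p x) \<le> k * ((F x)\<^sup>2 * p x) + c5 * (w 1 x + w (-1) x)"
    proof (cases "k \<ge> 1 / 4")
      case True
      have "(1 / 4) * ((F x)\<^sup>2 * p x) \<le> k * ((F x)\<^sup>2 * p x)" using True fp by (intro mult_right_mono) auto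
      moreover have "0 \<le> c5 * (w 1 x + w (-1) x)" using w0 \<mu> unfolding c5_def by (intro mult_nonneg_nonneg add_nonneg_nonneg) auto
      ultimately show ?thesis by linarith
    next
      case False
      hence "x \<in> S 1 \<or> x \<in> S (-1)" using pot[of x] unfolding k_def S_def by (auto simp: abs_le_iff)
      hence "(F x)\<^sup>2 * p x \<le> w 1 x + w (-1) x" using w0[of 1 x] w0[of "-1" x] unfolding w_def by auto
      hence "c5 * ((F x)\<^sup>2 * p x) \<le> c5 * (w 1 x + w (-1) x)" using \<mu> unfolding c5_def by (intro mult_left_mono) auto
      moreover have "k \<ge> - (\<mu> / 2)"
      proof -
        have "0 \<le> (P x)\<^sup>2 / (4 * h)" using h by simp
        thus ?thesis unfolding k_def using P(4)[of x] by linarith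
      qed
      hence "- (\<mu> / 2) * ((F x)\<^sup>2 * p x) \<le> k * ((F x)\<^sup>2 * p x)" using fp by (intro mult_right_mono) auto
      moreover have "c5 * ((F x)\<^sup>2 * p x) = (1 / 4) * ((F x)\<^sup>2 * p x) - (- (\<mu> / 2) * ((F x)\<^sup>2 * p x))"
        unfolding c5_def by (simp add: algebra_simps)
      ultimately show ?thesis by linarith
    qed
    with 1 show ?thesis by simp
  qed
  have i1: "(\<lambda>x. 4 * (h * ((F' x)\<^sup>2 * p x)) - 4 * B' x) integrable_on I"
    by (intro intI continuous_intros conts contB')
  have i2: "(\<lambda>x. 4 * c5 * (w 1 x + w (-1) x)) integrable_on I"
  proof -
    have "(\<lambda>x. w 1 x + w (-1) x) integrable_on I" by (rule integrable_add[OF intw(1)[OF SI(1)] intw(1)[OF SI(2)]])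
    thus ?thesis using integrable_on_cmult_left[of "\<lambda>x. w 1 x + w (-1) x" I "4 * c5"] by simp
  qed
  have i0: "(\<lambda>x. (F x)\<^sup>2 * p x) integrable_on I" by (intro intI continuous_intros conts)
  have "integral I (\<lambda>x. (F x)\<^sup>2 * p x)
    \<le> integral I (\<lambda>x. 4 * (h * ((F' x)\<^sup>2 * p x)) - 4 * B' x + 4 * c5 * (w 1 x + w (-1) x))"
    by (rule integral_le[OF i0 integrable_add[OF i1 i2]]) (rule pw)
  also have "\<dots> = integral I (\<lambda>x. 4 * (h * ((F' x)\<^sup>2 * p x)) - 4 * B' x) + integral I (\<lambda>x. 4 * c5 * (w 1 x + w (-1) x))"
    by (rule Henstock_Kurzweil_Integration.integral_add[OF i1 i2])
  also have "integral I (\<lambda>x. 4 * (h * ((F' x)\<^sup>2 * p x)) - 4 * B' x)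
      = integral I (\<lambda>x. 4 * (h * ((F' x)\<^sup>2 * p x))) - integral I (\<lambda>x. 4 * B' x)"
    by (intro Henstock_Kurzweil_Integration.integral_diff intI continuous_intros conts contB')
  also have "integral I (\<lambda>x. 4 * (h * ((F' x)\<^sup>2 * p x))) = 4 * (h * J)" unfolding J_def by simp
  also have "integral I (\<lambda>x. 4 * B' x) = 4 * (B R - B (-R))" unfolding intB'[symmetric] by simp
  also have "integral I (\<lambda>x. 4 * c5 * (w 1 x + w (-1) x)) = 4 * c5 * integral I (\<lambda>x. w 1 x + w (-1) x)" by simp
  also have "integral I (\<lambda>x. w 1 x + w (-1) x) = integral I (w 1) + integral I (w (-1))"
    by (intro Henstock_Kurzweil_Integration.integral_add intw SI)
  finally have "integral I (\<lambda>x. (F x)\<^sup>2 * p x) \<le> 4 * (h * J) - 4 * (B R - B (-R)) + 4 * c5 * (integral I (w 1) + integral I (w (-1)))" .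
  also have "\<dots> \<le> 4 * (h * J) - 4 * (B R - B (-R)) + 4 * c5 * (Cw * (h * J) + Cw * (h * J))"
    using win \<mu> unfolding c5_def by (intro add_left_mono mult_left_mono add_mono) auto
  also have "\<dots> = line_const \<mu> c c3 c4 * (h * J) + (4 * B (-R) - 4 * B R)"
    unfolding line_const_def c5_def Cw_def by (simp add: algebra_simps)
  also have "4 * B (-R) - 4 * B R \<le> 2 * \<bar>P R * (F R)\<^sup>2 * p R\<bar> + 2 * \<bar>P (-R) * (F (-R))\<^sup>2 * p (-R)\<bar>"
  proof -
    have 4: "4 * B x = 2 * (P x * (F x)\<^sup>2 * p x)" for x unfolding B_def by simp
    have "2 * u - 2 * v \<le> 2 * \<bar>v\<bar> + 2 * \<bar>u\<bar>" for u v :: real by simp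
    thus ?thesis unfolding 4 .
  qed
  finally show ?thesis unfolding J_def I_def by simp
qed

text \<open>Here \<open>a\<close> stands for the conditional mean, \<open>e\<close> for the error in the stationarity equation, \<open>s\<close> and \<open>v\<close> for
  the conditional variances of a coordinate and of the mean.\<close>
lemma potential_dichotomy:
  fixes \<mu> h a \<xi> e s v c1 c2 :: real
  assumes \<mu>: "\<mu> > 1" and h: "0 < h" "h \<le> 1" "h * c2 \<le> 1 / 12" and c1: "c1 \<ge> 0"
    and stat: "\<mu> * (\<xi> - a) = a ^ 3 - a + e" "\<bar>e\<bar> \<le> c1 * h * (1 + \<bar>a\<bar>)"
    and s: "s \<le> c2 * h"
    and v: "h \<le> v * (3 * (a\<^sup>2 + s) + (\<mu> - 1))" "0 \<le> v"
  defines "P \<equiv> \<mu> * (\<xi> - a)" and "P' \<equiv> \<mu> * (1 - \<mu> / h * v)"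
  shows "P\<^sup>2 / (4 * h) - P' / 2 \<ge> 1 / 4 \<or> \<bar>\<xi> - 1\<bar> \<le> (5 * sqrt (2 * \<mu> + 1) + 5 * c1) * sqrt h
     \<or> \<bar>\<xi> + 1\<bar> \<le> (5 * sqrt (2 * \<mu> + 1) + 5 * c1) * sqrt h"
proof -
  define M where "M = sqrt (2 * \<mu> + 1)"
  have M: "M \<ge> 0" "M\<^sup>2 = 2 * \<mu> + 1" unfolding M_def using \<mu> by auto
  have hs: "h \<le> sqrt h"
    using h by (intro real_le_rsqrt) (simp add: power2_eq_square mult_left_le)
  have P'le: "P' \<le> \<mu>" unfolding P'_def using \<mu> h v by (simp add: mult_le_cancel_left1 algebra_simps)
  \<comment> \<open>Near a = 0 the field's potential is concave and - P' / 2 suffices; for a large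
    slope P^2 / (4 h) suffices; otherwise stationarity forces a, and with it \<xi>, close to 1 or
    -1.\<close>
  consider "a\<^sup>2 \<le> 1 / 12" | "P\<^sup>2 \<ge> M\<^sup>2 * h" | "a\<^sup>2 > 1 / 12" "P\<^sup>2 < M\<^sup>2 * h" by linarith
  thus ?thesis
  proof cases
    case 1
    have "s \<le> 1 / 12" using s h by (simp add: mult.commute)
    \<comment> \<open>With both terms at most 1 / 12 the Cramer-Rao bound gives v \<ge> h / (\<mu> -
      1 / 2). This exceeds h / \<mu> by enough to push P' down to - 1 / 2.\<close>
    hence "a\<^sup>2 + s \<le> 1 / 12 + 1 / 12" using 1 by (rule add_mono[rotated])
    hence "3 * (a\<^sup>2 + s) + (\<mu> - 1) \<le> \<mu> - 1 / 2" by simp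
    hence "v * (3 * (a\<^sup>2 + s) + (\<mu> - 1)) \<le> v * (\<mu> - 1 / 2)" using v(2) by (rule mult_left_mono)
    hence "h \<le> v * (\<mu> - 1 / 2)" using v(1) by (rule order.trans[rotated])
    define q where "q = \<mu> - 1 / 2"
    have q: "q > 0" "\<mu> = q + 1 / 2" unfolding q_def using \<mu> by auto
    have "h / h \<le> v * q / h" using \<open>h \<le> v * (\<mu> - 1 / 2)\<close> h(1) unfolding q_def by (intro divide_right_mono) auto
    hence "1 \<le> (v / h) * q" using h(1) by simp
    hence "1 / q \<le> v / h" using q(1) by (subst pos_divide_le_eq) auto
    hence "\<mu> * (1 / q) \<le> \<mu> * (v / h)" by (rule mult_left_mono) (use \<mu> in simp)
    moreover have "\<mu> * (1 / q) = 1 + (1 / 2) / q" unfolding q(2) using q(1) by (simp add: add_divide_distrib)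
    moreover have "\<mu> * (v / h) = \<mu> / h * v" by simp
    ultimately have "1 - \<mu> / h * v \<le> - ((1 / 2) / q)" by linarith
    hence "P' \<le> \<mu> * - ((1 / 2) / q)" unfolding P'_def by (rule mult_left_mono) (use \<mu> in simp)
    also have "\<dots> = - (1 / 2) - (1 / 4) / q" unfolding q(2) using q(1) by (simp add: field_simps)
    also have "\<dots> \<le> - (1 / 2)" using q(1) by simp
    finally have "P' \<le> - (1 / 2)" .
    moreover have "0 \<le> P\<^sup>2 / (4 * h)" using h by simp
    ultimately have "1 / 4 \<le> P\<^sup>2 / (4 * h) - P' / 2" by linarith
    thus ?thesis by simp
  next
    case 2
    \<comment> \<open>M^2 = 2 \<mu> + 1 is what lets P^2 / (4 h) cover both the target 1 / 4 and the
      largest value \<mu> / 2 of P' / 2.\<close>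
    hence "(2 * \<mu> + 1) / 4 \<le> P\<^sup>2 / (4 * h)" unfolding M using h by (simp add: field_simps)
    hence "1 / 4 \<le> P\<^sup>2 / (4 * h) - P' / 2" using P'le by (simp add: field_simps)
    thus ?thesis by simp
  next
    case 3
    have "(M * sqrt h)\<^sup>2 = M\<^sup>2 * h" using h(1) by (simp add: power_mult_distrib)
    hence "\<bar>P\<bar>\<^sup>2 \<le> (M * sqrt h)\<^sup>2" using 3(2) by simp
    hence Pb: "\<bar>P\<bar> \<le> M * sqrt h" by (rule power2_le_imp_le) (use M(1) h(1) in simp)
    have a4: "\<bar>a\<bar> \<ge> 1 / 4"
    proof (rule ccontr)
      assume "\<not> \<bar>a\<bar> \<ge> 1 / 4"
      hence "\<bar>a\<bar>\<^sup>2 \<le> (1 / 4)\<^sup>2" by (intro power_mono) auto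
      thus False using 3 by (simp add: power_divide)
    qed
    \<comment> \<open>Stationarity reads a (a^2 - 1) = P - e. Since |a| \<ge> 1 / 4, every term on
      the right can be bounded by a multiple of |a| and |a| divided out.\<close>
    have "\<bar>a\<bar> * \<bar>a\<^sup>2 - 1\<bar> = \<bar>P - e\<bar>"
      unfolding P_def stat(1) abs_mult[symmetric] by (simp add: power2_eq_square power3_eq_cube algebra_simps)
    also have "\<dots> \<le> M * sqrt h + c1 * h * (1 + \<bar>a\<bar>)" using Pb stat(2) by linarith
    also have "\<dots> \<le> M * sqrt h * (4 * \<bar>a\<bar>) + c1 * h * (4 * \<bar>a\<bar> + \<bar>a\<bar>)"
    proof (intro add_mono mult_left_mono)
      have "M * sqrt h * 1 \<le> M * sqrt h * (4 * \<bar>a\<bar>)" using a4 M h by (intro mult_left_mono) auto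
      thus "M * sqrt h \<le> M * sqrt h * (4 * \<bar>a\<bar>)" by simp
    qed (use a4 c1 h in auto)
    also have "\<dots> = \<bar>a\<bar> * (4 * M * sqrt h + 5 * c1 * h)" by (simp add: algebra_simps)
    finally have "\<bar>a\<^sup>2 - 1\<bar> \<le> 4 * M * sqrt h + 5 * c1 * h" using a4 by (simp add: mult_le_cancel_left_pos)
    also have "\<dots> \<le> 4 * M * sqrt h + 5 * c1 * sqrt h" using hs c1 by (simp add: mult_left_mono)
    finally have a2: "\<bar>a\<^sup>2 - 1\<bar> \<le> (4 * M + 5 * c1) * sqrt h" by (simp add: algebra_simps)
    have "\<bar>\<bar>a\<bar> - 1\<bar> * 1 \<le> \<bar>\<bar>a\<bar> - 1\<bar> * (\<bar>a\<bar> + 1)" by (intro mult_left_mono) auto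
    also have "\<dots> = \<bar>(\<bar>a\<bar> - 1) * (\<bar>a\<bar> + 1)\<bar>" by (simp add: abs_mult)
    also have "(\<bar>a\<bar> - 1) * (\<bar>a\<bar> + 1) = a\<^sup>2 - 1" by (simp add: algebra_simps power2_eq_square flip: abs_mult)
    finally have aa: "\<bar>\<bar>a\<bar> - 1\<bar> \<le> (4 * M + 5 * c1) * sqrt h" using a2 by simp
    have "\<bar>\<xi> - a\<bar> * 1 \<le> \<bar>\<xi> - a\<bar> * \<mu>" using \<mu> by (intro mult_left_mono) auto
    also have "\<dots> = \<bar>P\<bar>" unfolding P_def using \<mu> by (simp add: abs_mult)
    finally have "\<bar>\<xi> - a\<bar> \<le> M * sqrt h" using Pb by simp
    moreover have "(5 * M + 5 * c1) * sqrt h = M * sqrt h + (4 * M + 5 * c1) * sqrt h" by (simp add: algebra_simps)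
    ultimately have "\<bar>\<xi> - 1\<bar> \<le> (5 * M + 5 * c1) * sqrt h \<or> \<bar>\<xi> + 1\<bar> \<le> (5 * M + 5 * c1) * sqrt h"
      using aa by (cases "a \<ge> 0") auto
    thus ?thesis unfolding M_def by blast
  qed
qed

text \<open>At \<xi> = 1 or -1 the stationarity equation factorises as (\<xi> - a) (\<mu> + a (a +
  \<xi>)) = e, and the second factor is at least 3 / 4 by completing the square. Hence a is within 4
  c1 h of \<xi>, which is more than the scale sqrt h required by the window estimate.\<close>

lemma potential_slope_at_well:
  fixes \<mu> h a \<xi> e c1 :: real
  assumes \<mu>: "\<mu> > 1" and h: "0 < h" "h \<le> 1" "c1 * h \<le> 1 / 4" and c1: "c1 \<ge> 0"
    and stat: "\<mu> * (\<xi> - a) = a ^ 3 - a + e" "\<bar>e\<bar> \<le> c1 * h * (1 + \<bar>a\<bar>)"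
    and \<xi>: "\<xi> = 1 \<or> \<xi> = -1"
  shows "\<bar>\<mu> * (\<xi> - a)\<bar> \<le> 4 * \<mu> * c1 * sqrt h"
proof -
  have hs: "h \<le> sqrt h"
    using h by (intro real_le_rsqrt) (simp add: power2_eq_square mult_left_le)
  have \<xi>2: "\<xi> * \<xi> = 1" using \<xi> by auto
  have "(\<xi> - a) * (\<mu> + a * (a + \<xi>)) = \<mu> * (\<xi> - a) + a * (\<xi> * \<xi> - a * a)"
    by (simp add: algebra_simps)
  also have "\<dots> = e" unfolding stat(1) \<xi>2 by (simp add: power3_eq_cube algebra_simps)
  finally have eq: "(\<xi> - a) * (\<mu> + a * (a + \<xi>)) = e" .
  have "0 \<le> (a + \<xi> / 2)\<^sup>2" by simp
  also have "\<dots> = a * (a + \<xi>) + \<xi> * \<xi> / 4" by (simp add: power2_eq_square algebra_simps)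
  finally have "\<mu> + a * (a + \<xi>) \<ge> 3 / 4" using \<mu> \<xi>2 by simp
  hence "\<bar>\<xi> - a\<bar> * (3 / 4) \<le> \<bar>\<xi> - a\<bar> * (\<mu> + a * (a + \<xi>))" by (intro mult_left_mono) auto
  also have "\<dots> = \<bar>e\<bar>" unfolding eq[symmetric] abs_mult using \<open>\<mu> + a * (a + \<xi>) \<ge> 3 / 4\<close> by simp
  also have "\<dots> \<le> c1 * h * (2 + \<bar>\<xi> - a\<bar>)"
  proof -
    have "1 + \<bar>a\<bar> \<le> 2 + \<bar>\<xi> - a\<bar>" using \<xi> by auto
    hence "c1 * h * (1 + \<bar>a\<bar>) \<le> c1 * h * (2 + \<bar>\<xi> - a\<bar>)" using c1 h by (intro mult_left_mono) auto
    thus ?thesis using stat(2) by linarith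
  qed
  also have "\<dots> \<le> 2 * c1 * h + 1 / 4 * \<bar>\<xi> - a\<bar>"
    using mult_right_mono[OF h(3), of "\<bar>\<xi> - a\<bar>"] by (simp add: algebra_simps)
  finally have "\<bar>\<xi> - a\<bar> \<le> 4 * c1 * h" by simp
  also have "\<dots> \<le> 4 * c1 * sqrt h" using hs c1 by (simp add: mult_left_mono)
  finally have "\<mu> * \<bar>\<xi> - a\<bar> \<le> \<mu> * (4 * c1 * sqrt h)" using \<mu> by (intro mult_left_mono) auto
  thus ?thesis using \<mu> by (simp add: abs_mult mult_ac)
qed

section \<open>Slope and curvature of the field's potential\<close>

context chain
begin

definition a :: "real \<Rightarrow> real" where "a \<xi> = E \<xi> (mean N)"

definition var :: "real \<Rightarrow> real" where "var \<xi> = E \<xi> (\<lambda>x. (mean N x)\<^sup>2) - (a \<xi>)\<^sup>2"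

lemma E_has_derivative:
  assumes g: "egrowth N g"
  shows "((\<lambda>\<xi>. E \<xi> g) has_real_derivative \<mu> / h * (E \<xi> (\<lambda>x. g x * mean N x) - E \<xi> g * a \<xi>)) (at \<xi>)"
proof -
  have Z: "K \<xi> (\<lambda>_. 1) \<noteq> 0" for \<xi> using K_one_pos[of \<xi>] by simp
  have 1: "(\<lambda>x. 1 * mean N x) = mean N" by simp
  show ?thesis
    unfolding E_def a_def
    by (rule DERIV_cong[OF DERIV_divide[OF K_has_derivative[OF g] K_has_derivative[OF egrowth_const] Z]])
      (use Z h in \<open>simp add: 1 field_simps\<close>)
qed

text \<open>This identifies \<mu> (\<xi> - \<open>a \<xi>\<close>) as the slope of the effective
  potential of the field, whose temperature is h without any N.\<close>

lemma Z_has_derivative: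
  "((\<lambda>\<xi>. K \<xi> (\<lambda>_. 1)) has_real_derivative - (\<mu> * (\<xi> - a \<xi>) / h) * K \<xi> (\<lambda>_. 1)) (at \<xi>)"
proof -
  have 1: "(\<lambda>x. 1 * mean N x) = mean N" by simp
  have "K \<xi> (mean N) = a \<xi> * K \<xi> (\<lambda>_. 1)" unfolding a_def E_def using K_one_pos[of \<xi>] by simp
  thus ?thesis
    by (intro DERIV_cong[OF K_has_derivative[OF egrowth_const[of N 1]]]) (simp add: 1 algebra_simps diff_divide_distrib)
qed

lemma a_has_derivative: "(a has_real_derivative \<mu> / h * var \<xi>) (at \<xi>)"
  unfolding a_def[abs_def] var_def
  by (rule DERIV_cong[OF E_has_derivative[OF egrowth_mean]]) (simp add: a_def power2_eq_square)

lemma isCont_E: "egrowth N g \<Longrightarrow> isCont (\<lambda>\<xi>. E \<xi> g) \<xi>"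
  using E_has_derivative DERIV_isCont by blast

lemma isCont_a: "isCont a \<xi>"
  using a_has_derivative DERIV_isCont by blast

lemma E_centered_square:
  assumes "egrowth N g"
  shows "E \<xi> (\<lambda>x. (g x - E \<xi> g)\<^sup>2) = E \<xi> (\<lambda>x. (g x)\<^sup>2) - (E \<xi> g)\<^sup>2"
proof -
  have "E \<xi> (\<lambda>x. (g x - E \<xi> g)\<^sup>2) = E \<xi> (\<lambda>x. (g x)\<^sup>2 - (2 * E \<xi> g) * g x + (E \<xi> g)\<^sup>2)"
    by (simp add: power2_diff algebra_simps)
  also have "\<dots> = E \<xi> (\<lambda>x. (g x)\<^sup>2) - (2 * E \<xi> g) * E \<xi> g + (E \<xi> g)\<^sup>2"
    by (simp only: E_diff E_add E_cmult E_const egrowth_intros assms)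
  finally show ?thesis by (simp add: power2_eq_square)
qed

lemma var_eq: "var \<xi> = E \<xi> (\<lambda>x. (mean N x - a \<xi>)\<^sup>2)"
  unfolding var_def a_def by (rule E_centered_square[OF egrowth_mean, symmetric])

lemma var_bounds: "0 \<le> var \<xi>" "var \<xi> \<le> 12 * \<tau>"
  using mean_variance[of \<xi>] unfolding var_eq by (auto simp: a_def intro: E_nonneg)

lemma E_rotate:
  "\<phi> \<in> borel_measurable borel \<Longrightarrow> k < N \<Longrightarrow> E \<xi> (\<lambda>x. \<phi> (x k)) = E \<xi> (\<lambda>x. \<phi> (x 0))"
  unfolding E_def by (simp only: K_rotate[of \<phi> k])

lemma E_sum: "(\<And>k. k \<in> A \<Longrightarrow> egrowth N (f k)) \<Longrightarrow> E \<xi> (\<lambda>x. \<Sum>k\<in>A. f k x) = (\<Sum>k\<in>A. E \<xi> (f k))"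
  unfolding E_def by (simp add: K_sum sum_divide_distrib)

text \<open>Rotation invariance trades an average over the chain for one coordinate, whose moments
  are bounded uniformly in N.\<close>

lemma E_site_average:
  assumes m: "\<phi> \<in> borel_measurable borel" and eg: "\<And>k. k < N \<Longrightarrow> egrowth N (\<lambda>x. \<phi> (x k))"
  shows "E \<xi> (\<lambda>x. (\<Sum>k<N. \<phi> (x k)) / real N) = E \<xi> (\<lambda>x. \<phi> (x 0))"
proof -
  have "E \<xi> (\<lambda>x. (\<Sum>k<N. \<phi> (x k)) / real N) = (1 / real N) * E \<xi> (\<lambda>x. \<Sum>k<N. \<phi> (x k))"
    using E_cmult[of \<xi> "1 / real N" "\<lambda>x. \<Sum>k<N. \<phi> (x k)"] by simp
  also have "E \<xi> (\<lambda>x. \<Sum>k<N. \<phi> (x k)) = (\<Sum>k<N. E \<xi> (\<lambda>x. \<phi> (x k)))" by (rule E_sum) (use eg in auto)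
  also have "\<dots> = (\<Sum>k<N. E \<xi> (\<lambda>x. \<phi> (x 0)))" by (rule sum.cong[OF refl E_rotate[OF m]]) simp
  also have "\<dots> = real N * E \<xi> (\<lambda>x. \<phi> (x 0))" by simp
  finally show ?thesis using N by simp
qed

lemma E_coord: "E \<xi> (\<lambda>x. x 0) = a \<xi>"
  using E_site_average[of "\<lambda>t. t" \<xi>] unfolding a_def mean_def[abs_def] by (simp add: egrowth_coord)

definition site_var :: "real \<Rightarrow> real" where "site_var \<xi> = E \<xi> (\<lambda>x. (x 0 - a \<xi>)\<^sup>2)"

lemma site_var_bounds: "0 \<le> site_var \<xi>" "site_var \<xi> \<le> 12 * \<tau>"
  using coord_moments(1)[OF N, of \<xi>] unfolding site_var_def E_coord by (auto intro: E_nonneg)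

text \<open>The mean of \<open>D\<close> vanishes. Expanding the cube in it about the conditional
  mean leaves a^3 - a, while 3 a times the variance at one site and the third central moment form
  the error.\<close>

lemma stationarity:
  obtains e where "\<mu> * (\<xi> - a \<xi>) = (a \<xi>) ^ 3 - a \<xi> + e" "\<bar>e\<bar> \<le> 36 * \<tau> * \<bar>a \<xi>\<bar> + 162 * (\<tau> * sqrt \<tau>)"
proof -
  define b where "b = a \<xi>"
  define X where "X = (\<lambda>x::nat \<Rightarrow> real. x 0 - b)"
  have eX: "egrowth N X" unfolding X_def using N by (intro egrowth_intros) auto
  have E1: "E \<xi> X = 0" unfolding X_def b_def using N by (simp add: E_diff egrowth_intros E_coord)
  have m3: "(\<lambda>t::real. t ^ 3) \<in> borel_measurable borel" by simp
  have e3: "egrowth N (\<lambda>x. (x k) ^ 3)" if "k < N" for k using that by (intro egrowth_intros)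
  have D: "D \<xi> = (\<lambda>x. (\<Sum>k<N. (x k) ^ 3) / real N - mean N x + \<mu> * (mean N x - \<xi>))"
    by (simp add: D_def[abs_def])
  have "0 = E \<xi> (D \<xi>)" unfolding E_def using K_D by simp
  also have "\<dots> = E \<xi> (\<lambda>x. (\<Sum>k<N. (x k) ^ 3) / real N) - a \<xi> + \<mu> * (a \<xi> - \<xi>)"
    unfolding D a_def
    by (subst E_add, (intro egrowth_intros; simp)+, subst E_diff, (intro egrowth_intros; simp)+,
        subst E_cmult, subst E_diff, (intro egrowth_intros; simp)+, subst E_const, rule refl)
  also have "E \<xi> (\<lambda>x. (\<Sum>k<N. (x k) ^ 3) / real N) = E \<xi> (\<lambda>x. (x 0) ^ 3)"
    by (rule E_site_average[OF m3 e3])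
  finally have 1: "\<mu> * (\<xi> - b) = E \<xi> (\<lambda>x. (x 0) ^ 3) - b" unfolding b_def by (simp add: algebra_simps)
  have "(\<lambda>x. (x 0) ^ 3) = (\<lambda>x. b ^ 3 + (3 * b\<^sup>2) * X x + (3 * b) * (X x)\<^sup>2 + (X x) ^ 3)"
    unfolding X_def by (simp add: power3_eq_cube power2_eq_square algebra_simps)
  hence "E \<xi> (\<lambda>x. (x 0) ^ 3) = E \<xi> (\<lambda>x. b ^ 3 + (3 * b\<^sup>2) * X x + (3 * b) * (X x)\<^sup>2 + (X x) ^ 3)" by simp
  also have "\<dots> = b ^ 3 + (3 * b\<^sup>2) * E \<xi> X + (3 * b) * E \<xi> (\<lambda>x. (X x)\<^sup>2) + E \<xi> (\<lambda>x. (X x) ^ 3)"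
    by (simp only: E_add E_cmult E_const egrowth_intros eX)
  finally have 2: "E \<xi> (\<lambda>x. (x 0) ^ 3) = b ^ 3 + (3 * b * site_var \<xi> + E \<xi> (\<lambda>x. (X x) ^ 3))"
    unfolding E1 by (simp add: site_var_def X_def b_def)
  have "\<bar>E \<xi> (\<lambda>x. (X x) ^ 3)\<bar> \<le> E \<xi> (\<lambda>x. \<bar>X x\<bar> ^ 3)"
  proof -
    have "E \<xi> (\<lambda>x. (X x) ^ 3) \<le> E \<xi> (\<lambda>x. \<bar>X x\<bar> ^ 3)"
      by (intro E_mono egrowth_intros egrowth_abs eX) (metis abs_ge_self power_abs)
    moreover have "E \<xi> (\<lambda>x. (-1) * \<bar>X x\<bar> ^ 3) \<le> E \<xi> (\<lambda>x. (X x) ^ 3)"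
    proof (intro E_mono egrowth_intros egrowth_abs eX)
      fix x
      have "\<bar>X x\<bar> ^ 3 = \<bar>(X x) ^ 3\<bar>" by (simp add: power_abs)
      thus "(-1) * \<bar>X x\<bar> ^ 3 \<le> (X x) ^ 3" by linarith
    qed
    ultimately show ?thesis unfolding E_cmult by linarith
  qed
  also have "\<dots> \<le> 162 * (\<tau> * sqrt \<tau>)"
    using coord_moments(2)[OF N, of \<xi>] unfolding E_coord X_def b_def .
  finally have 3: "\<bar>E \<xi> (\<lambda>x. (X x) ^ 3)\<bar> \<le> 162 * (\<tau> * sqrt \<tau>)" .
  have "\<bar>3 * b * site_var \<xi>\<bar> = 3 * \<bar>b\<bar> * site_var \<xi>" using site_var_bounds by (simp add: abs_mult)
  also have "\<dots> \<le> 3 * \<bar>b\<bar> * (12 * \<tau>)" using site_var_bounds by (intro mult_left_mono) auto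
  finally have "\<bar>3 * b * site_var \<xi>\<bar> \<le> 36 * \<tau> * \<bar>b\<bar>" by (simp add: mult_ac)
  with 3 have "\<bar>3 * b * site_var \<xi> + E \<xi> (\<lambda>x. (X x) ^ 3)\<bar> \<le> 36 * \<tau> * \<bar>b\<bar> + 162 * (\<tau> * sqrt \<tau>)" by linarith
  thus ?thesis using 1 2 that[of "3 * b * site_var \<xi> + E \<xi> (\<lambda>x. (X x) ^ 3)"] unfolding b_def by simp
qed

text \<open>By parts, the covariance of the mean with \<open>D\<close> equals h, and the second
  moment of \<open>D\<close> is h times the expectation of 3 times the average of x^2 plus \<mu> -
  1; Cauchy-Schwarz concludes. A lower bound on the variance of the mean is an upper bound on the
  curvature of the field's potential.\<close>

lemma cramer_rao: "h \<le> var \<xi> * (3 * ((a \<xi>)\<^sup>2 + site_var \<xi>) + (\<mu> - 1))"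
proof -
  define Z where "Z = K \<xi> (\<lambda>_. 1)"
  define T where "T = (\<lambda>x::nat \<Rightarrow> real. 3 * ((\<Sum>k<N. (x k)\<^sup>2) / real N) + (\<mu> - 1))"
  have Z: "Z > 0" unfolding Z_def by (rule K_one_pos)
  have "K \<xi> (\<lambda>x. (mean N x - a \<xi>) * D \<xi> x) = K \<xi> (\<lambda>x. mean N x * D \<xi> x - a \<xi> * D \<xi> x)"
    by (simp add: algebra_simps)
  also have "\<dots> = h * Z"
    unfolding Z_def by (simp only: K_diff K_cmult egrowth_intros egrowth_D K_D K_mean_D mult_zero_right diff_0_right)
  finally have 1: "K \<xi> (\<lambda>x. (mean N x - a \<xi>) * D \<xi> x) = h * Z" .
  have "(K \<xi> (\<lambda>x. (mean N x - a \<xi>) * D \<xi> x))\<^sup>2 \<le> K \<xi> (\<lambda>x. (mean N x - a \<xi>)\<^sup>2) * K \<xi> (\<lambda>x. (D \<xi> x)\<^sup>2)"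
    by (intro K_Cauchy_Schwarz egrowth_intros egrowth_D)
  also have "K \<xi> (\<lambda>x. (D \<xi> x)\<^sup>2) = h * K \<xi> T" unfolding power2_eq_square T_def by (rule K_D_squared[unfolded power2_eq_square])
  also have "K \<xi> T = Z * E \<xi> T" unfolding E_def Z_def using K_one_pos[of \<xi>] by simp
  also have "K \<xi> (\<lambda>x. (mean N x - a \<xi>)\<^sup>2) = Z * var \<xi>" unfolding var_eq E_def Z_def using K_one_pos[of \<xi>] by simp
  finally have "(h * Z)\<^sup>2 \<le> Z * var \<xi> * (h * (Z * E \<xi> T))" unfolding 1 .
  hence "(h * Z\<^sup>2) * h \<le> (h * Z\<^sup>2) * (var \<xi> * E \<xi> T)" by (simp add: power2_eq_square mult_ac)
  hence 2: "h \<le> var \<xi> * E \<xi> T" using h Z by (subst (asm) mult_le_cancel_left_pos) auto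
  have m2: "(\<lambda>t::real. t\<^sup>2) \<in> borel_measurable borel" by simp
  have e2: "egrowth N (\<lambda>x. (x k)\<^sup>2)" if "k < N" for k using that by (intro egrowth_intros)
  have "E \<xi> T = 3 * E \<xi> (\<lambda>x. (\<Sum>k<N. (x k)\<^sup>2) / real N) + (\<mu> - 1)"
  proof -
    have "egrowth N (\<lambda>x. (\<Sum>k<N. (x k)\<^sup>2) / real N)" by (intro egrowth_intros) auto
    thus ?thesis unfolding T_def by (simp only: E_add E_cmult E_const egrowth_intros)
  qed
  also have "E \<xi> (\<lambda>x. (\<Sum>k<N. (x k)\<^sup>2) / real N) = E \<xi> (\<lambda>x. (x 0)\<^sup>2)" by (rule E_site_average[OF m2 e2])
  also have "\<dots> = (a \<xi>)\<^sup>2 + site_var \<xi>"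
    using E_centered_square[OF egrowth_coord[OF N], of \<xi>] unfolding E_coord site_var_def by simp
  finally show ?thesis using 2 by simp
qed

end

section \<open>The Poincare inequality under two constraints\<close>

text \<open>Both bounds follow from exp u \<ge> 1 + u. One provides domination, the other decay, for
  the boundary terms in the field.\<close>

lemma abs_gaussian_le:
  assumes k: "(k::real) > 0"
  shows "\<bar>s\<bar> * exp (- k * s\<^sup>2) \<le> 1 / (2 * sqrt k)" and "s \<noteq> 0 \<Longrightarrow> \<bar>s\<bar> * exp (- k * s\<^sup>2) \<le> 1 / (k * \<bar>s\<bar>)"
proof -
  have e: "exp (- k * s\<^sup>2) \<le> 1 / (1 + k * s\<^sup>2)"
  proof -
    have "1 + k * s\<^sup>2 \<le> exp (k * s\<^sup>2)" by simp
    moreover have "0 < 1 + k * s\<^sup>2" using k by (intro add_pos_nonneg) auto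
    ultimately show ?thesis by (simp add: exp_minus field_simps)
  qed
  have pos: "0 < 1 + k * s\<^sup>2" using k by (intro add_pos_nonneg) auto
  have "0 \<le> (1 - sqrt k * \<bar>s\<bar>)\<^sup>2" by simp
  also have "\<dots> = 1 + k * s\<^sup>2 - 2 * sqrt k * \<bar>s\<bar>" using k by (simp add: power2_diff power_mult_distrib)
  finally have "2 * sqrt k * \<bar>s\<bar> \<le> 1 + k * s\<^sup>2" by simp
  hence "\<bar>s\<bar> * (1 / (1 + k * s\<^sup>2)) \<le> 1 / (2 * sqrt k)" using k pos by (simp add: field_simps)
  with mult_left_mono[OF e, of "\<bar>s\<bar>"] show "\<bar>s\<bar> * exp (- k * s\<^sup>2) \<le> 1 / (2 * sqrt k)" by linarith
  assume s: "s \<noteq> 0"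
  have "\<bar>s\<bar> * (k * \<bar>s\<bar>) = k * \<bar>s\<bar>\<^sup>2" by (simp only: power2_eq_square mult_ac)
  also have "\<dots> \<le> 1 + k * s\<^sup>2" by simp
  finally have "\<bar>s\<bar> * (k * \<bar>s\<bar>) \<le> 1 + k * s\<^sup>2" .
  hence "\<bar>s\<bar> * (1 / (1 + k * s\<^sup>2)) \<le> 1 / (k * \<bar>s\<bar>)" using k s pos by (simp add: field_simps)
  with mult_left_mono[OF e, of "\<bar>s\<bar>"] show "\<bar>s\<bar> * exp (- k * s\<^sup>2) \<le> 1 / (k * \<bar>s\<bar>)" by linarith
qed

lemma tendsto_abs_gaussian:
  assumes k: "(k::real) > 0" and lim: "filterlim (\<lambda>n. \<bar>s n\<bar>) at_top F"
  shows "((\<lambda>n. \<bar>s n\<bar> * exp (- k * (s n)\<^sup>2)) \<longlongrightarrow> 0) F"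
proof (rule tendsto_sandwich[OF _ _ tendsto_const])
  show "eventually (\<lambda>n. 0 \<le> \<bar>s n\<bar> * exp (- k * (s n)\<^sup>2)) F" by simp
  have "eventually (\<lambda>n. \<bar>s n\<bar> > 0) F" using lim by (simp only: filterlim_at_top_dense)
  thus "eventually (\<lambda>n. \<bar>s n\<bar> * exp (- k * (s n)\<^sup>2) \<le> 1 / (k * \<bar>s n\<bar>)) F"
    by eventually_elim (use abs_gaussian_le(2)[OF k] in auto)
  have "filterlim (\<lambda>n. k * \<bar>s n\<bar>) at_top F"
    by (rule filterlim_tendsto_pos_mult_at_top[OF tendsto_const k lim])
  thus "((\<lambda>n. 1 / (k * \<bar>s n\<bar>)) \<longlongrightarrow> 0) F"
    using tendsto_divide_0[OF tendsto_const filterlim_at_top_imp_at_infinity] by blast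
qed

definition tau0 :: "real \<Rightarrow> real" where "tau0 \<mu> = 16 * pi\<^sup>2 / (\<mu> - 1)"

text \<open>The coefficients of the error in \<open>stationarity\<close>, with \<open>\<tau>\<close>
  replaced by \<open>tau0 \<mu>\<close> times h and the surplus factor sqrt h bounded by 1.\<close>

definition err0 :: "real \<Rightarrow> real" where "err0 \<mu> = 36 * tau0 \<mu> + 162 * (tau0 \<mu> * sqrt (tau0 \<mu>))"

text \<open>The second entry keeps the variance at a site below 1 / 12, as the concavity near 0
  requires; the third lets the stationarity error be absorbed at the wells; the first allows h \<le>
  sqrt h.\<close>

definition small_h :: "real \<Rightarrow> real" where
  "small_h \<mu> = min 1 (min (1 / (144 * tau0 \<mu>)) (1 / (4 * err0 \<mu>)))"

text \<open>The 1 accounts for the conditional variance, the product for the conditional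
  expectation: the one-dimensional constant times the ratio 12 \<mu>^2 \<open>tau0 \<mu>\<close> of
  h (F')^2 to the conditional variance. The division by \<mu> - 1 is the Poincare constant at a
  fixed field.\<close>

definition gap_const :: "real \<Rightarrow> real" where
  "gap_const \<mu> = (1 + line_const \<mu> (5 * sqrt (2 * \<mu> + 1) + 5 * err0 \<mu>) (\<mu> * (1 + \<mu> * (12 * tau0 \<mu>)))
     (4 * \<mu> * err0 \<mu>) * (12 * \<mu>\<^sup>2 * tau0 \<mu>)) / (\<mu> - 1)"

lemma gap_consts_pos:
  assumes "\<mu> > 1"
  shows "tau0 \<mu> > 0" "err0 \<mu> > 0" "small_h \<mu> > 0" "gap_const \<mu> > 0"
proof -
  show t: "tau0 \<mu> > 0" unfolding tau0_def using assms by simp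
  show e: "err0 \<mu> > 0" unfolding err0_def using t by (intro add_pos_pos mult_pos_pos) auto
  show "small_h \<mu> > 0" unfolding small_h_def using t e by simp
  show "gap_const \<mu> > 0" unfolding gap_const_def line_const_def using assms t e
    by (intro divide_pos_pos add_pos_nonneg mult_nonneg_nonneg) auto
qed

section \<open>Integration over the field and the combined estimate\<close>

context chain
begin

definition gauss_mass :: real where "gauss_mass = (\<integral>s. exp (- (\<mu> / (2 * h)) * s\<^sup>2) \<partial>lborel)"

lemma gauss_integrable: "integrable lborel (\<lambda>s::real. exp (- (\<mu> / (2 * h)) * s\<^sup>2))"
  by (rule integrable_gaussian) (use \<mu> h in simp)

lemma gauss_mass_pos: "gauss_mass > 0"
proof -
  have "gauss_mass \<noteq> 0"
  proof
    assume "gauss_mass = 0"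
    hence "AE s in lborel. exp (- (\<mu> / (2 * h)) * (s::real)\<^sup>2) = 0"
      unfolding gauss_mass_def using gauss_integrable by (subst (asm) integral_nonneg_eq_0_iff_AE) auto
    hence "AE s::real in lborel. False" by simp
    hence "emeasure lborel (UNIV :: real set) = 0"
      by (subst (asm) AE_iff_measurable[OF sets.top]) auto
    thus False by simp
  qed
  moreover have "gauss_mass \<ge> 0" unfolding gauss_mass_def by (intro integral_nonneg_AE) auto
  ultimately show ?thesis by simp
qed

lemma K_line_integral:
  assumes g: "egrowth N g"
  shows "integrable lborel (\<lambda>\<xi>. K \<xi> g)"
    and "(\<integral>\<xi>. K \<xi> g \<partial>lborel) = gauss_mass * (\<integral>x. g x * weight \<mu> h N x \<partial>lebN N)"
proof -
  interpret sf: sigma_finite_measure "lebN N" by (rule sigma_finite_lebN)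
  interpret pair_sigma_finite "lebN N" lborel ..
  note [measurable] = egrowth_measurable[OF g]
  have W': "W \<xi> x = weight \<mu> h N x * exp (- (\<mu> / (2 * h)) * (- mean N x + 1 * \<xi>)\<^sup>2)" for \<xi> x
    unfolding W_eq by simp
  have iW: "integrable lborel (\<lambda>\<xi>. W \<xi> x)" for x
    unfolding W' by (intro integrable_mult_right lborel_integrable_real_affine gauss_integrable) auto
  have W_int: "(\<integral>\<xi>. W \<xi> x \<partial>lborel) = weight \<mu> h N x * gauss_mass" for x
  proof -
    have "gauss_mass = (\<integral>\<xi>. exp (- (\<mu> / (2 * h)) * (- mean N x + 1 * \<xi>)\<^sup>2) \<partial>lborel)"
      unfolding gauss_mass_def
      using lborel_integral_real_affine[of 1 "\<lambda>s::real. exp (- (\<mu> / (2 * h)) * s\<^sup>2)" "- mean N x"] by simp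
    thus ?thesis unfolding W' by simp
  qed
  define G where "G x \<xi> = g x * W \<xi> x" for x \<xi>
  have mG: "case_prod G \<in> borel_measurable (lebN N \<Otimes>\<^sub>M lborel)"
    unfolding G_def W_eq case_prod_beta by measurable
  have int: "integrable (lebN N \<Otimes>\<^sub>M lborel) (case_prod G)"
  proof (rule Fubini_integrable[OF mG])
    have "(\<integral>\<xi>. norm (case_prod G (x, \<xi>)) \<partial>lborel) = (\<bar>g x\<bar> * weight \<mu> h N x) * gauss_mass" for x
    proof -
      have "(\<integral>\<xi>. norm (case_prod G (x, \<xi>)) \<partial>lborel) = (\<integral>\<xi>. \<bar>g x\<bar> * W \<xi> x \<partial>lborel)"
        using W_pos[THEN less_imp_le] by (simp add: G_def abs_mult)
      thus ?thesis using W_int by simp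
    qed
    thus "integrable (lebN N) (\<lambda>x. \<integral>\<xi>. norm (case_prod G (x, \<xi>)) \<partial>lborel)"
      using integrable_egrowth_weight[OF egrowth_abs[OF g]] by simp
    show "AE x in lebN N. integrable lborel (\<lambda>\<xi>. case_prod G (x, \<xi>))"
      using iW by (simp add: G_def)
  qed
  show "integrable lborel (\<lambda>\<xi>. K \<xi> g)"
    using integrable_snd[OF int] unfolding K_def G_def by simp
  have "(\<integral>\<xi>. K \<xi> g \<partial>lborel) = (\<integral>x. (\<integral>\<xi>. G x \<xi> \<partial>lborel) \<partial>lebN N)"
    unfolding K_def G_def[symmetric] by (rule Fubini_integral[OF int])
  also have "\<dots> = (\<integral>x. gauss_mass * (g x * weight \<mu> h N x) \<partial>lebN N)"
    unfolding G_def by (simp add: W_int mult_ac)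
  finally show "(\<integral>\<xi>. K \<xi> g \<partial>lborel) = gauss_mass * (\<integral>x. g x * weight \<mu> h N x \<partial>lebN N)" by simp
qed

text \<open>The one-dimensional estimate holds on bounded intervals, in terms of the gauge integral
  and with boundary terms. This is the passage to the whole line.\<close>

lemma K_interval_integral_limit:
  assumes g: "egrowth N g"
  shows "(\<lambda>n. integral {- real n..real n} (\<lambda>\<xi>. K \<xi> g)) \<longlonglongrightarrow> gauss_mass * (\<integral>x. g x * weight \<mu> h N x \<partial>lebN N)"
proof -
  note int = K_line_integral(1)[OF g]
  have [measurable]: "(\<lambda>\<xi>. K \<xi> g) \<in> borel_measurable borel" using int by auto
  have eq: "integral {- real n..real n} (\<lambda>\<xi>. K \<xi> g) = (\<integral>\<xi>. indicator {- real n..real n} \<xi> * K \<xi> g \<partial>lborel)" for n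
  proof -
    have "set_integrable lborel {- real n..real n} (\<lambda>\<xi>. K \<xi> g)"
      unfolding set_integrable_def using int by (intro integrable_mult_indicator) auto
    from set_borel_integral_eq_integral(2)[OF this] show ?thesis by (simp add: set_lebesgue_integral_def)
  qed
  have "(\<lambda>n. \<integral>\<xi>. indicator {- real n..real n} \<xi> * K \<xi> g \<partial>lborel) \<longlonglongrightarrow> (\<integral>\<xi>. K \<xi> g \<partial>lborel)"
  proof (rule integral_dominated_convergence[where w = "\<lambda>\<xi>. \<bar>K \<xi> g\<bar>"])
    show "AE \<xi> in lborel. (\<lambda>n. indicator {- real n..real n} \<xi> * K \<xi> g) \<longlonglongrightarrow> K \<xi> g"
    proof (rule AE_I2, rule tendsto_eventually)
      fix \<xi> :: real
      obtain n0 :: nat where n0: "\<bar>\<xi>\<bar> \<le> real n0" using real_arch_simple by blast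
      show "eventually (\<lambda>n. indicator {- real n..real n} \<xi> * K \<xi> g = K \<xi> g) sequentially"
        using eventually_ge_at_top[of n0]
      proof eventually_elim
        case (elim n)
        hence "real n0 \<le> real n" by simp
        hence "\<xi> \<in> {- real n..real n}" using n0 by auto
        thus ?case by simp
      qed
    qed
    show "AE \<xi> in lborel. norm (indicator {- real n..real n} \<xi> * K \<xi> g) \<le> \<bar>K \<xi> g\<bar>" for n
      by (auto simp: indicator_def)
  qed (use int in auto)
  thus ?thesis unfolding eq K_line_integral(2)[OF g] .
qed

text \<open>Up to the factor \<mu> this is slope times density of the field far out, as it occurs in
  the boundary terms. Domination is uniform in n because |t| exp (- k t^2) is bounded.\<close>

lemma boundary_limit:
  assumes s: "filterlim (\<lambda>n. \<bar>s n :: real\<bar>) at_top sequentially"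
  shows "(\<lambda>n. (s n - a (s n)) * K (s n) (\<lambda>_. 1)) \<longlonglongrightarrow> 0"
proof -
  define k where "k = \<mu> / (2 * h)"
  have k: "k > 0" unfolding k_def using \<mu> h by simp
  have "(\<lambda>n. \<integral>x. (s n - mean N x) * W (s n) x \<partial>lebN N) \<longlonglongrightarrow> (\<integral>x. 0 \<partial>lebN N)"
  proof (rule integral_dominated_convergence[where w = "\<lambda>x. 1 / (2 * sqrt k) * weight \<mu> h N x"])
    have Wk: "norm ((s n - mean N x) * W (s n) x)
        = (\<bar>s n - mean N x\<bar> * exp (- k * (s n - mean N x)\<^sup>2)) * weight \<mu> h N x" for n x
      unfolding W_eq k_def by (simp add: abs_mult weight_def)
    show "AE x in lebN N. norm ((s n - mean N x) * W (s n) x) \<le> 1 / (2 * sqrt k) * weight \<mu> h N x" for n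
      unfolding Wk by (intro AE_I2 mult_right_mono abs_gaussian_le(1)[OF k]) (simp add: weight_def)
    show "integrable (lebN N) (\<lambda>x. 1 / (2 * sqrt k) * weight \<mu> h N x)"
      by (rule integrable_egrowth_weight[OF egrowth_const])
    show "AE x in lebN N. (\<lambda>n. (s n - mean N x) * W (s n) x) \<longlonglongrightarrow> 0"
    proof (rule AE_I2, rule tendsto_norm_zero_cancel)
      fix x
      have "filterlim (\<lambda>n. - \<bar>mean N x\<bar> + \<bar>s n\<bar>) at_top sequentially"
        by (rule filterlim_tendsto_add_at_top[OF tendsto_const s])
      hence "filterlim (\<lambda>n. \<bar>s n - mean N x\<bar>) at_top sequentially"
        by (rule filterlim_at_top_mono) (auto intro!: always_eventually)
      from tendsto_mult_left_zero[OF tendsto_abs_gaussian[OF k this]]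
      show "(\<lambda>n. norm ((s n - mean N x) * W (s n) x)) \<longlonglongrightarrow> 0" unfolding Wk .
    qed
  qed auto
  moreover have "(\<integral>x. (s n - mean N x) * W (s n) x \<partial>lebN N) = (s n - a (s n)) * K (s n) (\<lambda>_. 1)" for n
  proof -
    have "(\<integral>x. (s n - mean N x) * W (s n) x \<partial>lebN N) = K (s n) (\<lambda>x. s n - mean N x)" by (simp add: K_def)
    also have "\<dots> = E (s n) (\<lambda>x. s n - mean N x) * K (s n) (\<lambda>_. 1)" unfolding E_def using K_one_pos[of "s n"] by simp
    also have "E (s n) (\<lambda>x. s n - mean N x) = s n - a (s n)" unfolding a_def by (simp add: E_diff egrowth_intros)
    finally show ?thesis .
  qed
  ultimately show ?thesis by simp
qed

text \<open>At each \<xi> the second moment of \<open>f\<close> splits into conditional variance and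
  squared conditional expectation \<open>F\<close>. The one-dimensional inequality bounds the latter
  by h (F')^2, which returns to the conditional variance, so a single use of the fixed-field
  Poincare inequality closes both parts.\<close>

lemma poincare_two_constraints:
  assumes h0: "h \<le> small_h \<mu>"
    and f: "f \<in> borel_measurable (lebN N)" "\<And>x. x \<in> RN N \<Longrightarrow> \<bar>f x\<bar> \<le> F0"
    and p: "\<And>k. k < N \<Longrightarrow> p k \<in> borel_measurable (lebN N)" "\<And>x k. k < N \<Longrightarrow> x \<in> RN N \<Longrightarrow> \<bar>p k x\<bar> \<le> P0"
    and taylor: "\<And>x y. x \<in> RN N \<Longrightarrow> y \<in> RN N \<Longrightarrow>
      f x - f y \<le> (\<Sum>k<N. p k x * (x k - y k)) + B * (\<Sum>k<N. (x k - y k)\<^sup>2)"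
    and zero: "K 1 f = 0" "K (-1) f = 0"
  shows "(\<integral>x. (f x)\<^sup>2 * weight \<mu> h N x \<partial>lebN N)
    \<le> gap_const \<mu> * (h * real N * (\<integral>x. (\<Sum>k<N. (p k x)\<^sup>2) * weight \<mu> h N x \<partial>lebN N))"
proof -
  note pos = gap_consts_pos[OF \<mu>]
  define c1 where "c1 = err0 \<mu>"
  define c2 where "c2 = 12 * tau0 \<mu>"
  define c where "c = 5 * sqrt (2 * \<mu> + 1) + 5 * c1"
  define c3 where "c3 = \<mu> * (1 + \<mu> * c2)"
  define c4 where "c4 = 4 * \<mu> * c1"
  define LC where "LC = line_const \<mu> c c3 c4"
  have c: "c > 0" "c3 \<ge> 0" "c4 \<ge> 0" "c1 \<ge> 0" "c2 \<ge> 0"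
    unfolding c_def c3_def c4_def c1_def c2_def using pos \<mu> by (auto intro!: add_pos_pos mult_nonneg_nonneg)
  have LC: "LC \<ge> 0" unfolding LC_def line_const_def using \<mu> by simp
  have h1: "h \<le> 1" using h0 unfolding small_h_def by simp
  have hc2: "h * c2 \<le> 1 / 12"
  proof -
    have "h \<le> 1 / (144 * tau0 \<mu>)" using h0 unfolding small_h_def by simp
    thus ?thesis unfolding c2_def using pos by (simp add: field_simps)
  qed
  have hc1: "c1 * h \<le> 1 / 4"
  proof -
    have "h \<le> 1 / (4 * err0 \<mu>)" using h0 unfolding small_h_def by simp
    thus ?thesis unfolding c1_def using pos by (simp add: field_simps)
  qed
  have tau: "\<tau> = tau0 \<mu> * h" unfolding \<tau>_def tau0_def by simp
  have tau2: "12 * \<tau> = c2 * h" unfolding tau c2_def by simp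
  define P where "P \<xi> = \<mu> * (\<xi> - a \<xi>)" for \<xi>
  define P' where "P' \<xi> = \<mu> * (1 - \<mu> / h * var \<xi>)" for \<xi>
  define Z where "Z \<xi> = K \<xi> (\<lambda>_. 1)" for \<xi>
  define F where "F \<xi> = E \<xi> f" for \<xi>
  define F' where "F' \<xi> = \<mu> / h * (E \<xi> (\<lambda>x. f x * mean N x) - E \<xi> f * a \<xi>)" for \<xi>
  define g where "g x = (\<Sum>k<N. (p k x)\<^sup>2)" for x
  have ef: "egrowth N f" by (rule egrowth_bounded[OF f])
  have eg: "egrowth N g" unfolding g_def[abs_def]
    by (intro egrowth_sum egrowth_power) (use p in \<open>auto intro!: egrowth_bounded\<close>)
  have ef2: "egrowth N (\<lambda>x. (f x)\<^sup>2)" by (intro egrowth_intros ef)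
  have Z: "Z \<xi> > 0" for \<xi> unfolding Z_def by (rule K_one_pos)
  have stat: "\<exists>e. \<mu> * (\<xi> - a \<xi>) = (a \<xi>) ^ 3 - a \<xi> + e \<and> \<bar>e\<bar> \<le> c1 * h * (1 + \<bar>a \<xi>\<bar>)" for \<xi>
  proof -
    obtain e where e: "\<mu> * (\<xi> - a \<xi>) = (a \<xi>) ^ 3 - a \<xi> + e" "\<bar>e\<bar> \<le> 36 * \<tau> * \<bar>a \<xi>\<bar> + 162 * (\<tau> * sqrt \<tau>)"
      by (rule stationarity)
    have "sqrt \<tau> \<le> sqrt (tau0 \<mu>)" unfolding tau using h1 pos by (intro real_sqrt_le_mono) simp
    hence "162 * (\<tau> * sqrt \<tau>) \<le> 162 * (\<tau> * sqrt (tau0 \<mu>))" using \<tau>_pos by simp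
    also have "\<dots> = 162 * (tau0 \<mu> * sqrt (tau0 \<mu>)) * h" unfolding tau by simp
    finally have 1: "162 * (\<tau> * sqrt \<tau>) \<le> 162 * (tau0 \<mu> * sqrt (tau0 \<mu>)) * h" .
    have "c1 * h * (1 + \<bar>a \<xi>\<bar>) = 36 * \<tau> * \<bar>a \<xi>\<bar> + 162 * (tau0 \<mu> * sqrt (tau0 \<mu>)) * h
       + (36 * \<tau> + 162 * (tau0 \<mu> * sqrt (tau0 \<mu>)) * h * \<bar>a \<xi>\<bar>)"
      unfolding c1_def err0_def tau by (simp add: algebra_simps)
    moreover have "0 \<le> 36 * \<tau> + 162 * (tau0 \<mu> * sqrt (tau0 \<mu>)) * h * \<bar>a \<xi>\<bar>"
      using \<tau>_pos pos h by (intro add_nonneg_nonneg mult_nonneg_nonneg) auto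
    ultimately have "\<bar>e\<bar> \<le> c1 * h * (1 + \<bar>a \<xi>\<bar>)" using e(2) 1 by linarith
    with e(1) show ?thesis by blast
  qed
  have vb: "0 \<le> var \<xi>" "var \<xi> \<le> c2 * h" for \<xi> using var_bounds[of \<xi>] tau2 by auto
  have P'b: "\<bar>P' \<xi>\<bar> \<le> c3" "P' \<xi> \<le> \<mu>" for \<xi>
  proof -
    have "\<mu> / h * var \<xi> \<le> \<mu> / h * (c2 * h)" using vb \<mu> h by (intro mult_left_mono) auto
    hence 1: "\<mu> / h * var \<xi> \<le> \<mu> * c2" using h by simp
    have 0: "0 \<le> \<mu> / h * var \<xi>" using vb \<mu> h by simp
    hence "\<bar>1 - \<mu> / h * var \<xi>\<bar> \<le> 1 + \<mu> * c2" using 1 by linarith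
    thus "\<bar>P' \<xi>\<bar> \<le> c3" unfolding P'_def c3_def abs_mult using \<mu> by (intro mult_mono) auto
    have "\<mu> * (1 - \<mu> / h * var \<xi>) \<le> \<mu> * 1" using 0 \<mu> by (intro mult_left_mono) auto
    thus "P' \<xi> \<le> \<mu>" unfolding P'_def by simp
  qed
  have pot: "(P \<xi>)\<^sup>2 / (4 * h) - P' \<xi> / 2 \<ge> 1 / 4 \<or> \<bar>\<xi> - 1\<bar> \<le> c * sqrt h \<or> \<bar>\<xi> + 1\<bar> \<le> c * sqrt h" for \<xi>
  proof -
    obtain e where e: "\<mu> * (\<xi> - a \<xi>) = (a \<xi>) ^ 3 - a \<xi> + e" "\<bar>e\<bar> \<le> c1 * h * (1 + \<bar>a \<xi>\<bar>)"
      using stat by blast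
    have sv: "site_var \<xi> \<le> c2 * h" using site_var_bounds[of \<xi>] tau2 by simp
    show ?thesis unfolding P_def P'_def c_def
      by (rule potential_dichotomy[OF \<mu> h h1 hc2 c(4) e sv cramer_rao vb(1)])
  qed
  have slope: "\<bar>P \<xi>\<bar> \<le> c4 * sqrt h" if "\<xi> = 1 \<or> \<xi> = -1" for \<xi>
  proof -
    obtain e where e: "\<mu> * (\<xi> - a \<xi>) = (a \<xi>) ^ 3 - a \<xi> + e" "\<bar>e\<bar> \<le> c1 * h * (1 + \<bar>a \<xi>\<bar>)"
      using stat by blast
    show ?thesis unfolding P_def c4_def by (rule potential_slope_at_well[OF \<mu> h h1 hc1 c(4) e that])
  qed
  have dP: "(P has_real_derivative P' \<xi>) (at \<xi>)" for \<xi>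
    unfolding P_def[abs_def] P'_def by (auto intro!: derivative_eq_intros a_has_derivative)
  have dF: "(F has_real_derivative F' \<xi>) (at \<xi>)" for \<xi>
    unfolding F_def[abs_def] F'_def by (rule E_has_derivative[OF ef])
  have dZ: "(Z has_real_derivative - (P \<xi> / h) * Z \<xi>) (at \<xi>)" for \<xi>
    unfolding Z_def[abs_def] P_def by (rule Z_has_derivative)
  have cont: "continuous_on A F" "continuous_on A F'" "continuous_on A P'" "continuous_on A Z" for A
  proof -
    have i: "isCont F \<xi>" "isCont Z \<xi>" for \<xi> using dF dZ DERIV_isCont by blast+
    have "isCont F' \<xi>" for \<xi> unfolding F'_def
      by (intro continuous_intros isCont_E isCont_a egrowth_intros ef)
    moreover have "isCont P' \<xi>" for \<xi> unfolding P'_def var_def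
      by (intro continuous_intros isCont_E isCont_a egrowth_intros)
    ultimately show "continuous_on A F" "continuous_on A F'" "continuous_on A P'" "continuous_on A Z"
      using i by (simp_all add: continuous_at_imp_continuous_on)
  qed
  have contK: "continuous_on A (\<lambda>\<xi>. K \<xi> q)" if "egrowth N q" for A q
    using K_has_derivative[OF that] DERIV_isCont by (intro continuous_at_imp_continuous_on ballI) blast
  have F0: "F 1 = 0" "F (-1) = 0" unfolding F_def E_def using zero by auto
  define V where "V \<xi> = E \<xi> (\<lambda>x. (f x)\<^sup>2) - (F \<xi>)\<^sup>2" for \<xi>
  have Vc: "V \<xi> = E \<xi> (\<lambda>x. (f x - F \<xi>)\<^sup>2)" for \<xi>
    unfolding V_def F_def by (rule E_centered_square[OF ef, symmetric])
  have V0: "V \<xi> \<ge> 0" for \<xi> unfolding Vc by (rule E_nonneg) simp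
  \<comment> \<open>Differentiation in the field brings a factor \<mu> / h. Its square times h is
    compensated by the variance of the mean, which is O(h), so the resulting constant is free of
    h.\<close>
  have F'V: "h * (F' \<xi>)\<^sup>2 \<le> 12 * \<mu>\<^sup>2 * tau0 \<mu> * V \<xi>" for \<xi>
  proof -
    define cov where "cov = E \<xi> (\<lambda>x. (f x - F \<xi>) * (mean N x - a \<xi>))"
    have "cov = E \<xi> (\<lambda>x. f x * mean N x - a \<xi> * f x - F \<xi> * mean N x + F \<xi> * a \<xi>)"
      unfolding cov_def by (simp add: algebra_simps)
    also have "\<dots> = E \<xi> (\<lambda>x. f x * mean N x) - a \<xi> * E \<xi> f - F \<xi> * E \<xi> (mean N) + F \<xi> * a \<xi>"
      by (simp only: E_diff E_add E_cmult E_const egrowth_intros ef)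
    finally have F': "F' \<xi> = \<mu> / h * cov" unfolding F'_def F_def a_def[symmetric] by simp
    have "(K \<xi> (\<lambda>x. (f x - F \<xi>) * (mean N x - a \<xi>)))\<^sup>2 / (Z \<xi>)\<^sup>2
      \<le> K \<xi> (\<lambda>x. (f x - F \<xi>)\<^sup>2) * K \<xi> (\<lambda>x. (mean N x - a \<xi>)\<^sup>2) / (Z \<xi>)\<^sup>2"
      by (intro divide_right_mono K_Cauchy_Schwarz egrowth_intros ef) simp
    hence "cov\<^sup>2 \<le> V \<xi> * var \<xi>"
      unfolding cov_def Vc var_eq E_def Z_def by (simp add: power_divide power2_eq_square)
    also have "\<dots> \<le> V \<xi> * (c2 * h)" by (intro mult_left_mono vb V0)
    finally have "cov\<^sup>2 \<le> V \<xi> * (c2 * h)" .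
    hence "(\<mu>\<^sup>2 / h) * cov\<^sup>2 \<le> (\<mu>\<^sup>2 / h) * (V \<xi> * (c2 * h))" using h by (intro mult_left_mono) auto
    also have "\<dots> = 12 * \<mu>\<^sup>2 * tau0 \<mu> * V \<xi>" unfolding c2_def using h by simp
    also have "(\<mu>\<^sup>2 / h) * cov\<^sup>2 = h * (F' \<xi>)\<^sup>2" unfolding F' using h by (simp add: power_divide power_mult_distrib power2_eq_square)
    finally show ?thesis .
  qed
  have PV: "V \<xi> * Z \<xi> \<le> h * real N / (\<mu> - 1) * K \<xi> g" for \<xi>
  proof -
    have "V \<xi> \<le> h * real N / (\<mu> - 1) * E \<xi> g"
      unfolding V_def F_def g_def[abs_def] by (rule poincare[OF f p taylor])
    hence "V \<xi> * Z \<xi> \<le> h * real N / (\<mu> - 1) * E \<xi> g * Z \<xi>" using Z[of \<xi>] by (intro mult_right_mono) auto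
    thus ?thesis unfolding E_def Z_def using K_one_pos[of \<xi>] by simp
  qed
  have Kf: "K \<xi> (\<lambda>x. (f x)\<^sup>2) = V \<xi> * Z \<xi> + (F \<xi>)\<^sup>2 * Z \<xi>" for \<xi>
    unfolding V_def E_def Z_def using K_one_pos[of \<xi>] by (simp add: left_diff_distrib)
  have contV: "continuous_on A (\<lambda>\<xi>. V \<xi> * Z \<xi>)" for A
  proof -
    have "(\<lambda>\<xi>. V \<xi> * Z \<xi>) = (\<lambda>\<xi>. K \<xi> (\<lambda>x. (f x)\<^sup>2) - (F \<xi>)\<^sup>2 * Z \<xi>)" using Kf by auto
    thus ?thesis by (simp only:) (intro continuous_intros contK cont ef2)
  qed
  \<comment> \<open>The boundary terms of the one-dimensional estimate. They vanish at infinity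
    because \<open>F\<close> is bounded and slope times density tends to 0.\<close>
  define bd where "bd s = 2 * \<bar>P s * (F s)\<^sup>2 * Z s\<bar>" for s
  define C where "C = (1 + LC * (12 * \<mu>\<^sup>2 * tau0 \<mu>)) * (h * real N / (\<mu> - 1))"
  have main: "integral {- R..R} (\<lambda>\<xi>. K \<xi> (\<lambda>x. (f x)\<^sup>2)) \<le> C * integral {- R..R} (\<lambda>\<xi>. K \<xi> g) + (bd R + bd (- R))"
    if R: "R \<ge> 1 + c * sqrt h" for R
  proof -
    define I where "I = {- R..R}"
    have ii: "q integrable_on I" if "continuous_on I q" for q :: "real \<Rightarrow> real"
      unfolding I_def using that I_def by (intro integrable_continuous_interval) auto
    define JV where "JV = integral I (\<lambda>\<xi>. V \<xi> * Z \<xi>)"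
    have "integral I (\<lambda>\<xi>. K \<xi> (\<lambda>x. (f x)\<^sup>2)) = JV + integral I (\<lambda>\<xi>. (F \<xi>)\<^sup>2 * Z \<xi>)"
      unfolding Kf JV_def
      by (intro Henstock_Kurzweil_Integration.integral_add ii continuous_intros contV cont)
    also have "integral I (\<lambda>\<xi>. (F \<xi>)\<^sup>2 * Z \<xi>)
        \<le> LC * (h * integral I (\<lambda>\<xi>. (F' \<xi>)\<^sup>2 * Z \<xi>)) + bd R + bd (- R)"
      unfolding I_def LC_def bd_def
      by (rule double_well_poincare[OF h c(1-3) _ Z dZ dP cont(3) P'b slope slope dF cont(2) F0 pot R]) (use \<mu> in auto)
    also have "h * integral I (\<lambda>\<xi>. (F' \<xi>)\<^sup>2 * Z \<xi>) = integral I (\<lambda>\<xi>. h * ((F' \<xi>)\<^sup>2 * Z \<xi>))" by simp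
    also have "integral I (\<lambda>\<xi>. h * ((F' \<xi>)\<^sup>2 * Z \<xi>)) \<le> integral I (\<lambda>\<xi>. 12 * \<mu>\<^sup>2 * tau0 \<mu> * (V \<xi> * Z \<xi>))"
    proof (rule integral_le)
      fix \<xi> assume "\<xi> \<in> I"
      show "h * ((F' \<xi>)\<^sup>2 * Z \<xi>) \<le> 12 * \<mu>\<^sup>2 * tau0 \<mu> * (V \<xi> * Z \<xi>)"
        using mult_right_mono[OF F'V[of \<xi>] less_imp_le[OF Z[of \<xi>]]] by (simp only: mult.assoc)
    qed (intro ii continuous_intros contV cont)+
    hence "LC * integral I (\<lambda>\<xi>. h * ((F' \<xi>)\<^sup>2 * Z \<xi>)) \<le> LC * (12 * \<mu>\<^sup>2 * tau0 \<mu> * JV)"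
      unfolding JV_def using LC by (intro mult_left_mono) auto
    finally have 1: "integral I (\<lambda>\<xi>. K \<xi> (\<lambda>x. (f x)\<^sup>2)) \<le> JV + LC * (12 * \<mu>\<^sup>2 * tau0 \<mu> * JV) + (bd R + bd (- R))"
      by linarith
    have "JV \<le> integral I (\<lambda>\<xi>. h * real N / (\<mu> - 1) * K \<xi> g)" unfolding JV_def
      by (rule integral_le[OF _ _ PV]) (intro ii continuous_on_mult_left contV contK eg)+
    hence "JV \<le> h * real N / (\<mu> - 1) * integral I (\<lambda>\<xi>. K \<xi> g)" by simp
    hence "(1 + LC * (12 * \<mu>\<^sup>2 * tau0 \<mu>)) * JV \<le> (1 + LC * (12 * \<mu>\<^sup>2 * tau0 \<mu>)) * (h * real N / (\<mu> - 1) * integral I (\<lambda>\<xi>. K \<xi> g))"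
      using LC pos(1) by (intro mult_left_mono) auto
    moreover have "JV + LC * (12 * \<mu>\<^sup>2 * tau0 \<mu> * JV) = (1 + LC * (12 * \<mu>\<^sup>2 * tau0 \<mu>)) * JV" by (simp add: algebra_simps)
    ultimately show ?thesis using 1 unfolding C_def I_def by (simp only: mult.assoc) 
  qed
  have Fb: "(F s)\<^sup>2 \<le> F0\<^sup>2" for s
  proof -
    have "E s f \<le> E s (\<lambda>_. F0)" by (intro E_mono ef egrowth_const) (use f(2) abs_le_D1 in blast)
    moreover have "E s (\<lambda>_. - F0) \<le> E s f"
      by (intro E_mono ef egrowth_const) (use f(2) in \<open>auto simp: abs_le_iff minus_le_iff\<close>)
    ultimately have "\<bar>F s\<bar> \<le> F0" unfolding F_def by simp
    thus ?thesis using power_mono[of "\<bar>F s\<bar>" F0 2] by simp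
  qed
  have bdlim: "(\<lambda>n. bd (s n)) \<longlonglongrightarrow> 0" if s: "filterlim (\<lambda>n. \<bar>s n\<bar>) at_top sequentially" for s :: "nat \<Rightarrow> real"
  proof (rule tendsto_sandwich[OF _ _ tendsto_const])
    show "eventually (\<lambda>n. 0 \<le> bd (s n)) sequentially" unfolding bd_def by simp
    have "bd (s n) \<le> 2 * \<mu> * F0\<^sup>2 * \<bar>(s n - a (s n)) * K (s n) (\<lambda>_. 1)\<bar>" for n
    proof -
      have "bd (s n) = 2 * \<mu> * (F (s n))\<^sup>2 * \<bar>(s n - a (s n)) * K (s n) (\<lambda>_. 1)\<bar>"
        unfolding bd_def P_def Z_def using \<mu> by (simp add: abs_mult)
      also have "\<dots> \<le> 2 * \<mu> * F0\<^sup>2 * \<bar>(s n - a (s n)) * K (s n) (\<lambda>_. 1)\<bar>"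
        using \<mu> Fb by (intro mult_right_mono mult_left_mono) auto
      finally show ?thesis .
    qed
    thus "eventually (\<lambda>n. bd (s n) \<le> 2 * \<mu> * F0\<^sup>2 * \<bar>(s n - a (s n)) * K (s n) (\<lambda>_. 1)\<bar>) sequentially" by simp
    show "(\<lambda>n. 2 * \<mu> * F0\<^sup>2 * \<bar>(s n - a (s n)) * K (s n) (\<lambda>_. 1)\<bar>) \<longlonglongrightarrow> 0"
      by (intro tendsto_mult_right_zero tendsto_rabs_zero boundary_limit s)
  qed
  have rn: "filterlim (\<lambda>n. \<bar>real n\<bar>) at_top sequentially" "filterlim (\<lambda>n. \<bar>- real n\<bar>) at_top sequentially"
    using filterlim_real_sequentially by simp_all
  have "(\<lambda>n. C * integral {- real n..real n} (\<lambda>\<xi>. K \<xi> g) + (bd (real n) + bd (- real n)))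
    \<longlonglongrightarrow> C * (gauss_mass * (\<integral>x. g x * weight \<mu> h N x \<partial>lebN N)) + (0 + 0)"
    by (intro tendsto_intros K_interval_integral_limit eg bdlim rn)
  moreover have "(\<lambda>n. integral {- real n..real n} (\<lambda>\<xi>. K \<xi> (\<lambda>x. (f x)\<^sup>2)))
    \<longlonglongrightarrow> gauss_mass * (\<integral>x. (f x)\<^sup>2 * weight \<mu> h N x \<partial>lebN N)"
    by (rule K_interval_integral_limit[OF ef2])
  moreover have "eventually (\<lambda>n. integral {- real n..real n} (\<lambda>\<xi>. K \<xi> (\<lambda>x. (f x)\<^sup>2))
     \<le> C * integral {- real n..real n} (\<lambda>\<xi>. K \<xi> g) + (bd (real n) + bd (- real n))) sequentially"
  proof -
    obtain n0 :: nat where n0: "1 + c * sqrt h \<le> real n0" using real_arch_simple by blast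
    show ?thesis using eventually_ge_at_top[of n0]
    proof eventually_elim
      case (elim n)
      hence "real n0 \<le> real n" by simp
      thus ?case using n0 by (intro main) linarith
    qed
  qed
  ultimately have "gauss_mass * (\<integral>x. (f x)\<^sup>2 * weight \<mu> h N x \<partial>lebN N)
    \<le> C * (gauss_mass * (\<integral>x. g x * weight \<mu> h N x \<partial>lebN N)) + (0 + 0)"
    using tendsto_le[OF sequentially_bot] by blast
  hence "gauss_mass * (\<integral>x. (f x)\<^sup>2 * weight \<mu> h N x \<partial>lebN N)
    \<le> gauss_mass * (C * (\<integral>x. g x * weight \<mu> h N x \<partial>lebN N))" by (simp add: mult_ac)
  hence "(\<integral>x. (f x)\<^sup>2 * weight \<mu> h N x \<partial>lebN N) \<le> C * (\<integral>x. g x * weight \<mu> h N x \<partial>lebN N)"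
    using gauss_mass_pos by simp
  also have "C = gap_const \<mu> * (h * real N)"
    unfolding C_def gap_const_def LC_def c_def c3_def c4_def c1_def c2_def by simp
  finally show ?thesis unfolding g_def by (simp only: mult.assoc)
qed

end

section \<open>Test functions\<close>

lemma fun_upd_RN [simp]: "x \<in> RN N \<Longrightarrow> k < N \<Longrightarrow> x(k := t) \<in> RN N"
  by (auto simp: RN_def PiE_iff extensional_def)

text \<open>Continuity refers to the product topology on all functions from \<open>nat\<close>.
  Beyond N the points of \<open>RN N\<close> are constantly \<open>undefined\<close>, so the
  inclusion into the full product is measurable, and there the product sets are the Borel
  sets.\<close>

lemma continuous_on_RN_measurable:
  fixes f :: "(nat \<Rightarrow> real) \<Rightarrow> real"
  assumes "continuous_on (RN N) f"
  shows "f \<in> borel_measurable (lebN N)"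
proof -
  have "(\<lambda>x. x) \<in> measurable (lebN N) (PiM UNIV (\<lambda>_. borel :: real measure))"
  proof (rule measurable_PiM_single')
    fix k :: nat
    show "(\<lambda>x. x k) \<in> measurable (lebN N) borel"
    proof (cases "k < N")
      case False
      have "(\<lambda>x::nat\<Rightarrow>real. x k) \<in> measurable (lebN N) borel \<longleftrightarrow> (\<lambda>x. undefined::real) \<in> measurable (lebN N) borel"
        using False by (intro measurable_cong) (auto simp: RN_def PiE_iff extensional_def)
      thus ?thesis by simp
    qed simp
  qed auto
  hence "(\<lambda>x. x) \<in> measurable (lebN N) (borel :: (nat \<Rightarrow> real) measure)"
    by (simp add: measurable_cong_sets[OF refl sets_PiM_equal_borel])
  hence "(\<lambda>x. x) \<in> measurable (lebN N) (restrict_space borel (RN N))"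
    by (intro measurable_restrict_space2) auto
  from measurable_compose[OF this borel_measurable_continuous_on_restrict[OF assms]] show ?thesis .
qed

lemma Cb_inf_iter: "Cb_inf N f \<Longrightarrow> k < N \<Longrightarrow> Cb_inf N (partial k f)"
  unfolding Cb_inf_def
proof (intro allI impI)
  fix ks
  assume *: "\<forall>ks. set ks \<subseteq> {..<N} \<longrightarrow> continuous_on (RN N) (iter_partial ks f) \<and>
      (\<exists>B. \<forall>x\<in>RN N. \<bar>iter_partial ks f x\<bar> \<le> B) \<and>
      (\<forall>k<N. \<forall>x\<in>RN N. (\<lambda>t. iter_partial ks f (x(k := t))) differentiable (at (x k)))"
    and "k < N" "set ks \<subseteq> {..<N}"
  moreover have "iter_partial ks (partial k f) = iter_partial (ks @ [k]) f"
    by (simp add: iter_partial_def)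
  ultimately show "continuous_on (RN N) (iter_partial ks (partial k f)) \<and>
      (\<exists>B. \<forall>x\<in>RN N. \<bar>iter_partial ks (partial k f) x\<bar> \<le> B) \<and>
      (\<forall>i<N. \<forall>x\<in>RN N. (\<lambda>t. iter_partial ks (partial k f) (x(i := t))) differentiable (at (x i)))"
    using *[rule_format, of "ks @ [k]"] by simp
qed

lemma Cb_inf_basic:
  assumes "Cb_inf N f"
  shows "f \<in> borel_measurable (lebN N)" "\<exists>B. \<forall>x\<in>RN N. \<bar>f x\<bar> \<le> B"
    and "k < N \<Longrightarrow> x \<in> RN N \<Longrightarrow> ((\<lambda>t. f (x(k := t))) has_real_derivative partial k f (x(k := s))) (at s)"
proof -
  have "set [] \<subseteq> {..<N}" by simp
  note base = assms[unfolded Cb_inf_def, rule_format, OF this, unfolded iter_partial_def foldr_Nil id_apply]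
  have *: "continuous_on (RN N) f" "\<exists>B. \<forall>x\<in>RN N. \<bar>f x\<bar> \<le> B"
      "\<And>k x. k < N \<Longrightarrow> x \<in> RN N \<Longrightarrow> (\<lambda>t. f (x(k := t))) differentiable (at (x k))"
    using base by blast+
  show "f \<in> borel_measurable (lebN N)" by (rule continuous_on_RN_measurable[OF *(1)])
  show "\<exists>B. \<forall>x\<in>RN N. \<bar>f x\<bar> \<le> B" by fact
  assume k: "k < N" "x \<in> RN N"
  have "(\<lambda>t. f (x(k := t))) differentiable (at s)"
    using *(3)[OF k(1) fun_upd_RN[OF k(2,1)], of s] by simp
  hence "((\<lambda>t. f (x(k := t))) has_real_derivative deriv (\<lambda>t. f (x(k := t))) s) (at s)"
    by (simp add: DERIV_deriv_iff_real_differentiable)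
  thus "((\<lambda>t. f (x(k := t))) has_real_derivative partial k f (x(k := s))) (at s)"
    by (simp add: partial_def)
qed

lemma Cb_inf_partial_bound:
  assumes f: "Cb_inf N f"
  shows "\<exists>B\<ge>0. \<forall>k<N. \<forall>x\<in>RN N. \<bar>partial k f x\<bar> \<le> B"
proof -
  have "\<exists>B. \<forall>k<N. \<forall>x\<in>RN N. \<bar>partial k f x\<bar> \<le> B k"
    using Cb_inf_basic(2)[OF Cb_inf_iter[OF f]] by metis
  then obtain B where B: "\<And>k x. k < N \<Longrightarrow> x \<in> RN N \<Longrightarrow> \<bar>partial k f x\<bar> \<le> B k" by blast
  have "\<bar>partial k f x\<bar> \<le> (\<Sum>k<N. \<bar>B k\<bar>)" if "k < N" "x \<in> RN N" for k x
  proof -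
    have "\<bar>partial k f x\<bar> \<le> \<bar>B k\<bar>" using B[OF that] by linarith
    also have "\<dots> \<le> (\<Sum>k<N. \<bar>B k\<bar>)" using that member_le_sum[of k "{..<N}" "\<lambda>k. \<bar>B k\<bar>"] by simp
    finally show ?thesis .
  qed
  thus ?thesis by (intro exI[of _ "\<Sum>k<N. \<bar>B k\<bar>"]) (simp add: sum_nonneg)
qed

lemma Cb_inf_coordinate_lipschitz:
  assumes f: "Cb_inf N f"
  shows "\<exists>L\<ge>0. \<forall>x\<in>RN N. \<forall>k<N. \<forall>t. \<bar>f (x(k := t)) - f x\<bar> \<le> L * \<bar>t - x k\<bar>"
proof -
  obtain L where L: "L \<ge> 0" "\<And>k x. k < N \<Longrightarrow> x \<in> RN N \<Longrightarrow> \<bar>partial k f x\<bar> \<le> L"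
    using Cb_inf_partial_bound[OF f] by blast
  have "\<bar>f (x(k := t)) - f x\<bar> \<le> L * \<bar>t - x k\<bar>" if x: "x \<in> RN N" and k: "k < N" for x k t
  proof -
    have "norm (f (x(k := t)) - f (x(k := x k))) \<le> L * norm (t - x k)"
    proof (rule field_differentiable_bound[where S = UNIV])
      show "((\<lambda>t. f (x(k := t))) has_real_derivative partial k f (x(k := s))) (at s within UNIV)" for s
        using Cb_inf_basic(3)[OF f k x] by simp
      show "norm (partial k f (x(k := s))) \<le> L" for s using L(2)[OF k fun_upd_RN[OF x k]] by simp
    qed auto
    thus ?thesis by simp
  qed
  thus ?thesis using L(1) by blast
qed

text \<open>Passes from x to y one coordinate at a time, so that partial derivatives are the only
  derivatives ever needed.\<close>

definition hybrid :: "nat \<Rightarrow> (nat \<Rightarrow> real) \<Rightarrow> (nat \<Rightarrow> real) \<Rightarrow> nat \<Rightarrow> real" where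
  "hybrid i y x = (\<lambda>k. if k < i then y k else x k)"

lemma hybrid_RN: "x \<in> RN N \<Longrightarrow> y \<in> RN N \<Longrightarrow> hybrid i y x \<in> RN N"
  by (auto simp: RN_def PiE_iff extensional_def hybrid_def)

lemma hybrid_Suc: "hybrid (Suc i) y x = (hybrid i y x)(i := y i)"
  by (auto simp: hybrid_def fun_eq_iff less_Suc_eq)

lemma hybrid_0 [simp]: "hybrid 0 y x = x"
  by (simp add: hybrid_def)

lemma hybrid_N: "x \<in> RN N \<Longrightarrow> y \<in> RN N \<Longrightarrow> hybrid N y x = y"
  by (auto simp: RN_def PiE_iff extensional_def hybrid_def fun_eq_iff)

lemma hybrid_lipschitz:
  assumes L: "\<And>x k t. x \<in> RN N \<Longrightarrow> k < N \<Longrightarrow> \<bar>f (x(k := t)) - f x\<bar> \<le> L * \<bar>t - x k\<bar>" "L \<ge> 0"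
    and xy: "x \<in> RN N" "y \<in> RN N" and i: "i \<le> N"
  shows "\<bar>f (hybrid i y x) - f x :: real\<bar> \<le> L * (\<Sum>j<N. \<bar>x j - y j\<bar>)"
proof -
  have "\<bar>f (hybrid i y x) - f x\<bar> \<le> L * (\<Sum>j<i. \<bar>x j - y j\<bar>)" using i
  proof (induction i)
    case (Suc i)
    have "\<bar>f (hybrid (Suc i) y x) - f (hybrid i y x)\<bar> \<le> L * \<bar>y i - hybrid i y x i\<bar>"
      unfolding hybrid_Suc using Suc.prems by (intro L hybrid_RN xy) simp
    hence 1: "\<bar>f (hybrid (Suc i) y x) - f (hybrid i y x)\<bar> \<le> L * \<bar>x i - y i\<bar>"
      by (simp add: hybrid_def abs_minus_commute)
    have "\<bar>f (hybrid i y x) - f x\<bar> \<le> L * (\<Sum>j<i. \<bar>x j - y j\<bar>)" using Suc by simp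
    with 1 have "\<bar>f (hybrid (Suc i) y x) - f x\<bar> \<le> L * (\<Sum>j<i. \<bar>x j - y j\<bar>) + L * \<bar>x i - y i\<bar>" by linarith
    thus ?case by (simp add: distrib_left)
  qed simp
  also have "\<dots> \<le> L * (\<Sum>j<N. \<bar>x j - y j\<bar>)" using i L(2) by (intro mult_left_mono sum_mono2) auto
  finally show ?thesis .
qed

text \<open>Telescoping along the hybrids leaves a one-variable mean value estimate per coordinate.
  The partials are Lipschitz, so their value on each segment differs from that at x by at most 2 L
  S, with S the l1 distance of x and y; Cauchy-Schwarz turns S^2 into squared differences.\<close>

lemma Cb_inf_taylor:
  assumes f: "Cb_inf N f"
  shows "\<exists>B. \<forall>x\<in>RN N. \<forall>y\<in>RN N.
    \<bar>f x - f y - (\<Sum>k<N. partial k f x * (x k - y k))\<bar> \<le> B * (\<Sum>k<N. (x k - y k)\<^sup>2)"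
proof -
  have "\<forall>k. \<exists>L. k < N \<longrightarrow> L \<ge> 0 \<and> (\<forall>x\<in>RN N. \<forall>j<N. \<forall>t. \<bar>partial k f (x(j := t)) - partial k f x\<bar> \<le> L * \<bar>t - x j\<bar>)"
    using Cb_inf_coordinate_lipschitz[OF Cb_inf_iter[OF f]] by blast
  then obtain M where M: "\<And>k. k < N \<Longrightarrow> M k \<ge> 0"
      "\<And>k x j t. k < N \<Longrightarrow> x \<in> RN N \<Longrightarrow> j < N \<Longrightarrow> \<bar>partial k f (x(j := t)) - partial k f x\<bar> \<le> M k * \<bar>t - x j\<bar>"
    by metis
  define L where "L = (\<Sum>k<N. M k)"
  have L0: "L \<ge> 0" unfolding L_def using M(1) by (intro sum_nonneg) auto
  have MleL: "M k \<le> L" if "k < N" for k unfolding L_def using M(1) that by (intro member_le_sum) auto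
  have L: "\<bar>partial k f (x(j := t)) - partial k f x\<bar> \<le> L * \<bar>t - x j\<bar>" if "k < N" "x \<in> RN N" "j < N" for k x j t
    using M(2)[OF that, of t] mult_right_mono[OF MleL[OF that(1)], of "\<bar>t - x j\<bar>"] by linarith
  have "\<bar>f x - f y - (\<Sum>k<N. partial k f x * (x k - y k))\<bar> \<le> 2 * L * real N * (\<Sum>k<N. (x k - y k)\<^sup>2)"
    if xy: "x \<in> RN N" "y \<in> RN N" for x y
  proof -
    define S where "S = (\<Sum>j<N. \<bar>x j - y j\<bar>)"
    have dS: "\<bar>x i - y i\<bar> \<le> S" if "i < N" for i
      unfolding S_def using that member_le_sum[of i "{..<N}" "\<lambda>j. \<bar>x j - y j\<bar>"] by simp
    have step: "\<bar>f (hybrid i y x) - f (hybrid (Suc i) y x) - partial i f x * (x i - y i)\<bar> \<le> 2 * L * S * \<bar>x i - y i\<bar>"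
      if i: "i < N" for i
    proof -
      define z where "z = hybrid i y x"
      have z: "z \<in> RN N" unfolding z_def by (rule hybrid_RN[OF xy])
      have zi: "z i = x i" unfolding z_def hybrid_def by simp
      have "norm ((f (z(i := x i)) - partial i f x * x i) - (f (z(i := y i)) - partial i f x * y i)) \<le> (2 * L * S) * norm (x i - y i)"
      proof (rule field_differentiable_bound[where S = "closed_segment (x i) (y i)"])
        show "((\<lambda>t. f (z(i := t)) - partial i f x * t) has_real_derivative partial i f (z(i := s)) - partial i f x)
            (at s within closed_segment (x i) (y i))" for s
          by (auto intro!: derivative_eq_intros has_field_derivative_at_within[OF Cb_inf_basic(3)[OF f i z]])
        show "norm (partial i f (z(i := s)) - partial i f x) \<le> 2 * L * S" if "s \<in> closed_segment (x i) (y i)" for s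
        proof -
          have "\<bar>s - x i\<bar> \<le> \<bar>x i - y i\<bar>" using that by (auto simp: closed_segment_eq_real_ivl split: if_splits)
          hence "\<bar>s - x i\<bar> \<le> S" using dS[OF i] by linarith
          hence "L * \<bar>s - z i\<bar> \<le> L * S" unfolding zi using L0 by (intro mult_left_mono) auto
          hence "\<bar>partial i f (z(i := s)) - partial i f z\<bar> \<le> L * S" using L[OF i z i, of s] by linarith
          moreover have "\<bar>partial i f z - partial i f x\<bar> \<le> L * S"
            unfolding z_def S_def using i by (intro hybrid_lipschitz L L0 xy) auto
          ultimately show ?thesis unfolding real_norm_def by linarith
        qed
      qed auto
      moreover have "z(i := x i) = z" using zi by auto
      ultimately show ?thesis unfolding hybrid_Suc z_def[symmetric] by (simp add: right_diff_distrib algebra_simps)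
    qed
    have tele: "f x - f y = (\<Sum>i<N. f (hybrid i y x) - f (hybrid (Suc i) y x))"
      using sum_lessThan_telescope'[of "\<lambda>i. f (hybrid i y x)" N] hybrid_N[OF xy] by simp
    have "\<bar>f x - f y - (\<Sum>k<N. partial k f x * (x k - y k))\<bar>
      = \<bar>\<Sum>i<N. f (hybrid i y x) - f (hybrid (Suc i) y x) - partial i f x * (x i - y i)\<bar>"
      unfolding tele by (simp add: sum_subtractf)
    also have "\<dots> \<le> (\<Sum>i<N. \<bar>f (hybrid i y x) - f (hybrid (Suc i) y x) - partial i f x * (x i - y i)\<bar>)" by (rule sum_abs)
    also have "\<dots> \<le> (\<Sum>i<N. 2 * L * S * \<bar>x i - y i\<bar>)" using step by (intro sum_mono) auto
    also have "\<dots> = 2 * L * S\<^sup>2" unfolding S_def by (simp add: sum_distrib_left power2_eq_square mult_ac)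
    also have "\<dots> \<le> 2 * L * (real N * (\<Sum>k<N. (x k - y k)\<^sup>2))"
    proof (rule mult_left_mono)
      show "S\<^sup>2 \<le> real N * (\<Sum>k<N. (x k - y k)\<^sup>2)"
        unfolding S_def using Cauchy_Schwarz_ineq_sum[of "\<lambda>_. 1" "\<lambda>j. \<bar>x j - y j\<bar>" "{..<N}"] by simp
    qed (use L0 in simp)
    finally show ?thesis by (simp add: mult.assoc)
  qed
  thus ?thesis by blast
qed

text \<open>A nonzero value persists, by the Lipschitz bound, on a box of positive measure. This
  makes the weighted square integral positive definite on the span of an independent family.\<close>

lemma Cb_inf_AE_zero:
  assumes f: "Cb_inf N f" and ae: "AE x in lebN N. f x = 0" and x: "x \<in> RN N"
  shows "f x = 0"
proof (rule ccontr)
  assume nz: "f x \<noteq> 0"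
  obtain L where L: "L \<ge> 0" "\<And>x k t. x \<in> RN N \<Longrightarrow> k < N \<Longrightarrow> \<bar>f (x(k := t)) - f x\<bar> \<le> L * \<bar>t - x k\<bar>"
    using Cb_inf_coordinate_lipschitz[OF f] by blast
  \<comment> \<open>On the box of half-width \<open>\<delta>\<close> the function changes by at most
    |f x| / 2; the +1 covers L = 0.\<close>
  define \<delta> where "\<delta> = \<bar>f x\<bar> / (2 * (L * real N + 1))"
  have den: "L * real N + 1 > 0" using L(1) by (intro add_nonneg_pos) auto
  have \<delta>: "\<delta> > 0" unfolding \<delta>_def using nz den by simp
  define Q where "Q = PiE {..<N} (\<lambda>k. {x k - \<delta>..x k + \<delta>})"
  have QN: "f y \<noteq> 0" "y \<in> RN N" if "y \<in> Q" for y
  proof -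
    show y: "y \<in> RN N" using that by (auto simp: Q_def RN_def PiE_iff)
    have "\<bar>f (hybrid N y x) - f x\<bar> \<le> L * (\<Sum>j<N. \<bar>x j - y j\<bar>)" by (rule hybrid_lipschitz[OF L(2,1) x y]) auto
    also have "\<dots> \<le> L * (\<Sum>j<N. \<delta>)" using that L(1)
      by (intro mult_left_mono sum_mono) (auto simp: Q_def PiE_iff abs_le_iff Ball_def algebra_simps)
    also have "\<dots> \<le> (L * real N + 1) * \<delta>" using \<delta> by (simp add: algebra_simps)
    also have "\<dots> = \<bar>f x\<bar> / 2"
    proof -
      have "D * (r / (2 * D)) = r / 2" if "D > 0" for D r :: real using that by simp
      from this[OF den] show ?thesis unfolding \<delta>_def .
    qed
    finally have "\<bar>f y - f x\<bar> \<le> \<bar>f x\<bar> / 2" unfolding hybrid_N[OF x y] .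
    thus "f y \<noteq> 0" using nz by auto
  qed
  obtain A where A: "{x \<in> space (lebN N). \<not> f x = 0} \<subseteq> A" "emeasure (lebN N) A = 0" "A \<in> sets (lebN N)"
    using ae by (rule AE_E)
  have "emeasure (lebN N) Q \<le> emeasure (lebN N) A" using QN A by (intro emeasure_mono) auto
  moreover have "emeasure (lebN N) Q = (\<Prod>k<N. emeasure lborel {x k - \<delta>..x k + \<delta>})"
    unfolding lebN_def Q_def by (rule lborel_PiM.emeasure_PiM) auto
  moreover have "\<dots> = (\<Prod>k<N. ennreal (2 * \<delta>))" using \<delta> by simp
  moreover have "\<dots> \<noteq> 0" using \<delta> by (simp add: prod_zero_iff ennreal_eq_0_iff)
  ultimately show False using A(2) by simp
qed

text \<open>A family closed under all partial derivatives, hence easily seen to be in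
  \<open>Cb_inf\<close>. It contains three independent functions, so the infimum in
  \<open>lambda_ev\<close> is not taken over the empty set.\<close>

definition trig_fun :: "real \<Rightarrow> real \<Rightarrow> real \<Rightarrow> (nat \<Rightarrow> real) \<Rightarrow> real" where
  "trig_fun u v w x = u * sin (x 0) + v * cos (x 0) + w"

lemma partial_trig_fun: "\<exists>u' v' w'. partial k (trig_fun u v w) = trig_fun u' v' w'"
proof (cases "k = 0")
  case True
  have "partial k (trig_fun u v w) = trig_fun (- v) u 0"
  proof
    fix x
    have "((\<lambda>t. trig_fun u v w (x(0 := t))) has_real_derivative trig_fun (- v) u 0 x) (at (x 0))"
      unfolding trig_fun_def by (auto intro!: derivative_eq_intros)
    thus "partial k (trig_fun u v w) x = trig_fun (- v) u 0 x"
      unfolding partial_def True by (rule DERIV_imp_deriv)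
  qed
  thus ?thesis by blast
next
  case False
  have "partial k (trig_fun u v w) = trig_fun 0 0 0"
    using False by (auto simp: partial_def trig_fun_def fun_eq_iff)
  thus ?thesis by blast
qed

lemma Cb_inf_trig_fun: "Cb_inf N (trig_fun u v w)"
proof -
  have iter: "\<exists>u' v' w'. iter_partial ks (trig_fun u v w) = trig_fun u' v' w'" for ks
  proof (induction ks)
    case Nil show ?case by (auto simp: iter_partial_def)
  next
    case (Cons k ks)
    then obtain u' v' w' where "iter_partial ks (trig_fun u v w) = trig_fun u' v' w'" by blast
    hence "iter_partial (k # ks) (trig_fun u v w) = partial k (trig_fun u' v' w')" by (simp add: iter_partial_def)
    thus ?case using partial_trig_fun by simp
  qed
  show ?thesis unfolding Cb_inf_def
  proof (intro allI impI)
    fix ks :: "nat list"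
    obtain u' v' w' where eq: "iter_partial ks (trig_fun u v w) = trig_fun u' v' w'" using iter by blast
    have "continuous_on (RN N) (trig_fun u' v' w')" unfolding trig_fun_def
      by (intro continuous_intros continuous_on_subset[OF continuous_on_product_coordinates[of 0]]) auto
    moreover have "\<bar>trig_fun u' v' w' x\<bar> \<le> \<bar>u'\<bar> + \<bar>v'\<bar> + \<bar>w'\<bar>" for x
    proof -
      have "\<bar>u' * sin (x 0)\<bar> \<le> \<bar>u'\<bar>" "\<bar>v' * cos (x 0)\<bar> \<le> \<bar>v'\<bar>"
        by (simp_all add: abs_mult mult_left_le)
      thus ?thesis unfolding trig_fun_def by linarith
    qed
    moreover have "(\<lambda>t. trig_fun u' v' w' (x(k := t))) differentiable (at (x k))" for x k
    proof (cases "k = 0")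
      case True
      have "((\<lambda>t. trig_fun u' v' w' (x(0 := t))) has_real_derivative trig_fun (- v') u' 0 x) (at (x 0))"
        unfolding trig_fun_def by (auto intro!: derivative_eq_intros)
      thus ?thesis unfolding True by (auto simp: real_differentiable_def)
    qed (simp add: trig_fun_def)
    ultimately show "continuous_on (RN N) (iter_partial ks (trig_fun u v w)) \<and>
      (\<exists>B. \<forall>x\<in>RN N. \<bar>iter_partial ks (trig_fun u v w) x\<bar> \<le> B) \<and>
      (\<forall>k<N. \<forall>x\<in>RN N. (\<lambda>t. iter_partial ks (trig_fun u v w) (x(k := t))) differentiable (at (x k)))"
      unfolding eq by blast
  qed
qed

text \<open>Homogeneity reduces the ratio to the compact unit sphere. It serves to show that the set
  of energies in \<open>kappa\<close> is bounded above, so that its members lie below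
  \<open>Sup\<close>.\<close>

lemma quadratic_ratio_bounded:
  fixes q e :: "'a::euclidean_space \<Rightarrow> real"
  assumes cont: "continuous_on UNIV q" "continuous_on UNIV e"
    and hom: "\<And>r v. q (r *\<^sub>R v) = r\<^sup>2 * q v" "\<And>r v. e (r *\<^sub>R v) = r\<^sup>2 * e v"
    and pos: "\<And>v. v \<noteq> 0 \<Longrightarrow> q v > 0"
  shows "\<exists>B. \<forall>v. q v = 1 \<longrightarrow> e v \<le> B"
proof -
  define S where "S = sphere (0::'a) 1"
  have S: "compact S" "S \<noteq> {}" unfolding S_def by simp_all
  have cS: "continuous_on S q" "continuous_on S e" using cont continuous_on_subset by blast+
  obtain u where u: "u \<in> S" "\<And>v. v \<in> S \<Longrightarrow> q u \<le> q v"
    using continuous_attains_inf[OF S cS(1)] by blast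
  obtain w where w: "w \<in> S" "\<And>v. v \<in> S \<Longrightarrow> e v \<le> e w"
    using continuous_attains_sup[OF S cS(2)] by blast
  have qu: "q u > 0" using u(1) by (intro pos) (auto simp: S_def)
  have "e v \<le> max (e w) 0 / q u" if v: "q v = 1" for v
  proof -
    define r where "r = norm v"
    define v' where "v' = v /\<^sub>R r"
    have "v \<noteq> 0" using hom(1)[of 0 v] v by auto
    hence r: "r > 0" and v': "v' \<in> S" "v = r *\<^sub>R v'" unfolding r_def v'_def S_def by auto
    have "r\<^sup>2 * q u \<le> r\<^sup>2 * q v'" using u(2)[OF v'(1)] by (intro mult_left_mono) auto
    also have "\<dots> = 1" using v hom(1)[of r v'] v'(2) by simp
    finally have r2: "r\<^sup>2 \<le> 1 / q u" using qu by (simp add: field_simps)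
    have "e v = r\<^sup>2 * e v'" using hom(2)[of r v'] v'(2) by simp
    also have "\<dots> \<le> r\<^sup>2 * max (e w) 0" using w(2)[OF v'(1)] by (intro mult_left_mono) auto
    also have "\<dots> \<le> (1 / q u) * max (e w) 0" by (intro mult_right_mono r2) auto
    finally show ?thesis by simp
  qed
  thus ?thesis by blast
qed

lemma integral_square_sum:
  fixes w :: "'b \<Rightarrow> real"
  assumes "\<And>i j. i < m \<Longrightarrow> j < m \<Longrightarrow> integrable M (\<lambda>x. u i x * u j x * w x)"
  shows "(\<integral>x. (\<Sum>i<m. c i * u i x)\<^sup>2 * w x \<partial>M)
    = (\<Sum>i<(m::nat). \<Sum>j<m. c i * c j * (\<integral>x. u i x * u j x * w x \<partial>M))"
proof -
  have "(\<Sum>i<m. c i * u i x)\<^sup>2 * w x = (\<Sum>i<m. \<Sum>j<m. c i * c j * (u i x * u j x * w x))" for x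
    unfolding power2_eq_square sum_product unfolding sum_distrib_right
    by (intro sum.cong refl) (simp only: mult_ac)
  hence "(\<integral>x. (\<Sum>i<m. c i * u i x)\<^sup>2 * w x \<partial>M) = (\<integral>x. (\<Sum>i<m. \<Sum>j<m. c i * c j * (u i x * u j x * w x)) \<partial>M)" by simp
  also have "\<dots> = (\<Sum>i<m. \<Sum>j<m. \<integral>x. c i * c j * (u i x * u j x * w x) \<partial>M)"
    using assms by (subst Bochner_Integration.integral_sum) (auto intro!: sum.cong Bochner_Integration.integral_sum)
  finally show ?thesis by simp
qed

section \<open>Lower bound for the third eigenvalue\<close>

text \<open>Additivity of \<open>deriv\<close> needs differentiability, which is only known at
  points of \<open>RN N\<close>. The induction over the list of partials therefore claims equality
  there and not as functions.\<close>

lemma Cb_inf_sum: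
  fixes g :: "nat \<Rightarrow> (nat \<Rightarrow> real) \<Rightarrow> real"
  assumes g: "\<And>i. i < m \<Longrightarrow> Cb_inf N (g i)"
  shows "Cb_inf N (\<lambda>x. \<Sum>i<m. c i * g i x)"
    and "k < N \<Longrightarrow> x \<in> RN N \<Longrightarrow> partial k (\<lambda>x. \<Sum>i<m. c i * g i x) x = (\<Sum>i<m. c i * partial k (g i) x)"
proof -
  let ?f = "\<lambda>x. \<Sum>i<m. c i * g i x"
  have reg: "continuous_on (RN N) (iter_partial ks (g i))" "\<exists>B. \<forall>x\<in>RN N. \<bar>iter_partial ks (g i) x\<bar> \<le> B"
      "\<And>k x. k < N \<Longrightarrow> x \<in> RN N \<Longrightarrow> (\<lambda>t. iter_partial ks (g i) (x(k := t))) differentiable (at (x k))"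
    if "i < m" "set ks \<subseteq> {..<N}" for i ks
    using g[OF that(1), unfolded Cb_inf_def, rule_format, OF that(2)] by blast+
  have iter: "iter_partial ks ?f x = (\<Sum>i<m. c i * iter_partial ks (g i) x)"
    if "set ks \<subseteq> {..<N}" "x \<in> RN N" for ks x
    using that
  proof (induction ks arbitrary: x)
    case Nil show ?case by (simp add: iter_partial_def)
  next
    case (Cons k ks)
    hence k: "k < N" and ks: "set ks \<subseteq> {..<N}" by auto
    have eq: "iter_partial ks ?f (x(k := t)) = (\<Sum>i<m. c i * iter_partial ks (g i) (x(k := t)))" for t
      using Cons.IH[OF ks fun_upd_RN[OF Cons.prems(2) k]] .
    have d: "((\<lambda>t. iter_partial ks (g i) (x(k := t))) has_real_derivative iter_partial (k # ks) (g i) x) (at (x k))"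
      if "i < m" for i
      using reg(3)[OF that ks k Cons.prems(2)]
      by (simp add: iter_partial_def partial_def DERIV_deriv_iff_real_differentiable)
    have "((\<lambda>t. \<Sum>i<m. c i * iter_partial ks (g i) (x(k := t))) has_real_derivative
       (\<Sum>i<m. c i * iter_partial (k # ks) (g i) x)) (at (x k))"
      by (intro DERIV_sum DERIV_cmult d) auto
    hence "deriv (\<lambda>t. iter_partial ks ?f (x(k := t))) (x k) = (\<Sum>i<m. c i * iter_partial (k # ks) (g i) x)"
      unfolding eq by (rule DERIV_imp_deriv)
    moreover have "iter_partial (k # ks) ?f x = deriv (\<lambda>t. iter_partial ks ?f (x(k := t))) (x k)"
      by (simp add: iter_partial_def partial_def)
    ultimately show ?case by simp
  qed
  show "Cb_inf N ?f" unfolding Cb_inf_def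
  proof (intro allI impI conjI ballI)
    fix ks assume ks: "set ks \<subseteq> {..<N}"
    have "continuous_on (RN N) (\<lambda>x. \<Sum>i<m. c i * iter_partial ks (g i) x)"
      by (intro continuous_intros reg(1) ks) auto
    thus "continuous_on (RN N) (iter_partial ks ?f)" by (simp add: iter[OF ks] cong: continuous_on_cong)
    have "\<exists>B. \<forall>i<m. \<forall>x\<in>RN N. \<bar>iter_partial ks (g i) x\<bar> \<le> B i" using reg(2)[OF _ ks] by metis
    then obtain B where B: "\<And>i x. i < m \<Longrightarrow> x \<in> RN N \<Longrightarrow> \<bar>iter_partial ks (g i) x\<bar> \<le> B i" by blast
    have "\<bar>iter_partial ks ?f x\<bar> \<le> (\<Sum>i<m. \<bar>c i\<bar> * B i)" if x: "x \<in> RN N" for x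
    proof -
      have "\<bar>iter_partial ks ?f x\<bar> \<le> (\<Sum>i<m. \<bar>c i * iter_partial ks (g i) x\<bar>)"
        unfolding iter[OF ks x] by (rule sum_abs)
      also have "\<dots> \<le> (\<Sum>i<m. \<bar>c i\<bar> * B i)" unfolding abs_mult using B x by (intro sum_mono mult_left_mono) auto
      finally show ?thesis .
    qed
    thus "\<exists>B. \<forall>x\<in>RN N. \<bar>iter_partial ks ?f x\<bar> \<le> B" by blast
    fix k x assume k: "k < N" and x: "x \<in> RN N"
    have "(\<lambda>t. iter_partial ks ?f (x(k := t))) = (\<lambda>t. \<Sum>i<m. c i * iter_partial ks (g i) (x(k := t)))"
      using iter[OF ks fun_upd_RN[OF x k]] by auto
    thus "(\<lambda>t. iter_partial ks ?f (x(k := t))) differentiable (at (x k))"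
      using reg(3)[OF _ ks k x] by (simp only:) (intro differentiable_sum differentiable_mult differentiable_const ballI; simp)
  qed
  assume "k < N" "x \<in> RN N"
  thus "partial k ?f x = (\<Sum>i<m. c i * partial k (g i) x)" using iter[of "[k]" x] by (simp add: iter_partial_def)
qed

text \<open>Coefficient vectors live in a Euclidean type so that compactness of the sphere and
  orthogonal complements are available.\<close>

definition triple :: "real \<times> real \<times> real \<Rightarrow> nat \<Rightarrow> real" where
  "triple v i = (if i = 0 then fst v else if i = 1 then fst (snd v) else snd (snd v))"

lemma triple_scale: "triple (r *\<^sub>R v) i = r * triple v i"
  by (simp add: triple_def)

lemma continuous_on_triple: "continuous_on A (\<lambda>v. triple v i)"
  unfolding triple_def by (cases "i = 0"; cases "i = 1") (auto intro!: continuous_intros)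

lemma sum_lessThan_3: "(\<Sum>i<3::nat. t i) = t 0 + t 1 + (t 2 :: 'a::comm_monoid_add)"
  by (simp add: eval_nat_numeral add_ac)

text \<open>Two vectors span at most a plane, and this leaves a nonzero orthogonal direction in
  dimension three.\<close>

lemma exists_triple_orthogonal:
  "\<exists>v::real \<times> real \<times> real. v \<noteq> 0 \<and> (\<Sum>i<3. triple v i * \<alpha> i) = 0 \<and> (\<Sum>i<3. triple v i * \<beta> i) = 0"
proof -
  define A where "A = (\<alpha> 0, \<alpha> 1, \<alpha> (2::nat) :: real)"
  define B where "B = (\<beta> 0, \<beta> 1, \<beta> (2::nat) :: real)"
  have "dim {A, B} \<le> card {A, B}" by (intro dim_le_card) (auto intro: span_base)
  also have "\<dots> \<le> 2" by (simp add: card_insert_if)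
  finally have "dim {A, B} < DIM(real \<times> real \<times> real)" by simp
  then obtain v where v: "v \<noteq> 0" "\<And>y. y \<in> span {A, B} \<Longrightarrow> orthogonal v y"
    using orthogonal_to_subspace_exists by blast
  have "orthogonal v A" "orthogonal v B" by (rule v(2), rule span_base, simp)+
  hence "v \<bullet> A = 0" "v \<bullet> B = 0" by (simp_all add: orthogonal_def)
  thus ?thesis using v(1) unfolding A_def B_def
    by (intro exI[of _ v]) (cases v, auto simp: sum_lessThan_3 triple_def)
qed

context chain
begin

text \<open>The span contains a normalised function on which \<open>K 1\<close> and
  \<open>K (-1)\<close> vanish; its energy is at least 1 / \<open>gap_const \<mu>\<close> and
  belongs to the set whose supremum is \<open>kappa\<close>.\<close>

lemma kappa_lower_bound:
  fixes g :: "nat \<Rightarrow> (nat \<Rightarrow> real) \<Rightarrow> real"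
  assumes h0: "h \<le> small_h \<mu>" and g: "\<And>i. i < 3 \<Longrightarrow> Cb_inf N (g i)" and ind: "lin_indep_on N 3 g"
  shows "1 / gap_const \<mu> \<le> kappa \<mu> h N 3 g"
proof -
  define f where "f v x = (\<Sum>i<3. triple v i * g i x)" for v x
  have Cf: "Cb_inf N (f v)" for v unfolding f_def[abs_def] by (rule Cb_inf_sum(1)[OF g])
  have pf: "partial k (f v) x = (\<Sum>i<3. triple v i * partial k (g i) x)" if "k < N" "x \<in> RN N" for k v x
    unfolding f_def[abs_def] by (rule Cb_inf_sum(2)[OF g that])
  have eb: "egrowth N q" if q: "Cb_inf N q" for q
  proof -
    obtain b where "\<And>x. x \<in> RN N \<Longrightarrow> \<bar>q x\<bar> \<le> b" using Cb_inf_basic(2)[OF q] by blast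
    thus ?thesis by (rule egrowth_bounded[OF Cb_inf_basic(1)[OF q]])
  qed
  define G where "G i j = (\<integral>x. g i x * g j x * weight \<mu> h N x \<partial>lebN N)" for i j
  define H where "H k i j = (\<integral>x. partial k (g i) x * partial k (g j) x * weight \<mu> h N x \<partial>lebN N)" for k i j
  have q: "wnorm2 \<mu> h N (f v) = (\<Sum>i<3. \<Sum>j<3. triple v i * triple v j * G i j)" for v
    unfolding wnorm2_def f_def G_def
    by (rule integral_square_sum) (intro integrable_egrowth_weight egrowth_mult eb g)
  have e: "energy \<mu> h N (f v) = h * real N * (\<Sum>k<N. \<Sum>i<3. \<Sum>j<3. triple v i * triple v j * H k i j)" for v
  proof -
    have ep: "egrowth N (partial k (f v))" if "k < N" for k using eb[OF Cb_inf_iter[OF Cf that]] .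
    have "(\<integral>x. (\<Sum>k<N. (partial k (f v) x)\<^sup>2) * weight \<mu> h N x \<partial>lebN N)
      = (\<Sum>k<N. \<integral>x. (partial k (f v) x)\<^sup>2 * weight \<mu> h N x \<partial>lebN N)"
      unfolding sum_distrib_right
      by (intro Bochner_Integration.integral_sum integrable_egrowth_weight egrowth_power ep) simp
    also have "\<dots> = (\<Sum>k<N. \<Sum>i<3. \<Sum>j<3. triple v i * triple v j * H k i j)"
    proof (intro sum.cong refl)
      fix k assume "k \<in> {..<N}"
      hence k: "k < N" by simp
      have "(\<integral>x. (partial k (f v) x)\<^sup>2 * weight \<mu> h N x \<partial>lebN N)
        = (\<integral>x. (\<Sum>i<3. triple v i * partial k (g i) x)\<^sup>2 * weight \<mu> h N x \<partial>lebN N)"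
        by (intro Bochner_Integration.integral_cong refl) (simp add: pf[OF k])
      also have "\<dots> = (\<Sum>i<3. \<Sum>j<3. triple v i * triple v j * H k i j)"
        unfolding H_def
        by (rule integral_square_sum) (intro integrable_egrowth_weight egrowth_mult eb Cb_inf_iter g k)
      finally show "(\<integral>x. (partial k (f v) x)\<^sup>2 * weight \<mu> h N x \<partial>lebN N)
        = (\<Sum>i<3. \<Sum>j<3. triple v i * triple v j * H k i j)" .
    qed
    finally show ?thesis unfolding energy_def by simp
  qed
  have scale: "f (r *\<^sub>R v) x = r * f v x" for r v x
    unfolding f_def triple_scale by (simp add: sum_distrib_left mult.assoc)
  have qhom: "wnorm2 \<mu> h N (f (r *\<^sub>R v)) = r\<^sup>2 * wnorm2 \<mu> h N (f v)" for r v
    unfolding q triple_scale sum_distrib_left by (intro sum.cong refl) (simp add: power2_eq_square mult_ac)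
  have ehom: "energy \<mu> h N (f (r *\<^sub>R v)) = r\<^sup>2 * energy \<mu> h N (f v)" for r v
    unfolding e triple_scale sum_distrib_left by (intro sum.cong refl) (simp add: power2_eq_square mult_ac)
  have qpos: "wnorm2 \<mu> h N (f v) > 0" if v: "v \<noteq> 0" for v
  proof -
    have int: "integrable (lebN N) (\<lambda>x. (f v x)\<^sup>2 * weight \<mu> h N x)"
      by (intro integrable_egrowth_weight egrowth_power eb Cf)
    have nn: "AE x in lebN N. 0 \<le> (f v x)\<^sup>2 * weight \<mu> h N x" by (intro AE_I2) (simp add: weight_def)
    have "wnorm2 \<mu> h N (f v) \<noteq> 0"
    proof
      assume "wnorm2 \<mu> h N (f v) = 0"
      hence "AE x in lebN N. (f v x)\<^sup>2 * weight \<mu> h N x = 0"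
        unfolding wnorm2_def using integral_nonneg_eq_0_iff_AE[OF int nn] by simp
      hence "AE x in lebN N. f v x = 0" by (rule eventually_mono) (simp add: weight_def)
      hence "\<forall>x\<in>RN N. (\<Sum>i<3. triple v i * g i x) = 0"
        using Cb_inf_AE_zero[OF Cf[of v]] unfolding f_def by blast
      hence t: "triple v i = 0" if "i < 3" for i using ind that unfolding lin_indep_on_def by blast
      have "v = 0" using t[of 0] t[of 1] t[of 2] by (cases v) (auto simp: triple_def zero_prod_def)
      thus False using v by simp
    qed
    moreover have "wnorm2 \<mu> h N (f v) \<ge> 0" unfolding wnorm2_def using nn by (rule integral_nonneg_AE)
    ultimately show ?thesis by simp
  qed
  have cq: "continuous_on UNIV (\<lambda>v. wnorm2 \<mu> h N (f v))" unfolding q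
    by (intro continuous_intros continuous_on_triple)
  have ce: "continuous_on UNIV (\<lambda>v. energy \<mu> h N (f v))" unfolding e
    by (intro continuous_intros continuous_on_triple)
  obtain Bd where Bd: "\<And>v. wnorm2 \<mu> h N (f v) = 1 \<Longrightarrow> energy \<mu> h N (f v) \<le> Bd"
    using quadratic_ratio_bounded[OF cq ce qhom ehom qpos] by blast
  define S where "S = {energy \<mu> h N f | f. (\<exists>c::nat \<Rightarrow> real. f = (\<lambda>x. \<Sum>i<3. c i * g i x)) \<and> wnorm2 \<mu> h N f = 1}"
  have bdd: "bdd_above S"
  proof (rule bdd_aboveI)
    fix y assume "y \<in> S"
    then obtain c :: "nat \<Rightarrow> real" where c: "y = energy \<mu> h N (\<lambda>x. \<Sum>i<3. c i * g i x)"
      "wnorm2 \<mu> h N (\<lambda>x. \<Sum>i<3. c i * g i x) = 1" unfolding S_def by blast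
    have "(\<lambda>x. \<Sum>i<3. c i * g i x) = f (c 0, c 1, c 2)"
      unfolding f_def by (simp add: sum_lessThan_3 triple_def fun_eq_iff)
    thus "y \<le> Bd" using c Bd by simp
  qed
  obtain v where v: "v \<noteq> 0" "(\<Sum>i<3. triple v i * K 1 (g i)) = 0" "(\<Sum>i<3. triple v i * K (-1) (g i)) = 0"
    using exists_triple_orthogonal[of "\<lambda>i. K 1 (g i)" "\<lambda>i. K (-1) (g i)"] by blast
  define r where "r = 1 / sqrt (wnorm2 \<mu> h N (f v))"
  define F where "F = f (r *\<^sub>R v)"
  have F1: "wnorm2 \<mu> h N F = 1" unfolding F_def qhom r_def using qpos[OF v(1)] by (simp add: power_divide)
  have "energy \<mu> h N F \<in> S" unfolding S_def using F1 unfolding F_def f_def by blast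
  hence "energy \<mu> h N F \<le> Sup S" using bdd by (rule cSup_upper)
  also have "Sup S = kappa \<mu> h N 3 g" unfolding S_def kappa_def ..
  finally have le: "energy \<mu> h N F \<le> kappa \<mu> h N 3 g" .
  have KF: "K \<xi> F = r * (\<Sum>i<3. triple v i * K \<xi> (g i))" for \<xi>
  proof -
    have "K \<xi> F = K \<xi> (\<lambda>x. r * (\<Sum>i<3. triple v i * g i x))" unfolding F_def scale[abs_def] by (simp add: f_def)
    also have "\<dots> = r * K \<xi> (\<lambda>x. \<Sum>i<3. triple v i * g i x)" by (rule K_cmult)
    also have "K \<xi> (\<lambda>x. \<Sum>i<3. triple v i * g i x) = (\<Sum>i<3. K \<xi> (\<lambda>x. triple v i * g i x))"
      by (intro K_sum egrowth_mult egrowth_const eb g) simp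
    finally show ?thesis by (simp only: K_cmult)
  qed
  have K0: "K 1 F = 0" "K (-1) F = 0" unfolding KF using v by simp_all
  have CF: "Cb_inf N F" unfolding F_def by (rule Cf)
  obtain F0 where F0: "\<And>x. x \<in> RN N \<Longrightarrow> \<bar>F x\<bar> \<le> F0" using Cb_inf_basic(2)[OF CF] by blast
  obtain P0 where P0: "\<And>k x. k < N \<Longrightarrow> x \<in> RN N \<Longrightarrow> \<bar>partial k F x\<bar> \<le> P0" using Cb_inf_partial_bound[OF CF] by blast
  obtain B where B: "\<And>x y. x \<in> RN N \<Longrightarrow> y \<in> RN N \<Longrightarrow>
      \<bar>F x - F y - (\<Sum>k<N. partial k F x * (x k - y k))\<bar> \<le> B * (\<Sum>k<N. (x k - y k)\<^sup>2)"
    using Cb_inf_taylor[OF CF] by blast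
  have "(\<integral>x. (F x)\<^sup>2 * weight \<mu> h N x \<partial>lebN N)
    \<le> gap_const \<mu> * (h * real N * (\<integral>x. (\<Sum>k<N. (partial k F x)\<^sup>2) * weight \<mu> h N x \<partial>lebN N))"
  proof (rule poincare_two_constraints[OF h0 Cb_inf_basic(1)[OF CF] F0 _ P0 _ K0])
    show "partial k F \<in> borel_measurable (lebN N)" if "k < N" for k
      by (rule Cb_inf_basic(1)[OF Cb_inf_iter[OF CF that]])
    show "F x - F y \<le> (\<Sum>k<N. partial k F x * (x k - y k)) + B * (\<Sum>k<N. (x k - y k)\<^sup>2)"
      if "x \<in> RN N" "y \<in> RN N" for x y
      using B[OF that] unfolding abs_le_iff by linarith
  qed
  hence "1 \<le> gap_const \<mu> * energy \<mu> h N F" using F1 unfolding wnorm2_def energy_def by simp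
  hence "1 / gap_const \<mu> \<le> energy \<mu> h N F" using gap_consts_pos(4)[OF \<mu>] by (simp add: field_simps)
  thus ?thesis using le by linarith
qed

lemma lin_indep_on_trig:
  "lin_indep_on N 3 (\<lambda>i. if i = 0 then trig_fun 0 0 1 else if i = 1 then trig_fun 1 0 0 else trig_fun 0 1 0)"
  unfolding lin_indep_on_def
proof (intro allI impI)
  fix c :: "nat \<Rightarrow> real" and i :: nat
  assume z: "\<forall>x\<in>RN N. (\<Sum>i<3. c i * (if i = 0 then trig_fun 0 0 1 else if i = 1 then trig_fun 1 0 0 else trig_fun 0 1 0) x) = 0"
    and i: "i < 3"
  have eq: "c 0 + c 1 * sin t + c 2 * cos t = 0" for t
    using z[rule_format, of "\<lambda>k\<in>{..<N}. t"] N by (simp add: sum_lessThan_3 trig_fun_def RN_def)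
  \<comment> \<open>On the diagonal, t = 0, pi and pi / 2 give three independent equations.\<close>
  have "c 0 = 0 \<and> c 1 = 0 \<and> c 2 = 0" using eq[of 0] eq[of pi] eq[of "pi/2"] by simp
  moreover have "i = 0 \<or> i = 1 \<or> i = 2" using i by auto
  ultimately show "c i = 0" by auto
qed

lemma lambda_ev_lower_bound:
  assumes "h \<le> small_h \<mu>"
  shows "1 / gap_const \<mu> \<le> lambda_ev \<mu> h N 2"
proof -
  have 3: "2 + 1 = (3::nat)" by simp
  show ?thesis unfolding lambda_ev_def 3
  proof (rule cInf_greatest)
    define g where "g = (\<lambda>i::nat. if i = 0 then trig_fun 0 0 1 else if i = 1 then trig_fun 1 0 0 else trig_fun 0 1 0)"
    have "\<forall>i<3. Cb_inf N (g i)" unfolding g_def by (simp add: Cb_inf_trig_fun)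
    moreover have "lin_indep_on N 3 g" unfolding g_def by (rule lin_indep_on_trig)
    ultimately show "{kappa \<mu> h N 3 g |g. (\<forall>i<3. Cb_inf N (g i)) \<and> lin_indep_on N 3 g} \<noteq> {}" by blast
  qed (use kappa_lower_bound[OF assms] in blast)
qed

end

theorem theorem2p1:
  fixes \<mu> :: real
  assumes "\<mu> > 1"
  shows "\<exists>C h0. C > 0 \<and> h0 > 0 \<and>
           (\<forall>h. 0 < h \<and> h \<le> h0 \<longrightarrow> (\<forall>N::nat. N \<ge> 1 \<longrightarrow> lambda_ev \<mu> h N 2 \<ge> C))"
proof (intro exI conjI allI impI)
  show "1 / gap_const \<mu> > 0" "small_h \<mu> > 0" using gap_consts_pos[OF assms] by auto
  fix h :: real and N :: nat
  assume "0 < h \<and> h \<le> small_h \<mu>" "N \<ge> 1"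
  then interpret chain \<mu> h N by unfold_locales (use assms in auto)
  show "lambda_ev \<mu> h N 2 \<ge> 1 / gap_const \<mu>"
    using lambda_ev_lower_bound \<open>0 < h \<and> h \<le> small_h \<mu>\<close> by simp
qed

end
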